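(* Let $R>0$ and let $J_\lambda$ be the functional $$J_\lambda(W^h)=\left\|\Big(D_N^hW_y^h+\sum_{i=1}^nA_i^hW_{x_i}^h+F^h(W^h(\mathbf{x}^h),\mathbf{x}^h)\Big)e^{\lambda y}\right\|^2_{L_N^{2,h}(\Omega^h)}.$$ The following three assertions hold. 1. The functional $J_\lambda$ has the Fréchet derivative $J_\lambda'(W^h)\in H_{N,0}^{1,h}(\Omega^h)$ at any point $W^h\in\overline{B(R,P^h)}$ and for any $\lambda\ge0$. It satisfies the Lipschitz condition $$\|J_\lambda'(W_1^h)-J_\lambda'(W_2^h)\|_{H_N^{1,h}(\Omega^h)}\le C_4\|W_1^h-W_2^h\|_{H_N^{1,h}(\Omega^h)},\quad\forall W_1^h,W_2^h\in\overline{B(R,P^h)},$$ for all $\lambda\ge0$, where the number $C_4>0$ depends on the same parameters as $C_3$ as well as on $\lambda$. Assume now that $a\ge a_0$. Then: 2. There exists a sufficiently large number $\lambda_1=\lambda_1(R,A,d,N,a,b,h_0)\ge\lambda_0\ge1$ depending only on the listed parameters such that $J_\lambda$ is strictly convex on $\overline{B(R,P^h)}$ for all $\lambda\ge\lambda_1$, i.e. $$J_\lambda(W_2^h)-J_\lambda(W_1^h)-J_\lambda'(W_1^h)(W_2^h-W_1^h)\ge C_3e^{2\lambda a}\|W_2^h-W_1^h\|^2_{H_N^{1,h}(\Omega^h)},\quad\forall\lambda\ge\lambda_1,\ \forall W_1^h,W_2^h\in\overline{B(R,P^h)}.$$ 3. For each $\lambda\ge\lambda_1$ there exists a unique minimizer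 $W^h_{\min,\lambda}\in\overline{B(R,P^h)}$ of $J_\lambda$ on the set $\overline{B(R,P^h)}$. Furthermore, $$J_\lambda'(W^h_{\min,\lambda})(W^h-W^h_{\min,\lambda})\ge0,\quad\forall W^h\in\overline{B(R,P^h)}.$$
   Context: Geometry and data. $n\ge1$, $N\ge1$, $m>1$ are integers; $A,d>0$, $1<a<b$ are numbers; points of $\mathbb{R}^{n+1}$ are $\mathbf{x}=(x_1,\dots,x_n,y)$; $\Omega=\{-A<x_1,\dots,x_n<A,\ a<y<b\}$. For $\alpha\in[-d,d]$, $\mathbf{x}_\alpha=(\alpha,0,\dots,0)$ and $\nu(\mathbf{x},\alpha)=\frac{\mathbf{x}-\mathbf{x}_\alpha}{|\mathbf{x}-\mathbf{x}_\alpha|}=(\nu_1,\dots,\nu_{n+1})$. $K\ge0$, $K\in C^2(\overline\Omega\times[-d,d]^2)$; $\mu_s\in C^2(\mathbb{R}^{n+1})$, $\mu_s\ge0$, $\mu_s=0$ outside $\Omega$. The dimension $n$, the functions $K,\mu_s$ and the arbitrary number $R>0$ are given and fixed. Matrices and nonlinearity. $\{\Psi_r\}_{r\ge0}$ is the orthonormal basis of $L_2(-d,d)$ obtained by Gram–Schmidt from $\{\alpha^r e^\alpha\}_{r\ge0}$. For $k,r=0,\dots,N-1$ (row $k$, column $r$): $(M_N)_{kr}=\int_{-d}^d\Psi_r'\Psi_k\,d\alpha$, $(A_{n+1}(\mathbf{x}))_{kr}=\int_{-d}^d\frac{\partial_\alpha\nu_{n+1}}{\nu_{n+1}}\Psi_r\Psi_k\,d\alpha$,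 $(A_i(\mathbf{x}))_{kr}=\int_{-d}^d\left[\frac{\nu_i}{\nu_{n+1}}\Psi_r'+\frac{\partial_\alpha\nu_i}{\nu_{n+1}}\Psi_r\right]\Psi_k\,d\alpha$ ($i=1,\dots,n$), $D_N=M_N+A_{n+1}$. For $W=(w_0,\dots,w_{N-1})^T\in\mathbb{R}^N$, $F(W,\mathbf{x})\in\mathbb{R}^N$ has components $$F_k(W,\mathbf{x})=-\int_{-d}^d\frac{\mu_s(\mathbf{x})}{\nu_{n+1}(\mathbf{x},\alpha)}\,\frac{\partial}{\partial\alpha}\left[e^{-\sum_rw_r\Psi_r(\alpha)}\int_{-d}^dK(\mathbf{x},\alpha,\beta)e^{\sum_rw_r\Psi_r(\beta)}d\beta\right]\Psi_k(\alpha)\,d\alpha .$$ The number $a_0=a_0(A,d,N)>1$ is such that for all $a\ge a_0$ the matrix $D_N(\mathbf{x})$ is invertible for every $\mathbf{x}\in\overline\Omega$, with $D_N^{-1}$ bounded on $\overline\Omega$ by a constant $C_3$. $D_N^h,A_i^h,F^h$ are the restrictions of $D_N,A_i,F$ to $\mathbf{x}=\mathbf{x}^h\in\Omega^h$ (below). Semi-discrete spaces. For $i=1,\dots,n$ let $-A=x_{i,0}<x_{i,1}<\dots<x_{i,m}=A$ be the uniform partition with step $h\ge h_0$, $h_0>0$ fixed. For $J=(j_1,\dots,j_n)\in\{0,\dots,m\}^n$ put $X_J=(x_{1,j_1},\dots,x_{n,j_n})$; $J$ is interior if $1\le j_i\le m-1$ for all $i$. $\Omega^h=\{(X_J,y):y\in(a,b)\}$,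 with points denoted $\mathbf{x}^h$. The boundary $\partial\Omega^h$ consists of the points $(X_J,a)$, $(X_J,b)$ and of the points $(X_J,y)$ with $J$ not interior. A semi-discrete vector function $Q^h$ is a family of functions $Q_J^h(y)=Q^h(X_J,y)\in\mathbb{R}^N$. At interior $J$, $Q^h_{x_k}=\frac{Q^h_{J+e_k}(y)-Q^h_{J-e_k}(y)}{2h}$, and $Q_y^h$ is the usual $y$-derivative; differential expressions are considered only at interior $J$. Norms: $\|Q^h\|^2_{L_N^{2,h}(\Omega^h)}=\sum_{J\text{ interior}}\int_a^b|Q_J^h|^2dy$, $\|Q^h\|^2_{H_N^{1,h}(\Omega^h)}=\sum_{J\text{ interior}}\sum_{k=1}^n\int_a^b[|Q_J^h|^2+|Q_{x_k}^h(X_J,y)|^2+|\partial_yQ_J^h|^2]dy$; the (Hilbert) spaces consist of the $Q^h$ with finite norms, and $H_{N,0}^{1,h}(\Omega^h)=\{Q^h\in H_N^{1,h}(\Omega^h):Q^h|_{\partial\Omega^h}=0\}$. $P^h$ is a given $N$-dimensional boundary vector function on $\partial\Omega^h$, and $B(R,P^h)=\{W^h\in H_N^{1,h}(\Omega^h):W^h|_{\partial\Omega^h}=P^h,\ \|W^h\|_{H_N^{1,h}(\Omega^h)}<R\}$, assumed nonempty. The Fréchet derivative is with respect to increments in $H_{N,0}^{1,h}(\Omega^h)$ and is identified via the Riesz theorem with an element $J_\lambda'(W^h)$ of $H_{N,0}^{1,h}(\Omega^h)$; $J'_\lambda(W^h)(v)$ is the scalar product of $J_\lambda'(W^h)$ and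 $v$. Constants. $C_3$ denotes positive constants, possibly different, depending only on $A,d,N,a,b,h_0,\|K\|_{C^1(\overline\Omega\times[-d,d]^2)}$. $\lambda_0=\lambda_0(A,d,N,a,b,h_0)\ge1$ is a number such that, for $a\ge a_0$ and $G_i^h=(D_N^h)^{-1}A_i^h$, one has $\|(W_y^h+\sum_iG_i^hW_{x_i}^h)e^{\lambda y}\|^2_{L_N^{2,h}}\ge C_3(\|W_y^he^{\lambda y}\|^2_{L_N^{2,h}}+\lambda^2\|W^he^{\lambda y}\|^2_{L_N^{2,h}})$ for all $W^h\in H_{N,0}^{1,h}(\Omega^h)$, $\lambda\ge\lambda_0$. *)

theory Defs
  imports "HOL-Analysis.Analysis"
begin

text \<open>
  Conventions. The dimension \<open>n\<close> is \<open>CARD('n)\<close> and the number \<open>N\<close> of basis functions is \<open>CARD('N)\<close>.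
  A point \<open>(x\<^sub>1, \<dots>, x\<^sub>n, y)\<close> is an element of \<open>(real^'n) \<times> real\<close>, whose norm is Euclidean.
  The library enumeration \<open>to_nat_on UNIV\<close> identifies a finite index type with \<open>{0..<CARD}\<close>;
  it fixes both the first coordinate direction and the order of rows and columns.
\<close>

definition idx :: "'k::finite \<Rightarrow> nat" where
  "idx = to_nat_on (UNIV :: 'k set)"

lemma bij_betw_idx: "bij_betw (idx :: 'k::finite \<Rightarrow> nat) UNIV {..<CARD('k)}"
  unfolding idx_def by (rule to_nat_on_finite) simp

definition first_coord :: "'n::finite" where
  "first_coord = inv idx 0"

definition Omega :: "real \<Rightarrow> real \<Rightarrow> real \<Rightarrow> ((real^'n::finite) \<times> real) set" where
  "Omega A a b = {x. (\<forall>i. - A < fst x $ i \<and> fst x $ i < A) \<and> a < snd x \<and> snd x < b}"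

definition source :: "real \<Rightarrow> (real^'n::finite) \<times> real" where
  "source \<alpha> = (axis first_coord \<alpha>, 0)"

definition nu :: "(real^'n::finite) \<times> real \<Rightarrow> real \<Rightarrow> (real^'n) \<times> real" where
  "nu x \<alpha> = (1 / norm (x - source \<alpha>)) *\<^sub>R (x - source \<alpha>)"

definition Kdom :: "real \<Rightarrow> real \<Rightarrow> real \<Rightarrow> real \<Rightarrow> (((real^'n::finite) \<times> real) \<times> real \<times> real) set" where
  "Kdom A d a b = closure (Omega A a b) \<times> {-d..d} \<times> {-d..d}"

text \<open>
  Class \<open>C\<^sup>2\<close> on a set: gradient \<open>g\<close> and continuous second derivative \<open>H\<close>. Derivatives are taken within
  \<open>S\<close>, so that on a closed box they are one-sided at the boundary; this is the same as
  requiring the interior derivatives of order at most two to extend continuously to the closed box.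
\<close>
definition C2_on :: "'a::euclidean_space set \<Rightarrow> ('a \<Rightarrow> real) \<Rightarrow> bool" where
  "C2_on S f \<longleftrightarrow> (\<exists>(g :: 'a \<Rightarrow> 'a) (H :: 'a \<Rightarrow> 'a \<Rightarrow>\<^sub>L 'a).
     (\<forall>x\<in>S. (f has_derivative (\<lambda>v. g x \<bullet> v)) (at x within S)) \<and>
     (\<forall>x\<in>S. (g has_derivative blinfun_apply (H x)) (at x within S)) \<and>
     continuous_on S H)"

definition C1_norm :: "'a::euclidean_space set \<Rightarrow> ('a \<Rightarrow> real) \<Rightarrow> real" where
  "C1_norm S f = (SUP x\<in>S. \<bar>f x\<bar>) +
     (\<Sum>i\<in>Basis. SUP x\<in>S. \<bar>frechet_derivative f (at x within S) i\<bar>)"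

text \<open>Gram--Schmidt in \<open>L\<^sub>2(-d,d)\<close> applied to the functions \<open>\<alpha> ^ r * exp \<alpha>\<close>.\<close>
function Psi :: "real \<Rightarrow> nat \<Rightarrow> real \<Rightarrow> real" where
  "Psi d r =
     (let g = (\<lambda>\<alpha>. \<alpha> ^ r * exp \<alpha> -
                 (\<Sum>s<r. integral {-d..d} (\<lambda>\<beta>. \<beta> ^ r * exp \<beta> * Psi d s \<beta>) * Psi d s \<alpha>))
      in (\<lambda>\<alpha>. g \<alpha> / sqrt (integral {-d..d} (\<lambda>\<beta>. (g \<beta>)\<^sup>2))))"
  by pat_completeness auto
termination by (relation "inv_image less_than snd") auto

declare Psi.simps [simp del]

definition M_mat :: "real \<Rightarrow> real^'N::finite^'N" where
  "M_mat d = (\<chi> k r. integral {-d..d} (\<lambda>\<alpha>. deriv (Psi d (idx r)) \<alpha> * Psi d (idx k) \<alpha>))"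

text \<open>The matrix \<open>A\<^sub>n\<^sub>+\<^sub>1\<close>, belonging to the variable \<open>y\<close>.\<close>
definition Ay_mat :: "real \<Rightarrow> (real^'n::finite) \<times> real \<Rightarrow> real^'N::finite^'N" where
  "Ay_mat d x = (\<chi> k r. integral {-d..d} (\<lambda>\<alpha>.
      deriv (\<lambda>t. snd (nu x t)) \<alpha> / snd (nu x \<alpha>) * Psi d (idx r) \<alpha> * Psi d (idx k) \<alpha>))"

definition A_mat :: "real \<Rightarrow> 'n::finite \<Rightarrow> (real^'n) \<times> real \<Rightarrow> real^'N::finite^'N" where
  "A_mat d i x = (\<chi> k r. integral {-d..d} (\<lambda>\<alpha>.
      (fst (nu x \<alpha>) $ i / snd (nu x \<alpha>) * deriv (Psi d (idx r)) \<alpha> +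
       deriv (\<lambda>t. fst (nu x t) $ i) \<alpha> / snd (nu x \<alpha>) * Psi d (idx r) \<alpha>) * Psi d (idx k) \<alpha>))"

definition D_mat :: "real \<Rightarrow> (real^'n::finite) \<times> real \<Rightarrow> real^'N::finite^'N" where
  "D_mat d x = M_mat d + Ay_mat d x"

text \<open>The value of \<open>deriv\<close> at the two end points \<open>\<plusminus>d\<close> may depend on how \<open>K\<close> is continued beyond
  its domain; this does not affect the outer integral.\<close>
definition F_vec :: "real \<Rightarrow> ((real^'n::finite) \<times> real \<Rightarrow> real) \<Rightarrow>
    (((real^'n) \<times> real) \<times> real \<times> real \<Rightarrow> real) \<Rightarrow>
    real^'N::finite \<Rightarrow> (real^'n) \<times> real \<Rightarrow> real^'N" where
  "F_vec d mus K W x = (\<chi> k. - integral {-d..d} (\<lambda>\<alpha>.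
      mus x / snd (nu x \<alpha>) *
      deriv (\<lambda>t. exp (- (\<Sum>r\<in>UNIV. W $ r * Psi d (idx r) t)) *
               integral {-d..d} (\<lambda>\<beta>. K (x, t, \<beta>) * exp (\<Sum>r\<in>UNIV. W $ r * Psi d (idx r) \<beta>))) \<alpha> *
      Psi d (idx k) \<alpha>))"

definition step :: "real \<Rightarrow> nat \<Rightarrow> real" where
  "step A m = 2 * A / real m"

definition grid_idx :: "nat \<Rightarrow> (nat^'n::finite) set" where
  "grid_idx m = {J. \<forall>i. J $ i \<le> m}"

definition interior_idx :: "nat \<Rightarrow> (nat^'n::finite) set" where
  "interior_idx m = {J. \<forall>i. 1 \<le> J $ i \<and> J $ i \<le> m - 1}"

definition grid_point :: "real \<Rightarrow> nat \<Rightarrow> nat^'n::finite \<Rightarrow> real \<Rightarrow> (real^'n) \<times> real" where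
  "grid_point A m J y = ((\<chi> i. - A + real (J $ i) * step A m), y)"

definition boundary_h :: "nat \<Rightarrow> real \<Rightarrow> real \<Rightarrow> ((nat^'n::finite) \<times> real) set" where
  "boundary_h m a b = {(J, y). J \<in> grid_idx m \<and> y \<in> {a..b} \<and> (J \<in> interior_idx m \<longrightarrow> y = a \<or> y = b)}"

lemma finite_interior_idx: "finite (interior_idx m :: (nat^'n::finite) set)"
proof -
  have "interior_idx m \<subseteq> vec_lambda ` (PiE (UNIV :: 'n set) (\<lambda>_. {..m}))"
  proof
    fix J :: "nat^'n"
    assume J: "J \<in> interior_idx m"
    have "vec_nth J \<in> PiE UNIV (\<lambda>_. {..m})"
      using J by (auto simp: interior_idx_def PiE_def intro: order_trans[OF _ diff_le_self])
    moreover have "J = vec_lambda (vec_nth J)" by simp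
    ultimately show "J \<in> vec_lambda ` (PiE (UNIV :: 'n set) (\<lambda>_. {..m}))" by blast
  qed
  thus ?thesis by (rule finite_subset) (intro finite_imageI finite_PiE; simp)
qed

type_synonym ('n, 'N) sdf = "nat^'n \<Rightarrow> real \<Rightarrow> real^'N"

definition L2_fun :: "real \<Rightarrow> real \<Rightarrow> (real \<Rightarrow> 'v::euclidean_space) \<Rightarrow> bool" where
  "L2_fun a b f \<longleftrightarrow> f \<in> borel_measurable (lebesgue_on {a..b}) \<and>
     (\<lambda>y. (norm (f y))\<^sup>2) integrable_on {a..b}"

text \<open>
  \<open>q\<close> is (the continuous representative of) an element of \<open>H\<^sup>1(a,b)\<close> with derivative \<open>g\<close>: it is
  the indefinite integral of a square integrable function \<open>g\<close>. Then \<open>q\<close> is absolutely continuous on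
  \<open>{a..b}\<close>, and \<open>g\<close> is its usual derivative almost everywhere. In particular \<open>g\<close> is unique up to a null
  set, so the choice in \<open>y_deriv\<close> does not affect any integral.
\<close>
definition H1_deriv :: "real \<Rightarrow> real \<Rightarrow> (real \<Rightarrow> 'v::euclidean_space) \<Rightarrow> (real \<Rightarrow> 'v) \<Rightarrow> bool" where
  "H1_deriv a b q g \<longleftrightarrow> L2_fun a b g \<and> (\<forall>y\<in>{a..b}. q y = q a + integral {a..y} g)"

definition y_deriv :: "real \<Rightarrow> real \<Rightarrow> ('n::finite, 'N::finite) sdf \<Rightarrow> ('n, 'N) sdf" where
  "y_deriv a b Q J = (SOME g. H1_deriv a b (Q J) g)"

text \<open>Used only for interior \<open>J\<close>, so that the subtraction of indices is not truncated.\<close>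
definition x_diff :: "real \<Rightarrow> nat \<Rightarrow> 'n::finite \<Rightarrow> ('n, 'N::finite) sdf \<Rightarrow> ('n, 'N) sdf" where
  "x_diff A m k Q J y = (1 / (2 * step A m)) *\<^sub>R (Q (J + axis k 1) y - Q (J - axis k 1) y)"

definition L2h_norm :: "nat \<Rightarrow> real \<Rightarrow> real \<Rightarrow> ('n::finite, 'N::finite) sdf \<Rightarrow> real" where
  "L2h_norm m a b Q = sqrt (\<Sum>J\<in>interior_idx m. integral {a..b} (\<lambda>y. (norm (Q J y))\<^sup>2))"

definition H1h_inner :: "real \<Rightarrow> nat \<Rightarrow> real \<Rightarrow> real \<Rightarrow>
    ('n::finite, 'N::finite) sdf \<Rightarrow> ('n, 'N) sdf \<Rightarrow> real" where
  "H1h_inner A m a b Q V = (\<Sum>J\<in>interior_idx m. \<Sum>k\<in>UNIV. integral {a..b} (\<lambda>y.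
      Q J y \<bullet> V J y + x_diff A m k Q J y \<bullet> x_diff A m k V J y + y_deriv a b Q J y \<bullet> y_deriv a b V J y))"

definition H1h_norm :: "real \<Rightarrow> nat \<Rightarrow> real \<Rightarrow> real \<Rightarrow> ('n::finite, 'N::finite) sdf \<Rightarrow> real" where
  "H1h_norm A m a b Q = sqrt (\<Sum>J\<in>interior_idx m. \<Sum>k\<in>UNIV. integral {a..b} (\<lambda>y.
      (norm (Q J y))\<^sup>2 + (norm (x_diff A m k Q J y))\<^sup>2 + (norm (y_deriv a b Q J y))\<^sup>2))"

text \<open>
  Finiteness of the norm means: \<open>Q\<^sub>J\<close> is in \<open>H\<^sup>1(a,b)\<close> and the difference quotients are square integrable,
  for interior \<open>J\<close>. Since functions are total, they are normalised to be zero off the closed grid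
  lines, so that equality of semi-discrete functions is equality on these lines.
\<close>
definition H1h :: "real \<Rightarrow> nat \<Rightarrow> real \<Rightarrow> real \<Rightarrow> ('n::finite, 'N::finite) sdf set" where
  "H1h A m a b = {Q. (\<forall>J y. J \<notin> grid_idx m \<or> y \<notin> {a..b} \<longrightarrow> Q J y = 0) \<and>
     (\<forall>J\<in>interior_idx m. (\<exists>g. H1_deriv a b (Q J) g) \<and> (\<forall>k. L2_fun a b (x_diff A m k Q J)))}"

definition boundary_eq :: "nat \<Rightarrow> real \<Rightarrow> real \<Rightarrow> ('n::finite, 'N::finite) sdf \<Rightarrow> ('n, 'N) sdf \<Rightarrow> bool" where
  "boundary_eq m a b Q P \<longleftrightarrow> (\<forall>(J, y) \<in> boundary_h m a b. Q J y = P J y)"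

definition H1h0 :: "real \<Rightarrow> nat \<Rightarrow> real \<Rightarrow> real \<Rightarrow> ('n::finite, 'N::finite) sdf set" where
  "H1h0 A m a b = {Q \<in> H1h A m a b. boundary_eq m a b Q (\<lambda>J y. 0)}"

text \<open>Only the values of \<open>P\<close> on the boundary matter.\<close>
definition B_set :: "real \<Rightarrow> nat \<Rightarrow> real \<Rightarrow> real \<Rightarrow> real \<Rightarrow> ('n::finite, 'N::finite) sdf \<Rightarrow> ('n, 'N) sdf set" where
  "B_set A m a b R P = {W \<in> H1h A m a b. boundary_eq m a b W P \<and> H1h_norm A m a b W < R}"

text \<open>
  The closure in the norm of \<open>H1h\<close>. That norm sees boundary values with non-interior \<open>J\<close> only through
  differences (and not at all at the corners of the index cube), so the prescribed boundary
  values, which are part of the data of an element, are kept explicitly.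
\<close>
definition B_closure :: "real \<Rightarrow> nat \<Rightarrow> real \<Rightarrow> real \<Rightarrow> real \<Rightarrow> ('n::finite, 'N::finite) sdf \<Rightarrow> ('n, 'N) sdf set" where
  "B_closure A m a b R P = {W \<in> H1h A m a b. boundary_eq m a b W P \<and>
     (\<forall>\<epsilon>>0. \<exists>V\<in>B_set A m a b R P. H1h_norm A m a b (\<lambda>J y. W J y - V J y) < \<epsilon>)}"

definition J_fun :: "real \<Rightarrow> real \<Rightarrow> real \<Rightarrow> real \<Rightarrow> nat \<Rightarrow> ((real^'n::finite) \<times> real \<Rightarrow> real) \<Rightarrow>
    (((real^'n) \<times> real) \<times> real \<times> real \<Rightarrow> real) \<Rightarrow> real \<Rightarrow> ('n, 'N::finite) sdf \<Rightarrow> real" where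
  "J_fun A d a b m mus K lam W = (L2h_norm m a b (\<lambda>J y. exp (lam * y) *\<^sub>R
      (D_mat d (grid_point A m J y) *v y_deriv a b W J y +
       (\<Sum>i\<in>UNIV. A_mat d i (grid_point A m J y) *v x_diff A m i W J y) +
       F_vec d mus K (W J y) (grid_point A m J y))))\<^sup>2"

text \<open>
  \<open>g\<close> is the Riesz representative in \<open>H1h0\<close> of the Frechet derivative of \<open>\<Phi>\<close> at \<open>W\<close>, with respect to
  increments in \<open>H1h0\<close>.
\<close>
definition has_gradient :: "real \<Rightarrow> nat \<Rightarrow> real \<Rightarrow> real \<Rightarrow> (('n::finite, 'N::finite) sdf \<Rightarrow> real) \<Rightarrow>
    ('n, 'N) sdf \<Rightarrow> ('n, 'N) sdf \<Rightarrow> bool" where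
  "has_gradient A m a b \<Phi> W g \<longleftrightarrow> g \<in> H1h0 A m a b \<and>
     (\<forall>\<epsilon>>0. \<exists>\<delta>>0. \<forall>v\<in>H1h0 A m a b. H1h_norm A m a b v < \<delta> \<longrightarrow>
        \<bar>\<Phi> (\<lambda>J y. W J y + v J y) - \<Phi> W - H1h_inner A m a b g v\<bar> \<le> \<epsilon> * H1h_norm A m a b v)"

definition gradient :: "real \<Rightarrow> nat \<Rightarrow> real \<Rightarrow> real \<Rightarrow> (('n::finite, 'N::finite) sdf \<Rightarrow> real) \<Rightarrow>
    ('n, 'N) sdf \<Rightarrow> ('n, 'N) sdf" where
  "gradient A m a b \<Phi> W = (THE g. has_gradient A m a b \<Phi> W g)"

text \<open>The Carleman estimate on the grid with parameter \<open>m\<close>, with constant \<open>C\<close> and for all \<open>\<lambda> \<ge> lam0\<close>.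
  The two type arguments only fix \<open>n\<close> and \<open>N\<close>.\<close>
definition carleman :: "'n::finite itself \<Rightarrow> 'N::finite itself \<Rightarrow>
    real \<Rightarrow> real \<Rightarrow> real \<Rightarrow> real \<Rightarrow> nat \<Rightarrow> real \<Rightarrow> real \<Rightarrow> bool" where
  "carleman _ _ A d a b m C lam0 \<longleftrightarrow>
     (\<forall>W \<in> (H1h0 A m a b :: ('n, 'N) sdf set). \<forall>lam\<ge>lam0.
        (L2h_norm m a b (\<lambda>J y. exp (lam * y) *\<^sub>R (y_deriv a b W J y +
           (\<Sum>i\<in>UNIV. (matrix_inv (D_mat d (grid_point A m J y)) ** A_mat d i (grid_point A m J y))
                *v x_diff A m i W J y))))\<^sup>2
        \<ge> C * ((L2h_norm m a b (\<lambda>J y. exp (lam * y) *\<^sub>R y_deriv a b W J y))\<^sup>2 +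
                lam\<^sup>2 * (L2h_norm m a b (\<lambda>J y. exp (lam * y) *\<^sub>R W J y))\<^sup>2))"

end

theory Submission
  imports Defs
begin

text \<open>
  Write \<open>\<parallel>\<cdot>\<parallel>\<close> for the norm of \<open>L\<^sub>2\<close>, let \<open>L\<close> be the linear part of the operator under the norm in \<open>J\<^sub>\<lambda>\<close>, and
  \<open>r = F (W + v) - F W - F' W v\<close>. Then
  \<open>J\<^sub>\<lambda> (W + v) - J\<^sub>\<lambda> W - J\<^sub>\<lambda>' W v = 2 \<langle>e\<^bsup>\<lambda>y\<^esup> (L W + F W), e\<^bsup>\<lambda>y\<^esup> r\<rangle> + \<parallel>e\<^bsup>\<lambda>y\<^esup> (L v + F (W + v) - F W)\<parallel>\<^sup>2\<close> with \<open>|r| \<le> C |v|\<^sup>2\<close>, since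
  \<open>W\<close> is bounded in the supremum norm. The derivative and its Lipschitz continuity follow from this and the Riesz theorem.

  For convexity, put \<open>X = \<lambda> \<parallel>e\<^bsup>\<lambda>y\<^esup> v\<parallel>\<close> and \<open>Y = \<parallel>e\<^bsup>\<lambda>y\<^esup> v\<^sub>y\<parallel>\<close>. The Carleman estimate bounds the square on the right from
  below by a multiple of \<open>X\<^sup>2 + Y\<^sup>2\<close>, minus \<open>C X\<^sup>2 / \<lambda>\<^sup>2\<close>. Here \<open>L W + F W\<close> is only square integrable, so the first term
  needs a supremum bound for \<open>v\<close>: integrating \<open>v\<^sub>y\<close> from \<open>y\<close> to \<open>b\<close> and using the Cauchy-Schwarz inequality with the
  weight gives \<open>e\<^bsup>\<lambda>y\<^esup> |v| \<le> Y\<close> for \<open>\<lambda> \<ge> 1\<close>, whence the term is at most \<open>C (X\<^sup>2 + Y\<^sup>2) / \<lambda>\<close>. Large \<open>\<lambda>\<close> absorbs both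
  perturbations, and the remaining constant does not depend on \<open>R\<close>. Strict convexity makes minimizing sequences
  Cauchy sequences, so no weak compactness is needed for the minimizer.
\<close>

section \<open>Minimization and the Riesz representation\<close>

text \<open>The uniformity of the constants shapes the development. The kernel \<open>K\<close>
  enters the bounds on \<open>F\<close> only through \<open>\<kappa>\<close>, and the functional is
  studied in a locale whose bounds are parameters, so every constant derived there is an expression
  in these parameters, fixed before \<open>K\<close>, the grid and the boundary data. Since the step
  is at least \<open>h0\<close>, the central difference of a function with zero boundary values is a
  bounded operation; so the Carleman estimate, which bounds no difference, still controls the full
  norm of \<open>H1h\<close>. Two features of the spaces need care. \<open>y_deriv\<close> is a
  choice, linear only up to null sets, so identities involving it hold almost everywhere. And the
  norm of \<open>H1h\<close> is only a seminorm, definite on \<open>H1h0\<close>; hence the spaces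
  are sets with a semidefinite form. The minimization lemma below assumes no metric axioms and
  serves twice: for the quadratic functional of the Riesz theorem and for \<open>J_fun\<close>
  itself.\<close>

lemma midpoint_convex_minimizer:
  fixes \<Phi> :: "'x \<Rightarrow> real" and ds :: "'x \<Rightarrow> 'x \<Rightarrow> real"
  assumes ne: "S \<noteq> {}" and bdd: "\<And>u. u \<in> S \<Longrightarrow> B \<le> \<Phi> u" and "c > 0"
    and mid: "\<And>u v. u \<in> S \<Longrightarrow> v \<in> S \<Longrightarrow> mid u v \<in> S"
    and conv: "\<And>u v. u \<in> S \<Longrightarrow> v \<in> S \<Longrightarrow> \<Phi> (mid u v) + c * (ds u v)\<^sup>2 \<le> (\<Phi> u + \<Phi> v) / 2"
    and complete: "\<And>s. (\<And>i. s i \<in> S) \<Longrightarrow> (\<And>e. e > 0 \<Longrightarrow> \<exists>M::nat. \<forall>i\<ge>M. \<forall>j\<ge>M. ds (s i) (s j) < e) \<Longrightarrow>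
       \<exists>l\<in>S. (\<lambda>i. ds (s i) l) \<longlonglongrightarrow> 0"
    and cont: "\<And>s l. (\<And>i. s i \<in> S) \<Longrightarrow> l \<in> S \<Longrightarrow> (\<lambda>i. ds (s i) l) \<longlonglongrightarrow> 0 \<Longrightarrow> (\<lambda>i. \<Phi> (s i)) \<longlonglongrightarrow> \<Phi> l"
  shows "\<exists>u\<in>S. \<forall>v\<in>S. \<Phi> u \<le> \<Phi> v"
proof -
  define \<mu> where "\<mu> = (INF u\<in>S. \<Phi> u)"
  have below: "bdd_below (\<Phi> ` S)" using bdd by (auto intro!: bdd_belowI2)
  have \<mu>_le: "\<mu> \<le> \<Phi> u" if "u \<in> S" for u
    unfolding \<mu>_def by (rule cINF_lower[OF below that])
  have "\<exists>u\<in>S. \<Phi> u < \<mu> + e" if "e > 0" for e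
    using cINF_less_iff[OF ne below, of "\<mu> + e"] that by (simp add: \<mu>_def)
  then have "\<forall>i. \<exists>u. u \<in> S \<and> \<Phi> u < \<mu> + 1 / real (Suc i)"
    by (metis of_nat_0_less_iff zero_less_Suc zero_less_divide_1_iff)
  then obtain s where s: "\<And>i. s i \<in> S" "\<And>i. \<Phi> (s i) < \<mu> + 1 / real (Suc i)"
    by metis
  \<comment> \<open>Both values lie within \<open>1 / (M + 1)\<close> of the infimum and the
    midpoint value is not below it, so midpoint convexity forces the two points together.\<close>
  have close: "c * (ds (s i) (s j))\<^sup>2 \<le> 1 / real (Suc M)" if "i \<ge> M" "j \<ge> M" for i j M
  proof -
    have "1 / real (Suc i) \<le> 1 / real (Suc M)" "1 / real (Suc j) \<le> 1 / real (Suc M)"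
      using that by (auto intro!: divide_left_mono)
    then show ?thesis
      using conv[OF s(1)[of i] s(1)[of j]] \<mu>_le[OF mid[OF s(1)[of i] s(1)[of j]]] s(2)[of i] s(2)[of j]
      by argo
  qed
  have "\<exists>l\<in>S. (\<lambda>i. ds (s i) l) \<longlonglongrightarrow> 0"
  proof (rule complete)
    fix e :: real assume "e > 0"
    then have "c * e\<^sup>2 > 0" using \<open>c > 0\<close> by simp
    then obtain M where "1 / real (Suc M) < c * e\<^sup>2"
      using reals_Archimedean by (auto simp: inverse_eq_divide)
    then have "c * (ds (s i) (s j))\<^sup>2 < c * e\<^sup>2" if "i \<ge> M" "j \<ge> M" for i j
      using close[OF that] by linarith
    then show "\<exists>M. \<forall>i\<ge>M. \<forall>j\<ge>M. ds (s i) (s j) < e"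
      using \<open>c > 0\<close> \<open>e > 0\<close> by (meson mult_less_cancel_left_pos power2_less_imp_less less_imp_le)
  qed (rule s)
  then obtain l where l: "l \<in> S" "(\<lambda>i. ds (s i) l) \<longlonglongrightarrow> 0" by blast
  have lim: "(\<lambda>i. \<mu> + 1 / real (Suc i)) \<longlonglongrightarrow> \<mu> + 0"
    by (rule tendsto_add[OF tendsto_const LIMSEQ_Suc[OF lim_1_over_n]])
  have "\<Phi> l \<le> \<mu> + 0"
    by (rule LIMSEQ_le[OF cont[OF s(1) l] lim]) (use s(2) less_imp_le in blast)
  then have "\<Phi> l \<le> \<mu>" by simp
  then show ?thesis using l(1) \<mu>_le order_trans by blast
qed

text \<open>Semi-discrete functions form sets, not types with an inner product, and integrals do not
  separate functions that agree up to null sets; hence a form on a carrier set that is only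
  semidefinite. One law for \<open>u + c v\<close> covers sums, differences and multiples.\<close>

locale semi_inner =
  fixes S :: "('j \<Rightarrow> real \<Rightarrow> 'v::real_vector) set"
    and ip :: "('j \<Rightarrow> real \<Rightarrow> 'v) \<Rightarrow> ('j \<Rightarrow> real \<Rightarrow> 'v) \<Rightarrow> real"
  assumes S_ne: "S \<noteq> {}"
    and S_comb: "u \<in> S \<Longrightarrow> v \<in> S \<Longrightarrow> (\<lambda>j y. u j y + c *\<^sub>R v j y) \<in> S"
    and ip_comb: "u \<in> S \<Longrightarrow> v \<in> S \<Longrightarrow> w \<in> S \<Longrightarrow> ip (\<lambda>j y. u j y + c *\<^sub>R v j y) w = ip u w + c * ip v w"
    and ip_commute: "u \<in> S \<Longrightarrow> v \<in> S \<Longrightarrow> ip u v = ip v u"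
    and ip_nonneg: "u \<in> S \<Longrightarrow> 0 \<le> ip u u"
begin

definition nrm :: "('j \<Rightarrow> real \<Rightarrow> 'v) \<Rightarrow> real" where
  "nrm u = sqrt (ip u u)"

lemma S_add: "u \<in> S \<Longrightarrow> v \<in> S \<Longrightarrow> (\<lambda>j y. u j y + v j y) \<in> S"
  using S_comb[of u v 1] by simp

lemma S_diff: "u \<in> S \<Longrightarrow> v \<in> S \<Longrightarrow> (\<lambda>j y. u j y - v j y) \<in> S"
  using S_comb[of u v "-1"] by simp

lemma S_zero: "(\<lambda>j y. 0) \<in> S"
  using S_ne S_diff by fastforce

lemma S_scale: "u \<in> S \<Longrightarrow> (\<lambda>j y. c *\<^sub>R u j y) \<in> S"
  using S_comb[OF S_zero, of u c] by simp

lemma ip_add: "u \<in> S \<Longrightarrow> v \<in> S \<Longrightarrow> w \<in> S \<Longrightarrow> ip (\<lambda>j y. u j y + v j y) w = ip u w + ip v w"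
  using ip_comb[of u v w 1] by simp

lemma ip_diff: "u \<in> S \<Longrightarrow> v \<in> S \<Longrightarrow> w \<in> S \<Longrightarrow> ip (\<lambda>j y. u j y - v j y) w = ip u w - ip v w"
  using ip_comb[of u v w "-1"] by simp

lemma ip_zero: "w \<in> S \<Longrightarrow> ip (\<lambda>j y. 0) w = 0"
  using ip_diff[of w w w] by simp

lemma ip_scale: "u \<in> S \<Longrightarrow> w \<in> S \<Longrightarrow> ip (\<lambda>j y. c *\<^sub>R u j y) w = c * ip u w"
  using ip_comb[OF S_zero, of u w c] ip_zero by simp

lemma ip_comb_right:
  assumes "u \<in> S" "v \<in> S" "w \<in> S"
  shows "ip w (\<lambda>j y. u j y + c *\<^sub>R v j y) = ip w u + c * ip w v"
  using ip_comb[OF assms, of c] ip_commute[OF assms(3) S_comb[OF assms(1,2)], of c]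
    ip_commute[OF assms(3,1)] ip_commute[OF assms(3,2)] by simp

lemma ip_add_right: "u \<in> S \<Longrightarrow> v \<in> S \<Longrightarrow> w \<in> S \<Longrightarrow> ip w (\<lambda>j y. u j y + v j y) = ip w u + ip w v"
  using ip_comb_right[of u v w 1] by simp

lemma ip_diff_right: "u \<in> S \<Longrightarrow> v \<in> S \<Longrightarrow> w \<in> S \<Longrightarrow> ip w (\<lambda>j y. u j y - v j y) = ip w u - ip w v"
  using ip_comb_right[of u v w "-1"] by simp

lemma ip_scale_right: "u \<in> S \<Longrightarrow> w \<in> S \<Longrightarrow> ip w (\<lambda>j y. c *\<^sub>R u j y) = c * ip w u"
  using ip_comb_right[OF S_zero, of u w c] ip_commute[OF S_zero, of w] ip_zero by simp

lemma nrm_nonneg: "u \<in> S \<Longrightarrow> 0 \<le> nrm u"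
  by (simp add: nrm_def ip_nonneg)

lemma nrm_square: "u \<in> S \<Longrightarrow> (nrm u)\<^sup>2 = ip u u"
  by (simp add: nrm_def ip_nonneg)

lemma nrm_zero: "nrm (\<lambda>j y. 0) = 0"
  by (simp add: nrm_def ip_zero S_zero)

lemma nrm_square_comb:
  assumes "u \<in> S" "v \<in> S"
  shows "(nrm (\<lambda>j y. u j y + c *\<^sub>R v j y))\<^sup>2 = (nrm u)\<^sup>2 + 2 * c * ip u v + c\<^sup>2 * (nrm v)\<^sup>2"
  unfolding nrm_square[OF S_comb[OF assms]] nrm_square[OF assms(1)] nrm_square[OF assms(2)]
  by (simp add: assms S_comb ip_comb ip_comb_right ip_commute[of v u] power2_eq_square algebra_simps)

lemma nrm_square_add:
  assumes "u \<in> S" "v \<in> S"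
  shows "(nrm (\<lambda>j y. u j y + v j y))\<^sup>2 = (nrm u)\<^sup>2 + 2 * ip u v + (nrm v)\<^sup>2"
  using nrm_square_comb[OF assms, of 1] by simp

lemma nrm_scale: "u \<in> S \<Longrightarrow> nrm (\<lambda>j y. c *\<^sub>R u j y) = \<bar>c\<bar> * nrm u"
  unfolding nrm_def by (simp add: ip_scale ip_scale_right S_scale real_sqrt_mult flip: mult.assoc)

lemma cauchy_schwarz:
  assumes "u \<in> S" "v \<in> S"
  shows "\<bar>ip u v\<bar> \<le> nrm u * nrm v"
proof -
  have pos: "0 \<le> ip u u + 2 * c * ip u v + c\<^sup>2 * ip v v" for c
    using nrm_square_comb[OF assms, of c] zero_le_power2[of "nrm (\<lambda>j y. u j y + c *\<^sub>R v j y)"]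
    by (simp add: nrm_square assms)
  have "(ip u v)\<^sup>2 \<le> ip u u * ip v v"
  proof (cases "ip v v = 0")
    case True
    \<comment> \<open>With \<open>ip v v = 0\<close> the inequality \<open>pos\<close> is affine in
      \<open>c\<close>; the value chosen below would turn it into \<open>0 \<le> -1\<close> if
      \<open>ip u v\<close> were nonzero.\<close>
    have "ip u v = 0"
    proof (rule ccontr)
      assume nz: "ip u v \<noteq> 0"
      show False using pos[of "- (ip u u + 1) / ip u v / 2"] nz True ip_nonneg[OF assms(1)] by (simp add: field_simps)
    qed
    then show ?thesis using True by simp
  next
    case False
    then have "ip v v > 0" using ip_nonneg[OF assms(2)] by simp
    then show ?thesis using pos[of "- ip u v / ip v v"]
      by (simp add: field_simps power2_eq_square)
  qed
  then have "sqrt ((ip u v)\<^sup>2) \<le> sqrt (ip u u * ip v v)" by (rule real_sqrt_le_mono)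
  then show ?thesis by (simp add: nrm_def real_sqrt_mult)
qed

lemma nrm_triangle:
  assumes "u \<in> S" "v \<in> S"
  shows "nrm (\<lambda>j y. u j y + v j y) \<le> nrm u + nrm v"
proof -
  have "(nrm (\<lambda>j y. u j y + v j y))\<^sup>2 \<le> (nrm u + nrm v)\<^sup>2"
    using nrm_square_add[OF assms] cauchy_schwarz[OF assms] by (simp add: power2_sum)
  then show ?thesis
    by (rule power2_le_imp_le) (simp add: assms nrm_nonneg)
qed

lemma nrm_minus_commute:
  assumes "u \<in> S" "v \<in> S"
  shows "nrm (\<lambda>j y. u j y - v j y) = nrm (\<lambda>j y. v j y - u j y)"
  using nrm_scale[OF S_diff[OF assms], of "-1"] by simp

lemma nrm_triangle_diff:
  assumes "u \<in> S" "v \<in> S"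
  shows "\<bar>nrm u - nrm v\<bar> \<le> nrm (\<lambda>j y. u j y - v j y)"
  using nrm_triangle[OF S_diff[OF assms] assms(2)]
    nrm_triangle[OF S_diff[OF assms(2) assms(1)] assms(1)] nrm_minus_commute[OF assms] by simp

text \<open>The midpoint form of the parallelogram law, in the shape required by
  \<open>midpoint_convex_minimizer\<close>: the squared norm is strictly midpoint convex with
  constant 1/4.\<close>

lemma parallelogram:
  assumes "u \<in> S" "v \<in> S"
  shows "(nrm (\<lambda>j y. u j y + (1/2) *\<^sub>R (v j y - u j y)))\<^sup>2 + (1/4) * (nrm (\<lambda>j y. u j y - v j y))\<^sup>2
    = ((nrm u)\<^sup>2 + (nrm v)\<^sup>2) / 2"
  unfolding nrm_square_comb[OF assms(1) S_diff[OF assms(2) assms(1)], of "1/2"]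
    nrm_square[OF S_diff[OF assms]] nrm_square[OF S_diff[OF assms(2,1)]] nrm_square[OF assms(1)] nrm_square[OF assms(2)]
  by (simp add: assms S_diff ip_diff ip_diff_right ip_commute[of v u] field_simps)

text \<open>The representative is the minimizer of \<open>|u|^2 - 2 f u\<close>: the linear part
  leaves the midpoint convexity of the squared norm unchanged, and the first-order condition at the
  minimum is \<open>ip g v = f v\<close>. The lower bound comes from \<open>f u \<le> C |u|\<close>
  and completing the square.\<close>

lemma riesz:
  assumes complete: "\<And>s. (\<And>i. s i \<in> S) \<Longrightarrow>
       (\<And>e. e > 0 \<Longrightarrow> \<exists>M::nat. \<forall>i\<ge>M. \<forall>j\<ge>M. nrm (\<lambda>k y. s i k y - s j k y) < e) \<Longrightarrow>
       \<exists>l\<in>S. (\<lambda>i. nrm (\<lambda>k y. s i k y - l k y)) \<longlonglongrightarrow> 0"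
    and lin: "\<And>u v c. u \<in> S \<Longrightarrow> v \<in> S \<Longrightarrow> f (\<lambda>j y. u j y + c *\<^sub>R v j y) = f u + c * f v"
    and bd: "\<And>u. u \<in> S \<Longrightarrow> \<bar>f u\<bar> \<le> C * nrm u"
  shows "\<exists>g\<in>S. \<forall>v\<in>S. ip g v = f v"
proof -
  define \<Phi> where "\<Phi> u = (nrm u)\<^sup>2 - 2 * f u" for u
  have f_diff: "f (\<lambda>j y. u j y - v j y) = f u - f v" if "u \<in> S" "v \<in> S" for u v
    using lin[OF that, of "-1"] by simp
  have "\<exists>u\<in>S. \<forall>v\<in>S. \<Phi> u \<le> \<Phi> v"
  proof (rule midpoint_convex_minimizer[where B = "- C\<^sup>2" and c = "1/4"
        and mid = "\<lambda>u v. (\<lambda>j y. u j y + (1/2) *\<^sub>R (v j y - u j y))"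
        and ds = "\<lambda>u v. nrm (\<lambda>j y. u j y - v j y)"])
    show "- C\<^sup>2 \<le> \<Phi> u" if "u \<in> S" for u
    proof -
      have "0 \<le> (nrm u - C)\<^sup>2" by simp
      then show ?thesis using bd[OF that] by (simp add: \<Phi>_def power2_diff algebra_simps)
    qed
    show "(\<lambda>j y. u j y + (1/2) *\<^sub>R (v j y - u j y)) \<in> S" if "u \<in> S" "v \<in> S" for u v
      using S_comb[OF that(1) S_diff[OF that(2) that(1)]] .
    show "\<Phi> (\<lambda>j y. u j y + (1/2) *\<^sub>R (v j y - u j y)) + 1/4 * (nrm (\<lambda>j y. u j y - v j y))\<^sup>2
        \<le> (\<Phi> u + \<Phi> v) / 2" if "u \<in> S" "v \<in> S" for u v
      using parallelogram[OF that]
      unfolding \<Phi>_def lin[OF that(1) S_diff[OF that(2,1)]] f_diff[OF that(2,1)] by (simp add: field_simps)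
    show "\<exists>l\<in>S. (\<lambda>i. nrm (\<lambda>k y. s i k y - l k y)) \<longlonglongrightarrow> 0"
      if "\<And>i. s i \<in> S" "\<And>e. e > 0 \<Longrightarrow> \<exists>M::nat. \<forall>i\<ge>M. \<forall>j\<ge>M. nrm (\<lambda>k y. s i k y - s j k y) < e" for s
      using complete[OF that] .
    show "(\<lambda>i. \<Phi> (s i)) \<longlonglongrightarrow> \<Phi> l"
      if s: "\<And>i. s i \<in> S" and l: "l \<in> S" and lim: "(\<lambda>i. nrm (\<lambda>k y. s i k y - l k y)) \<longlonglongrightarrow> 0" for s l
    proof -
      have "(\<lambda>i. nrm (s i) - nrm l) \<longlonglongrightarrow> 0"
        by (rule Lim_null_comparison[OF _ lim]) (simp add: nrm_triangle_diff s l)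
      then have 1: "(\<lambda>i. nrm (s i)) \<longlonglongrightarrow> nrm l" by (simp add: LIM_zero_iff)
      have lim': "(\<lambda>i. C * nrm (\<lambda>k y. s i k y - l k y)) \<longlonglongrightarrow> 0"
        using tendsto_mult_right_zero[OF lim] .
      have "(\<lambda>i. f (s i) - f l) \<longlonglongrightarrow> 0"
        by (rule Lim_null_comparison[OF _ lim'])
          (use bd[OF S_diff[OF s l]] in \<open>simp add: f_diff s l\<close>)
      then have 2: "(\<lambda>i. f (s i)) \<longlonglongrightarrow> f l" by (simp add: LIM_zero_iff)
      show ?thesis unfolding \<Phi>_def by (intro tendsto_intros 1 2)
    qed
  qed (use S_ne in auto)
  then obtain g where g: "g \<in> S" and min: "\<And>v. v \<in> S \<Longrightarrow> \<Phi> g \<le> \<Phi> v" by blast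
  have "ip g v = f v" if v: "v \<in> S" for v
  proof (rule ccontr)
    assume ne: "ip g v \<noteq> f v"
    define D where "D = ip g v - f v"
    \<comment> \<open>The added 1 keeps the divisor positive when \<open>nrm v = 0\<close>; then
      \<open>c = - D / N\<close> makes the quadratic in \<open>c\<close> negative unless
      \<open>D = 0\<close>.\<close>
    define N where "N = (nrm v)\<^sup>2 + 1"
    have N: "N > 0" by (simp add: N_def add_nonneg_pos)
    have "0 \<le> 2 * c * D + c\<^sup>2 * (nrm v)\<^sup>2" for c
      using min[OF S_comb[OF g v, of c]] by (simp add: \<Phi>_def D_def nrm_square_comb g v lin algebra_simps)
    from this[of "- D / N"] have "0 \<le> - 2 * D\<^sup>2 / N + D\<^sup>2 / N\<^sup>2 * (nrm v)\<^sup>2"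
      by (simp add: power2_eq_square)
    also have "D\<^sup>2 / N\<^sup>2 * (nrm v)\<^sup>2 \<le> D\<^sup>2 / N\<^sup>2 * N"
      by (intro mult_left_mono) (auto simp: N_def)
    also have "\<dots> = D\<^sup>2 / N" using N by (simp add: power2_eq_square)
    finally have "D\<^sup>2 / N \<le> 0" by simp
    moreover have "D\<^sup>2 / N > 0" using N ne by (simp add: D_def)
    ultimately show False by simp
  qed
  then show ?thesis using g by blast
qed

end

section \<open>Square integrable functions on an interval\<close>

text \<open>Passes from the gauge integral in \<open>L2_fun\<close> to the Lebesgue integral, where
  Fatou's lemma and termwise integration of series are available. Nonnegativity makes gauge
  integrability absolute.\<close>

lemma L2_fun_iff:
  "L2_fun a b f \<longleftrightarrow> f \<in> borel_measurable (lebesgue_on {a..b}) \<and> integrable (lebesgue_on {a..b}) (\<lambda>y. (norm (f y))\<^sup>2)"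
proof -
  have "integrable (lebesgue_on {a..b}) (\<lambda>y. (norm (f y))\<^sup>2)"
    if f[measurable]: "f \<in> borel_measurable (lebesgue_on {a..b})" and i: "(\<lambda>y. (norm (f y))\<^sup>2) integrable_on {a..b}"
  proof -
    have "(\<lambda>y. (norm (f y))\<^sup>2) absolutely_integrable_on {a..b}"
      by (rule nonnegative_absolutely_integrable_1[OF i]) auto
    then show ?thesis by (rule absolutely_integrable_imp_integrable) simp
  qed
  moreover have "(\<lambda>y. (norm (f y))\<^sup>2) integrable_on {a..b}"
    if "integrable (lebesgue_on {a..b}) (\<lambda>y. (norm (f y))\<^sup>2)"
    by (rule integrable_on_lebesgue_on[OF that]) simp
  ultimately show ?thesis by (auto simp: L2_fun_def)
qed

lemma L2_fun_measurable: "L2_fun a b f \<Longrightarrow> f \<in> borel_measurable (lebesgue_on {a..b})"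
  by (simp add: L2_fun_def)

lemma L2_fun_square_integrable: "L2_fun a b f \<Longrightarrow> (\<lambda>y. (norm (f y))\<^sup>2) integrable_on {a..b}"
  by (simp add: L2_fun_def)

lemma L2_fun_dominated:
  fixes f :: "real \<Rightarrow> 'v::euclidean_space"
  assumes f: "f \<in> borel_measurable (lebesgue_on {a..b})"
    and g: "g integrable_on {a..b}" and le: "\<And>y. y \<in> {a..b} \<Longrightarrow> (norm (f y))\<^sup>2 \<le> g y"
  shows "L2_fun a b f"
  unfolding L2_fun_def
proof
  have "(\<lambda>y. (norm (f y))\<^sup>2) \<in> borel_measurable (lebesgue_on {a..b})" using f by measurable
  then show "(\<lambda>y. (norm (f y))\<^sup>2) integrable_on {a..b}"
    by (rule measurable_bounded_by_integrable_imp_integrable[OF _ g]) (use le in auto)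
qed (rule f)

lemma L2_fun_continuous: "continuous_on {a..b} f \<Longrightarrow> L2_fun a b f"
  unfolding L2_fun_def
  by (auto intro!: continuous_imp_measurable_on_sets_lebesgue integrable_continuous_real continuous_intros)

lemma L2_fun_comb:
  assumes "L2_fun a b f" "L2_fun a b g"
  shows "L2_fun a b (\<lambda>y. f y + c *\<^sub>R g y)"
proof (rule L2_fun_dominated)
  show "(\<lambda>y. f y + c *\<^sub>R g y) \<in> borel_measurable (lebesgue_on {a..b})"
    using assms[THEN L2_fun_measurable] by measurable
  show "(\<lambda>y. 2 * (norm (f y))\<^sup>2 + 2 * (c\<^sup>2 * (norm (g y))\<^sup>2)) integrable_on {a..b}"
    using assms unfolding L2_fun_def by (auto intro!: integrable_add integrable_on_mult_right)
  show "(norm (f y + c *\<^sub>R g y))\<^sup>2 \<le> 2 * (norm (f y))\<^sup>2 + 2 * (c\<^sup>2 * (norm (g y))\<^sup>2)" for y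
  proof -
    have "(norm (f y + c *\<^sub>R g y))\<^sup>2 \<le> (norm (f y) + norm (c *\<^sub>R g y))\<^sup>2"
      by (intro power_mono norm_triangle_ineq) simp
    also have "\<dots> \<le> 2 * (norm (f y))\<^sup>2 + 2 * (norm (c *\<^sub>R g y))\<^sup>2"
      using zero_le_power2[of "norm (f y) - norm (c *\<^sub>R g y)"] by (simp only: power2_sum power2_diff)
    finally show ?thesis by (simp add: power_mult_distrib)
  qed
qed

lemma L2_fun_add: "L2_fun a b f \<Longrightarrow> L2_fun a b g \<Longrightarrow> L2_fun a b (\<lambda>y. f y + g y)"
  using L2_fun_comb[of a b f g 1] by simp

lemma L2_fun_diff: "L2_fun a b f \<Longrightarrow> L2_fun a b g \<Longrightarrow> L2_fun a b (\<lambda>y. f y - g y)"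
  using L2_fun_comb[of a b f g "-1"] by simp

lemma L2_fun_zero: "L2_fun a b (\<lambda>y. 0)"
  by (simp add: L2_fun_continuous)

lemma L2_fun_scale: "L2_fun a b f \<Longrightarrow> L2_fun a b (\<lambda>y. c *\<^sub>R f y)"
  using L2_fun_comb[OF L2_fun_zero, of a b f c] by simp

lemma L2_fun_sum: "(\<And>i. i \<in> I \<Longrightarrow> L2_fun a b (f i)) \<Longrightarrow> L2_fun a b (\<lambda>y. \<Sum>i\<in>I. f i y)"
  by (induction I rule: infinite_finite_induct) (auto simp: L2_fun_zero L2_fun_add)

lemma L2_fun_bound:
  fixes f :: "real \<Rightarrow> 'v::euclidean_space" and g :: "real \<Rightarrow> 'w::euclidean_space"
  assumes f: "f \<in> borel_measurable (lebesgue_on {a..b})" and g: "L2_fun a b g"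
    and le: "\<And>y. y \<in> {a..b} \<Longrightarrow> norm (f y) \<le> c * norm (g y)"
  shows "L2_fun a b f"
proof (rule L2_fun_dominated[OF f])
  show "(\<lambda>y. c\<^sup>2 * (norm (g y))\<^sup>2) integrable_on {a..b}"
    using g unfolding L2_fun_def by (auto intro!: integrable_on_mult_right)
  show "(norm (f y))\<^sup>2 \<le> c\<^sup>2 * (norm (g y))\<^sup>2" if "y \<in> {a..b}" for y
    using power_mono[OF le[OF that], of 2] by (simp add: power_mult_distrib)
qed

lemma bilinear_matrix_vector_mult: "bilinear ((*v) :: real^'n^'m \<Rightarrow> real^'n \<Rightarrow> real^'m)"
  unfolding bilinear_def
  by (auto intro!: linearI simp: matrix_vector_mult_add_rdistrib matrix_vector_right_distrib
      scaleR_matrix_vector_assoc matrix_vector_mult_scaleR)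

lemma L2_fun_matrix:
  fixes M :: "real \<Rightarrow> real^'n^'m" and f :: "real \<Rightarrow> real^'n"
  assumes M: "continuous_on {a..b} M" and f: "L2_fun a b f"
    and le: "\<And>y v. y \<in> {a..b} \<Longrightarrow> norm (M y *v v) \<le> c * norm v"
  shows "L2_fun a b (\<lambda>y. M y *v f y)"
proof (rule L2_fun_bound[OF _ f])
  show "(\<lambda>y. M y *v f y) \<in> borel_measurable (lebesgue_on {a..b})"
    by (rule borel_measurable_bilinear[OF bilinear_matrix_vector_mult])
      (use f in \<open>auto simp: L2_fun_def intro!: continuous_imp_measurable_on_sets_lebesgue M\<close>)
qed (rule le)

lemma L2_fun_weight:
  fixes f :: "real \<Rightarrow> 'v::euclidean_space"
  assumes w: "continuous_on {a..b} w" and f: "L2_fun a b f"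
  shows "L2_fun a b (\<lambda>y. w y *\<^sub>R f y)"
proof -
  have "bounded (w ` {a..b})"
    by (intro compact_imp_bounded compact_continuous_image w) simp
  then have "\<exists>c. \<forall>y\<in>{a..b}. \<bar>w y\<bar> \<le> c" by (auto simp: bounded_iff)
  then obtain c where c: "\<And>y. y \<in> {a..b} \<Longrightarrow> \<bar>w y\<bar> \<le> c" by blast
  have [measurable]: "w \<in> borel_measurable (lebesgue_on {a..b})" "f \<in> borel_measurable (lebesgue_on {a..b})"
    using f by (auto simp: L2_fun_def intro!: continuous_imp_measurable_on_sets_lebesgue w)
  show ?thesis
    by (rule L2_fun_bound[OF _ f, of _ c]) (auto intro!: mult_right_mono c)
qed

lemma L2_fun_norm: "L2_fun a b f \<Longrightarrow> L2_fun a b (\<lambda>y. norm (f y))"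
  by (rule L2_fun_bound[of _ a b f 1]) (auto simp: L2_fun_def)

lemma L2_fun_inner_integrable:
  assumes f: "L2_fun a b f" and g: "L2_fun a b g"
  shows "(\<lambda>y. f y \<bullet> g y) integrable_on {a..b}"
proof (rule measurable_bounded_by_integrable_imp_integrable)
  show "(\<lambda>y. f y \<bullet> g y) \<in> borel_measurable (lebesgue_on {a..b})"
    using f[THEN L2_fun_measurable] g[THEN L2_fun_measurable] by measurable
  show "(\<lambda>y. (norm (f y))\<^sup>2 + (norm (g y))\<^sup>2) integrable_on {a..b}"
    using f g unfolding L2_fun_def by (auto intro!: integrable_add)
  show "norm (f y \<bullet> g y) \<le> (norm (f y))\<^sup>2 + (norm (g y))\<^sup>2" for y
  proof -
    have "norm (f y \<bullet> g y) \<le> norm (f y) * norm (g y)" by (simp add: Cauchy_Schwarz_ineq2)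
    also have "\<dots> \<le> (norm (f y))\<^sup>2 + (norm (g y))\<^sup>2"
    proof -
      have "0 \<le> norm (f y) * norm (g y)" by simp
      then show ?thesis using sum_squares_bound[of "norm (f y)" "norm (g y)"] by linarith
    qed
    finally show ?thesis .
  qed
qed simp

lemma L2_fun_absolutely_integrable:
  assumes f: "L2_fun a b f"
  shows "f absolutely_integrable_on {a..b}"
proof (rule measurable_bounded_by_integrable_imp_absolutely_integrable)
  show "(\<lambda>y. (norm (f y))\<^sup>2 + 1) integrable_on {a..b}"
    using f unfolding L2_fun_def by (auto intro!: integrable_add)
  show "norm (f y) \<le> (norm (f y))\<^sup>2 + 1" for y
    using sum_squares_bound[of "norm (f y)" 1] norm_ge_zero[of "f y"] by (simp, linarith)
qed (use f in \<open>auto simp: L2_fun_def\<close>)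

lemma L2_fun_integrable: "L2_fun a b f \<Longrightarrow> f integrable_on {a..b}"
  using L2_fun_absolutely_integrable set_lebesgue_integral_eq_integral(1) by blast

lemma L2_fun_subinterval:
  assumes f: "L2_fun a b f" and "{c..d} \<subseteq> {a..b}"
  shows "L2_fun c d f"
  unfolding L2_fun_def
proof
  show "f \<in> borel_measurable (lebesgue_on {c..d})"
    by (rule measurable_restrict_mono[OF L2_fun_measurable[OF f] assms(2)])
  show "(\<lambda>y. (norm (f y))\<^sup>2) integrable_on {c..d}"
    using assms by (auto simp: L2_fun_def intro: integrable_on_subinterval)
qed

text \<open>Values at indices outside \<open>I\<close> are unconstrained and invisible to
  \<open>L2ip\<close>, one more reason why the form is only semidefinite.\<close>

definition L2S :: "real \<Rightarrow> real \<Rightarrow> 'j set \<Rightarrow> ('j \<Rightarrow> real \<Rightarrow> 'v::euclidean_space) set" where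
  "L2S a b I = {Q. \<forall>j\<in>I. L2_fun a b (Q j)}"

definition L2ip :: "real \<Rightarrow> real \<Rightarrow> 'j set \<Rightarrow> ('j \<Rightarrow> real \<Rightarrow> 'v::euclidean_space) \<Rightarrow> ('j \<Rightarrow> real \<Rightarrow> 'v) \<Rightarrow> real" where
  "L2ip a b I Q V = (\<Sum>j\<in>I. integral {a..b} (\<lambda>y. Q j y \<bullet> V j y))"

interpretation L2: semi_inner "L2S a b I" "L2ip a b I" for a b I
proof
  show "L2S a b I \<noteq> {}" by (auto simp: L2S_def intro: exI[of _ "\<lambda>j y. 0"] L2_fun_zero)
  show "(\<lambda>j y. u j y + c *\<^sub>R v j y) \<in> L2S a b I" if "u \<in> L2S a b I" "v \<in> L2S a b I" for u v c
    using that by (auto simp: L2S_def intro: L2_fun_comb)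
  show "L2ip a b I (\<lambda>j y. u j y + c *\<^sub>R v j y) w = L2ip a b I u w + c * L2ip a b I v w"
    if "u \<in> L2S a b I" "v \<in> L2S a b I" "w \<in> L2S a b I" for u v w c
  proof -
    have "integral {a..b} (\<lambda>y. (u j y + c *\<^sub>R v j y) \<bullet> w j y) =
        integral {a..b} (\<lambda>y. u j y \<bullet> w j y) + c * integral {a..b} (\<lambda>y. v j y \<bullet> w j y)" if j: "j \<in> I" for j
    proof -
      have "(\<lambda>y. u j y \<bullet> w j y) integrable_on {a..b}" "(\<lambda>y. v j y \<bullet> w j y) integrable_on {a..b}"
        using \<open>u \<in> _\<close> \<open>v \<in> _\<close> \<open>w \<in> _\<close> j by (auto simp: L2S_def intro: L2_fun_inner_integrable)
      then show ?thesis
        by (simp add: inner_add_left integral_add integrable_on_mult_right)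
    qed
    then show ?thesis by (simp add: L2ip_def sum.distrib sum_distrib_left)
  qed
  show "L2ip a b I u v = L2ip a b I v u" for u v :: "'a \<Rightarrow> real \<Rightarrow> 'b"
    by (simp add: L2ip_def inner_commute)
  show "0 \<le> L2ip a b I u u" if "u \<in> L2S a b I" for u
    using that by (auto simp: L2ip_def L2S_def intro!: sum_nonneg integral_nonneg L2_fun_inner_integrable)
qed

definition L2n :: "real \<Rightarrow> real \<Rightarrow> (real \<Rightarrow> 'v::euclidean_space) \<Rightarrow> real" where
  "L2n a b f = sqrt (integral {a..b} (\<lambda>y. (norm (f y))\<^sup>2))"

text \<open>A single function is a family over the one-point type \<open>unit\<close>, so the
  Cauchy-Schwarz inequality on one interval is an instance of the locale.\<close>

lemma L2n_eq_nrm: "L2n a b f = L2.nrm a b (UNIV :: unit set) (\<lambda>_. f)"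
  by (simp add: L2n_def L2.nrm_def L2ip_def power2_norm_eq_inner UNIV_unit)

lemma L2n_nonneg: "L2_fun a b f \<Longrightarrow> 0 \<le> L2n a b f"
  by (simp add: L2n_def integral_nonneg L2_fun_square_integrable)

lemma L2n_square: "L2_fun a b f \<Longrightarrow> (L2n a b f)\<^sup>2 = integral {a..b} (\<lambda>y. (norm (f y))\<^sup>2)"
  by (simp add: L2n_def integral_nonneg L2_fun_square_integrable)

lemma L2n_cauchy_schwarz:
  "L2_fun a b f \<Longrightarrow> L2_fun a b g \<Longrightarrow> \<bar>integral {a..b} (\<lambda>y. f y \<bullet> g y)\<bar> \<le> L2n a b f * L2n a b g"
  using L2.cauchy_schwarz[of "\<lambda>_::unit. f" a b UNIV "\<lambda>_. g"] by (simp add: L2n_eq_nrm L2S_def L2ip_def UNIV_unit)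

lemma L2n_mono_interval:
  assumes "L2_fun a b f" "{c..d} \<subseteq> {a..b}"
  shows "L2n c d f \<le> L2n a b f"
  unfolding L2n_def
  by (intro real_sqrt_le_mono integral_subset_le)
    (use assms(2) in \<open>auto intro!: L2_fun_square_integrable assms L2_fun_subinterval[OF assms]\<close>)

text \<open>Cauchy-Schwarz for the product of \<open>1 / w\<close> and \<open>w g\<close>. The
  weight 1 gives the plain bound, the exponential weight the supremum bound behind
  convexity.\<close>

lemma norm_integral_weight_le:
  fixes g :: "real \<Rightarrow> 'v::euclidean_space"
  assumes g: "L2_fun a b g" and w: "continuous_on {a..b} w" "\<And>t. t \<in> {a..b} \<Longrightarrow> w t > 0"
    and sub: "{c..d} \<subseteq> {a..b}"
  shows "norm (integral {c..d} g) \<le> sqrt (integral {c..d} (\<lambda>t. (1 / w t)\<^sup>2)) * L2n a b (\<lambda>t. w t *\<^sub>R g t)"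
proof -
  have g': "L2_fun c d g" by (rule L2_fun_subinterval[OF g sub])
  have wcd: "continuous_on {c..d} w" "\<And>t. t \<in> {c..d} \<Longrightarrow> w t > 0"
    using w sub by (auto intro: continuous_on_subset)
  have inv: "L2_fun c d (\<lambda>t. 1 / w t)"
    by (intro L2_fun_continuous continuous_intros wcd(1)) (metis wcd(2) less_irrefl)
  have wg: "L2_fun a b (\<lambda>t. w t *\<^sub>R g t)" by (rule L2_fun_weight[OF w(1) g])
  have wg': "L2_fun c d (\<lambda>t. norm (w t *\<^sub>R g t))"
    by (rule L2_fun_norm[OF L2_fun_weight[OF wcd(1) g']])
  have ng: "(\<lambda>t. norm (g t)) integrable_on {c..d}"
    by (rule L2_fun_integrable[OF L2_fun_norm[OF g']])
  have "norm (integral {c..d} g) \<le> integral {c..d} (\<lambda>t. norm (g t))"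
    by (rule integral_norm_bound_integral[OF L2_fun_integrable[OF g'] ng]) simp
  also have "\<dots> = integral {c..d} (\<lambda>t. (1 / w t) \<bullet> norm (w t *\<^sub>R g t))"
    by (rule Henstock_Kurzweil_Integration.integral_cong) (use wcd(2) in \<open>fastforce simp: abs_of_pos\<close>)
  also have "\<dots> \<le> L2n c d (\<lambda>t. 1 / w t) * L2n c d (\<lambda>t. norm (w t *\<^sub>R g t))"
    using L2n_cauchy_schwarz[OF inv wg'] by linarith
  also have "L2n c d (\<lambda>t. norm (w t *\<^sub>R g t)) = L2n c d (\<lambda>t. w t *\<^sub>R g t)"
    by (simp add: L2n_def)
  also have "L2n c d (\<lambda>t. 1 / w t) * L2n c d (\<lambda>t. w t *\<^sub>R g t)
      \<le> L2n c d (\<lambda>t. 1 / w t) * L2n a b (\<lambda>t. w t *\<^sub>R g t)"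
    by (intro mult_left_mono L2n_mono_interval[OF wg sub] L2n_nonneg[OF inv])
  also have "L2n c d (\<lambda>t. 1 / w t) = sqrt (integral {c..d} (\<lambda>t. (1 / w t)\<^sup>2))"
    unfolding L2n_def real_norm_def power2_abs ..
  finally show ?thesis .
qed

lemma norm_integral_le_L2n:
  fixes g :: "real \<Rightarrow> 'v::euclidean_space"
  assumes g: "L2_fun a b g" and sub: "{c..d} \<subseteq> {a..b}" and "a \<le> b"
  shows "norm (integral {c..d} g) \<le> sqrt (b - a) * L2n a b g"
proof (cases "c \<le> d")
  case True
  have "norm (integral {c..d} g) \<le> sqrt (d - c) * L2n a b g"
    using norm_integral_weight_le[OF g _ _ sub, of "\<lambda>_. 1"] True by simp
  also have "\<dots> \<le> sqrt (b - a) * L2n a b g"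
    using sub True by (intro mult_right_mono L2n_nonneg[OF g]) auto
  finally show ?thesis .
qed (use assms L2n_nonneg[OF g] in auto)

text \<open>Riesz-Fischer: a subsequence whose increments are below \<open>(1/2)^k\<close> in
  \<open>L\<^sub>2\<close> has summable increments in \<open>L\<^sub>1\<close>, the interval being
  bounded. Hence it converges almost everywhere, and Fatou's lemma makes its pointwise limit the
  limit in norm of the whole sequence.\<close>

lemma L2_complete:
  fixes s :: "nat \<Rightarrow> real \<Rightarrow> 'v::euclidean_space"
  assumes s: "\<And>i. L2_fun a b (s i)" and "a \<le> b"
    and cauchy: "\<And>e. e > 0 \<Longrightarrow> \<exists>M. \<forall>i\<ge>M. \<forall>j\<ge>M. L2n a b (\<lambda>y. s i y - s j y) < e"
  shows "\<exists>g. L2_fun a b g \<and> (\<lambda>i. L2n a b (\<lambda>y. s i y - g y)) \<longlonglongrightarrow> 0"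
proof -
  let ?L = "lebesgue_on {a..b}"
  have meas[measurable]: "s i \<in> borel_measurable ?L" for i
    using s by (rule L2_fun_measurable)
  have d: "L2_fun a b (\<lambda>y. s i y - s j y)" for i j by (intro L2_fun_diff s)
  have "\<exists>N. \<forall>i\<ge>N. \<forall>j\<ge>N. L2n a b (\<lambda>y. s i y - s j y) < (1/2)^k" for k :: nat
    by (rule cauchy) simp
  then obtain N where N: "\<And>k i j. i \<ge> N k \<Longrightarrow> j \<ge> N k \<Longrightarrow> L2n a b (\<lambda>y. s i y - s j y) < (1/2)^k"
    by metis
  \<comment> \<open>The partial sums give \<open>r k \<ge> N k\<close> and
    \<open>r (Suc k) \<ge> N k\<close>, so the \<open>k\<close>-th increment is small; the summand
    \<open>k\<close> gives \<open>r k \<ge> k\<close>, which carries the subsequence past every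
    index \<open>M\<close>.\<close>
  define r where "r k = (\<Sum>i\<le>k. N i) + k" for k
  have r_ge: "r k \<ge> k" "r k \<ge> N k" "r (Suc k) \<ge> N k" for k
    using member_le_sum[of k "{..k}" N] by (auto simp: r_def)
  define h where "h k y = norm (s (r (Suc k)) y - s (r k) y)" for k y
  have h_nonneg: "0 \<le> h k y" for k y by (simp add: h_def)
  have h_int: "integrable ?L (h k)" for k
  proof -
    have "h k absolutely_integrable_on {a..b}"
      unfolding h_def by (rule L2_fun_absolutely_integrable[OF L2_fun_norm[OF d]])
    then show ?thesis by (rule absolutely_integrable_imp_integrable) simp
  qed
  have h_le: "(\<integral>y. h k y \<partial>?L) \<le> sqrt (b - a) * (1/2)^k" for k
  proof -
    have "(\<integral>y. h k y \<partial>?L) = integral {a..b} (h k)"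
      by (rule lebesgue_integral_eq_integral[OF h_int]) simp
    also have "\<dots> \<le> norm (integral {a..b} (h k))" by simp
    also have "\<dots> \<le> sqrt (b - a) * L2n a b (h k)"
      unfolding h_def by (rule norm_integral_le_L2n[OF L2_fun_norm[OF d] order_refl \<open>a \<le> b\<close>])
    also have "L2n a b (h k) = L2n a b (\<lambda>y. s (r (Suc k)) y - s (r k) y)"
      by (simp add: L2n_def h_def)
    also have "sqrt (b - a) * \<dots> \<le> sqrt (b - a) * (1/2)^k"
      using N[OF r_ge(3) r_ge(2)] \<open>a \<le> b\<close> by (intro mult_left_mono) (auto intro: less_imp_le)
    finally show ?thesis .
  qed
  have "(\<integral>\<^sup>+y. (\<Sum>k. ennreal (h k y)) \<partial>?L) = (\<Sum>k. \<integral>\<^sup>+y. ennreal (h k y) \<partial>?L)"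
    by (rule nn_integral_suminf) (use h_int in measurable)
  also have "\<dots> \<le> (\<Sum>k. ennreal (sqrt (b - a) * (1/2)^k))"
  proof (rule suminf_le)
    show "(\<integral>\<^sup>+y. ennreal (h k y) \<partial>?L) \<le> ennreal (sqrt (b - a) * (1/2)^k)" for k
      unfolding nn_integral_eq_integral[OF h_int AE_I2[OF h_nonneg]] by (rule ennreal_leI[OF h_le])
  qed auto
  also have "\<dots> < \<infinity>"
  proof -
    have "summable (\<lambda>k. sqrt (b - a) * (1/2::real)^k)" by (intro summable_mult summable_geometric) simp
    then show ?thesis
      using \<open>a \<le> b\<close> by (subst suminf_ennreal2) auto
  qed
  finally have "AE y in ?L. (\<Sum>k. ennreal (h k y)) \<noteq> \<infinity>"
    using borel_measurable_integrable[OF h_int] by (intro nn_integral_noteq_infinite) auto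
  then have conv: "AE y in ?L. convergent (\<lambda>k. s (r k) y)"
  proof eventually_elim
    case (elim y)
    then have "summable (\<lambda>k. h k y)"
      by (intro summable_suminf_not_top) (auto simp: h_def)
    then have "summable (\<lambda>k. s (r (Suc k)) y - s (r k) y)"
      unfolding h_def by (rule summable_norm_cancel)
    then have "convergent (\<lambda>n. \<Sum>k<n. s (r (Suc k)) y - s (r k) y)"
      by (simp add: summable_iff_convergent)
    then have "convergent (\<lambda>n. s (r n) y - s (r 0) y)"
      by (simp add: sum_lessThan_telescope[of "\<lambda>k. s (r k) y"])
    then show ?case by (simp add: convergent_diff_const_right_iff)
  qed
  \<comment> \<open>Where the sequence diverges, \<open>lim\<close> takes one fixed unspecified
    value, so \<open>g\<close> stays measurable.\<close>
  define g where "g y = lim (\<lambda>k. s (r k) y)" for y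
  have g_meas[measurable]: "g \<in> borel_measurable ?L"
    unfolding g_def by measurable
  have close: "(\<integral>\<^sup>+y. ennreal ((norm (s i y - g y))\<^sup>2) \<partial>?L) \<le> ennreal (e\<^sup>2)"
    if "e > 0" and i: "\<And>j. j \<ge> M \<Longrightarrow> L2n a b (\<lambda>y. s i y - s j y) < e" for i M e
  proof -
    have "(\<integral>\<^sup>+y. ennreal ((norm (s i y - g y))\<^sup>2) \<partial>?L)
        = (\<integral>\<^sup>+y. liminf (\<lambda>k. ennreal ((norm (s i y - s (r k) y))\<^sup>2)) \<partial>?L)"
    proof (rule nn_integral_cong_AE, use conv in eventually_elim)
      case (elim y)
      then have "(\<lambda>k. s (r k) y) \<longlonglongrightarrow> g y" by (simp add: g_def convergent_LIMSEQ_iff)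
      then have "(\<lambda>k. ennreal ((norm (s i y - s (r k) y))\<^sup>2)) \<longlonglongrightarrow> ennreal ((norm (s i y - g y))\<^sup>2)"
        by (intro tendsto_ennrealI tendsto_intros)
      then show ?case using lim_imp_Liminf[OF sequentially_bot] by metis
    qed
    also have "\<dots> \<le> liminf (\<lambda>k. \<integral>\<^sup>+y. ennreal ((norm (s i y - s (r k) y))\<^sup>2) \<partial>?L)"
      by (rule nn_integral_liminf) measurable
    also have "\<dots> \<le> ennreal (e\<^sup>2)"
    proof (rule Liminf_le)
      have "(\<integral>\<^sup>+y. ennreal ((norm (s i y - s (r k) y))\<^sup>2) \<partial>?L) \<le> ennreal (e\<^sup>2)" if "k \<ge> M" for k
      proof -
        have int: "integrable ?L (\<lambda>y. (norm (s i y - s (r k) y))\<^sup>2)"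
          using d[of i "r k"] by (simp add: L2_fun_iff)
        have "(\<integral>y. (norm (s i y - s (r k) y))\<^sup>2 \<partial>?L) = (L2n a b (\<lambda>y. s i y - s (r k) y))\<^sup>2"
          unfolding L2n_square[OF d] by (rule lebesgue_integral_eq_integral[OF int]) simp
        also have "\<dots> \<le> e\<^sup>2"
          using i[of "r k"] r_ge(1)[of k] that L2n_nonneg[OF d[of i "r k"]]
          by (intro power_mono) auto
        finally show ?thesis
          by (subst nn_integral_eq_integral[OF int]) (auto simp: ennreal_leI)
      qed
      then show "\<forall>\<^sub>F k in sequentially. (\<integral>\<^sup>+y. ennreal ((norm (s i y - s (r k) y))\<^sup>2) \<partial>?L) \<le> ennreal (e\<^sup>2)"
        using eventually_sequentially by blast
    qed simp
    finally show ?thesis .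
  qed
  have bound: "L2_fun a b (\<lambda>y. s i y - g y) \<and> L2n a b (\<lambda>y. s i y - g y) \<le> e"
    if "e > 0" and i: "\<And>j. j \<ge> M \<Longrightarrow> L2n a b (\<lambda>y. s i y - s j y) < e" for i M e
  proof -
    have c: "(\<integral>\<^sup>+y. ennreal ((norm (s i y - g y))\<^sup>2) \<partial>?L) \<le> ennreal (e\<^sup>2)" by (rule close[OF that])
    then have "(\<integral>\<^sup>+y. ennreal ((norm (s i y - g y))\<^sup>2) \<partial>?L) < \<infinity>"
      by (rule le_less_trans) simp
    then have int: "integrable ?L (\<lambda>y. (norm (s i y - g y))\<^sup>2)"
      by (intro integrableI_nonneg) auto
    then have L: "L2_fun a b (\<lambda>y. s i y - g y)" by (simp add: L2_fun_iff)
    have "(L2n a b (\<lambda>y. s i y - g y))\<^sup>2 = (\<integral>y. (norm (s i y - g y))\<^sup>2 \<partial>?L)"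
      unfolding L2n_square[OF L] by (rule lebesgue_integral_eq_integral[OF int, symmetric]) simp
    also have "\<dots> \<le> e\<^sup>2" using c by (subst (asm) nn_integral_eq_integral[OF int]) auto
    finally show ?thesis using L \<open>e > 0\<close> by (auto intro: power2_le_imp_le)
  qed
  obtain M1 where "\<And>i j. i \<ge> M1 \<Longrightarrow> j \<ge> M1 \<Longrightarrow> L2n a b (\<lambda>y. s i y - s j y) < 1"
    using cauchy[of 1] by auto
  then have "L2_fun a b (\<lambda>y. s M1 y - g y)" using bound[of 1 M1 M1] by auto
  then have "L2_fun a b (\<lambda>y. s M1 y - (s M1 y - g y))" by (rule L2_fun_diff[OF s])
  then have g: "L2_fun a b g" by simp
  have "(\<lambda>i. L2n a b (\<lambda>y. s i y - g y)) \<longlonglongrightarrow> 0"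
  proof (rule LIMSEQ_I)
    fix e :: real assume "e > 0"
    then obtain M where M: "\<And>i j. i \<ge> M \<Longrightarrow> j \<ge> M \<Longrightarrow> L2n a b (\<lambda>y. s i y - s j y) < e / 2"
      using cauchy[of "e/2"] by auto
    have "norm (L2n a b (\<lambda>y. s i y - g y) - 0) < e" if "i \<ge> M" for i
      using bound[of "e/2" M i] M[OF that] \<open>e > 0\<close> L2n_nonneg[of a b "\<lambda>y. s i y - g y"] by auto
    then show "\<exists>no. \<forall>n\<ge>no. norm (L2n a b (\<lambda>y. s n y - g y) - 0) < e" by blast
  qed
  with g show ?thesis by blast
qed

section \<open>Semi-discrete Sobolev spaces\<close>

lemma H1_deriv_L2: "H1_deriv a b q g \<Longrightarrow> L2_fun a b g"
  unfolding H1_deriv_def by blast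

lemma H1_deriv_eq: "H1_deriv a b q g \<Longrightarrow> y \<in> {a..b} \<Longrightarrow> q y = q a + integral {a..y} g"
  unfolding H1_deriv_def by blast

text \<open>The difference of two derivatives has indefinite integral zero, so it vanishes almost
  everywhere by Lebesgue differentiation. This is what makes the choice in \<open>y_deriv\<close>
  harmless under integrals.\<close>

lemma H1_deriv_unique:
  assumes g: "H1_deriv a b q g" and g': "H1_deriv a b q g'" and "a \<le> b"
  shows "\<exists>N. negligible N \<and> (\<forall>y\<in>{a..b} - N. g y = g' y)"
proof -
  have Lg: "L2_fun a b g" "L2_fun a b g'" using g g' by (auto intro: H1_deriv_L2)
  \<comment> \<open>The extension by zero is integrable over every box, as the differentiation
    theorem requires.\<close>
  define f where "f y = (if y \<in> {a..b} then g y - g' y else 0)" for y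
  have sub: "g integrable_on {c..d}" "g' integrable_on {c..d}" if "{c..d} \<subseteq> {a..b}" for c d
    using L2_fun_integrable[OF Lg(1)] L2_fun_integrable[OF Lg(2)] that integrable_on_subinterval by blast+
  have zero: "integral {a..y} f = 0" if "y \<in> {a..b}" for y
  proof -
    have "integral {a..y} f = integral {a..y} (\<lambda>t. g t - g' t)"
      by (rule Henstock_Kurzweil_Integration.integral_cong) (use that in \<open>auto simp: f_def\<close>)
    also have "\<dots> = integral {a..y} g - integral {a..y} g'"
      by (rule Henstock_Kurzweil_Integration.integral_diff) (use that in \<open>auto intro!: sub\<close>)
    also have "\<dots> = 0" using H1_deriv_eq[OF g that] H1_deriv_eq[OF g' that] by simp
    finally show ?thesis .
  qed
  have "(\<lambda>t. g t - g' t) integrable_on {a..b}"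
    by (intro Henstock_Kurzweil_Integration.integrable_diff sub) auto
  then have fU: "f integrable_on UNIV"
    unfolding f_def by (subst integrable_restrict_UNIV)
  then have f_int: "f integrable_on cbox c d" for c d
    using integrable_on_subcbox by blast
  obtain N where N: "negligible N" "\<And>x e. x \<notin> N \<Longrightarrow> 0 < e \<Longrightarrow>
      \<exists>d>0. \<forall>h. 0 < h \<and> h < d \<longrightarrow> norm (integral (cbox x (x + h *\<^sub>R One)) f /\<^sub>R h ^ DIM(real) - f x) < e"
    using integrable_ccontinuous_explicit[OF f_int] by blast
  \<comment> \<open>The point \<open>b\<close> is excluded because the averages are taken over
    intervals to the right of \<open>x\<close>.\<close>
  have "g x = g' x" if x: "x \<in> {a..b} - (N \<union> {b})" for x
  proof -
    have "norm (f x) < e" if "e > 0" for e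
    proof -
      from N(2)[of x e] x that obtain d where d: "d > 0"
        "\<And>h. 0 < h \<Longrightarrow> h < d \<Longrightarrow> norm (integral (cbox x (x + h *\<^sub>R One)) f /\<^sub>R h ^ DIM(real) - f x) < e"
        by blast
      define h where "h = min (d / 2) (b - x)"
      have h: "0 < h" "h < d" "x + h \<le> b" using d(1) x by (auto simp: h_def)
      have "integral {a..x} f + integral {x..x + h} f = integral {a..x + h} f"
        by (rule Henstock_Kurzweil_Integration.integral_combine)
          (use x h f_int[of a "x + h"] in auto)
      then have "integral {x..x + h} f = 0" using zero[of x] zero[of "x + h"] x h by simp
      then show ?thesis using d(2)[OF h(1,2)] by simp
    qed
    then have "f x = 0" by (metis less_irrefl norm_eq_zero zero_less_norm_iff)
    then show ?thesis using x by (simp add: f_def)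
  qed
  moreover have "negligible (N \<union> {b})" using N(1) by (simp add: negligible_Un)
  ultimately show ?thesis by blast
qed

lemma H1_deriv_comb:
  assumes g: "H1_deriv a b p g" and h: "H1_deriv a b q h"
  shows "H1_deriv a b (\<lambda>y. p y + c *\<^sub>R q y) (\<lambda>y. g y + c *\<^sub>R h y)"
proof -
  have L: "L2_fun a b g" "L2_fun a b h" using g h by (auto intro: H1_deriv_L2)
  have "integral {a..y} (\<lambda>y. g y + c *\<^sub>R h y) = integral {a..y} g + c *\<^sub>R integral {a..y} h"
    if "y \<in> {a..b}" for y
  proof -
    have "{a..y} \<subseteq> {a..b}" using that by auto
    then have "g integrable_on {a..y}" "h integrable_on {a..y}"
      using L2_fun_integrable[OF L(1)] L2_fun_integrable[OF L(2)] integrable_on_subinterval by blast+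
    then show ?thesis by (simp add: Henstock_Kurzweil_Integration.integral_add integrable_cmul)
  qed
  then have "p y + c *\<^sub>R q y = p a + c *\<^sub>R q a + integral {a..y} (\<lambda>y. g y + c *\<^sub>R h y)"
    if "y \<in> {a..b}" for y
    unfolding H1_deriv_eq[OF g that] H1_deriv_eq[OF h that] using that by (simp add: scaleR_add_right)
  then show ?thesis
    unfolding H1_deriv_def using L2_fun_comb[OF L] by blast
qed

lemma H1_deriv_diff_eq:
  assumes "H1_deriv a b q g" "a \<le> x" "x \<le> y" "y \<le> b"
  shows "q y = q x + integral {x..y} g"
proof -
  have L: "L2_fun a b g" using assms(1) by (rule H1_deriv_L2)
  have "integral {a..x} g + integral {x..y} g = integral {a..y} g"
    by (rule Henstock_Kurzweil_Integration.integral_combine)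
      (use assms integrable_on_subinterval[OF L2_fun_integrable[OF L], of a y] in auto)
  moreover have "q y = q a + integral {a..y} g" "q x = q a + integral {a..x} g"
    using assms by (auto intro!: H1_deriv_eq)
  ultimately show ?thesis by (metis add.assoc)
qed

lemma H1_deriv_continuous:
  assumes "H1_deriv a b q g"
  shows "continuous_on {a..b} q"
proof -
  have "g integrable_on {a..b}" using assms by (intro L2_fun_integrable H1_deriv_L2)
  then have "continuous_on {a..b} (\<lambda>y. q a + integral {a..y} g)"
    by (intro continuous_intros indefinite_integral_continuous_1)
  then show ?thesis
    by (rule continuous_on_eq) (simp add: H1_deriv_eq[OF assms, symmetric])
qed

lemma H1_deriv_dist_le:
  assumes q: "H1_deriv a b q g" and y: "y \<in> {a..b}" "z \<in> {a..b}"
  shows "norm (q y - q z) \<le> sqrt (b - a) * L2n a b g"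
proof -
  have L: "L2_fun a b g" using q by (rule H1_deriv_L2)
  have "norm (q y - q x) \<le> sqrt (b - a) * L2n a b g" if "a \<le> x" "x \<le> y" "y \<le> b" for x y
    using norm_integral_le_L2n[OF L, of x y] H1_deriv_diff_eq[OF q that] that by simp
  then show ?thesis using y by (metis atLeastAtMost_iff linorder_linear norm_minus_commute)
qed

text \<open>Compare \<open>q y\<close> with \<open>q z\<close> and integrate the squares over
  \<open>z\<close>: this replaces the value at one point by the \<open>L\<^sub>2\<close> norm of
  \<open>q\<close>, while the oscillation of \<open>q\<close> is controlled by its
  derivative.\<close>

lemma H1_deriv_sup_bound:
  assumes q: "H1_deriv a b q g" and "a < b" and y: "y \<in> {a..b}"
  shows "(b - a) * (norm (q y))\<^sup>2 \<le> 2 * (L2n a b q)\<^sup>2 + 2 * (b - a)\<^sup>2 * (L2n a b g)\<^sup>2"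
proof -
  have L: "L2_fun a b g" using q by (rule H1_deriv_L2)
  have Lq: "L2_fun a b q" by (rule L2_fun_continuous[OF H1_deriv_continuous[OF q]])
  have pt: "(norm (q y))\<^sup>2 \<le> 2 * (norm (q z))\<^sup>2 + 2 * ((b - a) * (L2n a b g)\<^sup>2)" if z: "z \<in> {a..b}" for z
  proof -
    let ?D = "sqrt (b - a) * L2n a b g"
    have "norm (q y) \<le> norm (q z) + ?D"
      using H1_deriv_dist_le[OF q y z] norm_triangle_sub[of "q y" "q z"] by linarith
    then have "(norm (q y))\<^sup>2 \<le> (norm (q z) + ?D)\<^sup>2" by (intro power_mono) auto
    also have "\<dots> \<le> 2 * (norm (q z))\<^sup>2 + 2 * ?D\<^sup>2"
      using zero_le_power2[of "norm (q z) - ?D"] by (simp only: power2_sum power2_diff)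
    finally show ?thesis using \<open>a < b\<close> by (simp add: power_mult_distrib)
  qed
  have I: "(\<lambda>z. 2 * (norm (q z))\<^sup>2) integrable_on {a..b}"
    by (intro integrable_on_mult_right L2_fun_square_integrable Lq)
  then have "(\<lambda>z. 2 * (norm (q z))\<^sup>2 + 2 * ((b - a) * (L2n a b g)\<^sup>2)) integrable_on {a..b}"
    by (intro Henstock_Kurzweil_Integration.integrable_add) auto
  then have "integral {a..b} (\<lambda>z. (norm (q y))\<^sup>2)
      \<le> integral {a..b} (\<lambda>z. 2 * (norm (q z))\<^sup>2 + 2 * ((b - a) * (L2n a b g)\<^sup>2))"
    by (intro integral_le pt) auto
  also have "\<dots> = 2 * (L2n a b q)\<^sup>2 + 2 * (b - a)\<^sup>2 * (L2n a b g)\<^sup>2"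
    using \<open>a < b\<close> by (subst Henstock_Kurzweil_Integration.integral_add[OF I])
      (auto simp: L2n_square[OF Lq] power2_eq_square[of "b - a"] algebra_simps)
  finally show ?thesis using \<open>a < b\<close> by simp
qed

section \<open>Functions on the grid lines and their inner product\<close>

lemma interior_idx_subset: "interior_idx m \<subseteq> grid_idx m"
  by (auto simp: interior_idx_def grid_idx_def intro: order_trans[OF _ diff_le_self])

lemma y_deriv_H1_deriv:
  "Q \<in> H1h A m a b \<Longrightarrow> J \<in> interior_idx m \<Longrightarrow> H1_deriv a b (Q J) (y_deriv a b Q J)"
  unfolding y_deriv_def by (rule someI_ex[of "H1_deriv a b (Q J)"]) (simp add: H1h_def)

lemma H1h_L2:
  assumes "Q \<in> H1h A m a b" "J \<in> interior_idx m"
  shows "continuous_on {a..b} (Q J)" "L2_fun a b (Q J)" "L2_fun a b (x_diff A m k Q J)" "L2_fun a b (y_deriv a b Q J)"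
proof -
  note d = y_deriv_H1_deriv[OF assms]
  show "continuous_on {a..b} (Q J)" by (rule H1_deriv_continuous[OF d])
  then show "L2_fun a b (Q J)" by (rule L2_fun_continuous)
  show "L2_fun a b (x_diff A m k Q J)" using assms by (auto simp: H1h_def)
  show "L2_fun a b (y_deriv a b Q J)" using d by (rule H1_deriv_L2)
qed

lemma x_diff_comb:
  "x_diff A m k (\<lambda>J y. Q J y + c *\<^sub>R V J y) J y = x_diff A m k Q J y + c *\<^sub>R x_diff A m k V J y"
  by (simp add: x_diff_def algebra_simps)

lemma x_diff_zero: "x_diff A m k (\<lambda>J y. 0) J = (\<lambda>y. 0)"
  by (simp add: x_diff_def fun_eq_iff)

lemma H1h_comb:
  assumes "Q \<in> H1h A m a b" "V \<in> H1h A m a b"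
  shows "(\<lambda>J y. Q J y + c *\<^sub>R V J y) \<in> H1h A m a b"
proof -
  have "\<exists>g. H1_deriv a b (\<lambda>y. Q J y + c *\<^sub>R V J y) g" if "J \<in> interior_idx m" for J
    using H1_deriv_comb[OF y_deriv_H1_deriv[OF assms(1) that] y_deriv_H1_deriv[OF assms(2) that]] by blast
  moreover have "L2_fun a b (x_diff A m k (\<lambda>J y. Q J y + c *\<^sub>R V J y) J)" if "J \<in> interior_idx m" for J k
  proof -
    have "x_diff A m k (\<lambda>J y. Q J y + c *\<^sub>R V J y) J = (\<lambda>y. x_diff A m k Q J y + c *\<^sub>R x_diff A m k V J y)"
      by (simp add: fun_eq_iff x_diff_comb)
    then show ?thesis using L2_fun_comb[OF H1h_L2(3)[OF assms(1) that] H1h_L2(3)[OF assms(2) that]] by simp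
  qed
  ultimately show ?thesis using assms by (auto simp: H1h_def)
qed

text \<open>Both sides are derivatives of the same function and so agree off a null set; the choice
  in \<open>y_deriv\<close> guarantees no pointwise identity.\<close>

lemma y_deriv_comb_ae:
  assumes "Q \<in> H1h A m a b" "V \<in> H1h A m a b" "J \<in> interior_idx m" "a \<le> b"
  shows "\<exists>N. negligible N \<and> (\<forall>y\<in>{a..b} - N. y_deriv a b (\<lambda>J y. Q J y + c *\<^sub>R V J y) J y
     = y_deriv a b Q J y + c *\<^sub>R y_deriv a b V J y)"
  by (rule H1_deriv_unique[OF y_deriv_H1_deriv[OF H1h_comb[OF assms(1,2)] assms(3)]
        H1_deriv_comb[OF y_deriv_H1_deriv[OF assms(1,3)] y_deriv_H1_deriv[OF assms(2,3)]] assms(4)])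

lemma L2h_norm_eq_nrm: "L2h_norm m a b Q = L2.nrm a b (interior_idx m) Q"
  by (simp add: L2h_norm_def L2.nrm_def L2ip_def power2_norm_eq_inner)

lemma H1h_in_L2S:
  assumes "Q \<in> H1h A m a b"
  shows "Q \<in> L2S a b (interior_idx m)" "x_diff A m k Q \<in> L2S a b (interior_idx m)"
    "y_deriv a b Q \<in> L2S a b (interior_idx m)"
  using H1h_L2[OF assms] by (auto simp: L2S_def)

text \<open>The factor \<open>CARD('n)\<close> arises because the definition repeats the terms
  without a difference quotient for every direction \<open>k\<close>.\<close>

lemma H1h_inner_eq:
  assumes Q: "Q \<in> H1h A m a b" and V: "(V :: ('n::finite, 'N::finite) sdf) \<in> H1h A m a b"
  shows "H1h_inner A m a b Q V = real CARD('n) * L2ip a b (interior_idx m) Q V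
     + (\<Sum>k\<in>UNIV. L2ip a b (interior_idx m) (x_diff A m k Q) (x_diff A m k V))
     + real CARD('n) * L2ip a b (interior_idx m) (y_deriv a b Q) (y_deriv a b V)"
proof -
  have "integral {a..b} (\<lambda>y. Q J y \<bullet> V J y + x_diff A m k Q J y \<bullet> x_diff A m k V J y + y_deriv a b Q J y \<bullet> y_deriv a b V J y)
     = integral {a..b} (\<lambda>y. Q J y \<bullet> V J y) + integral {a..b} (\<lambda>y. x_diff A m k Q J y \<bullet> x_diff A m k V J y)
       + integral {a..b} (\<lambda>y. y_deriv a b Q J y \<bullet> y_deriv a b V J y)" if J: "J \<in> interior_idx m" for J k
    using H1h_L2[OF Q J] H1h_L2[OF V J]
    by (simp add: Henstock_Kurzweil_Integration.integral_add Henstock_Kurzweil_Integration.integrable_add L2_fun_inner_integrable)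
  then have "H1h_inner A m a b Q V = (\<Sum>J\<in>interior_idx m. \<Sum>k\<in>(UNIV::'n set). integral {a..b} (\<lambda>y. Q J y \<bullet> V J y)
       + integral {a..b} (\<lambda>y. x_diff A m k Q J y \<bullet> x_diff A m k V J y)
       + integral {a..b} (\<lambda>y. y_deriv a b Q J y \<bullet> y_deriv a b V J y))"
    by (simp add: H1h_inner_def)
  also have "\<dots> = real CARD('n) * L2ip a b (interior_idx m) Q V
     + (\<Sum>J\<in>interior_idx m. \<Sum>k\<in>(UNIV::'n set). integral {a..b} (\<lambda>y. x_diff A m k Q J y \<bullet> x_diff A m k V J y))
     + real CARD('n) * L2ip a b (interior_idx m) (y_deriv a b Q) (y_deriv a b V)"
    by (simp add: L2ip_def sum.distrib sum_distrib_left)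
  also have "(\<Sum>J\<in>interior_idx m. \<Sum>k\<in>(UNIV::'n set). integral {a..b} (\<lambda>y. x_diff A m k Q J y \<bullet> x_diff A m k V J y))
     = (\<Sum>k\<in>(UNIV::'n set). L2ip a b (interior_idx m) (x_diff A m k Q) (x_diff A m k V))"
    unfolding L2ip_def by (rule sum.swap)
  finally show ?thesis .
qed

lemma L2ip_cong_ae:
  assumes "\<And>J. J \<in> I \<Longrightarrow> \<exists>N. negligible N \<and> (\<forall>y\<in>{a..b} - N. Q J y = Q' J y)"
  shows "L2ip a b I Q V = L2ip a b I Q' V"
  unfolding L2ip_def
proof (rule sum.cong[OF refl])
  fix J assume "J \<in> I"
  from assms[OF this] obtain N where "negligible N" "\<forall>y\<in>{a..b} - N. Q J y = Q' J y" by blast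
  then show "integral {a..b} (\<lambda>y. Q J y \<bullet> V J y) = integral {a..b} (\<lambda>y. Q' J y \<bullet> V J y)"
    by (intro integral_spike[of N]) auto
qed

lemma L2ip_commute: "L2ip a b I Q V = L2ip a b I V Q"
  by (simp add: L2ip_def inner_commute)

lemma L2_nrm_cong_ae:
  assumes "\<And>J. J \<in> I \<Longrightarrow> \<exists>N. negligible N \<and> (\<forall>y\<in>{a..b} - N. Q J y = Q' J y)"
  shows "L2.nrm a b I Q = L2.nrm a b I Q'"
proof -
  have "L2ip a b I Q Q = L2ip a b I Q' Q" by (rule L2ip_cong_ae[OF assms])
  also have "\<dots> = L2ip a b I Q Q'" by (rule L2ip_commute)
  also have "\<dots> = L2ip a b I Q' Q'" by (rule L2ip_cong_ae[OF assms])
  finally show ?thesis by (simp add: L2.nrm_def)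
qed

lemma semi_inner_H1h:
  assumes "a \<le> b"
  shows "semi_inner (H1h A m a b :: ('n::finite, 'N::finite) sdf set) (H1h_inner A m a b)"
proof
  have "(\<lambda>J y. 0) \<in> (H1h A m a b :: ('n, 'N) sdf set)"
    by (auto simp: H1h_def H1_deriv_def x_diff_zero intro!: exI[of _ "\<lambda>y. 0"] L2_fun_zero)
  then show "(H1h A m a b :: ('n, 'N) sdf set) \<noteq> {}" by blast
  show "(\<lambda>J y. u J y + c *\<^sub>R v J y) \<in> H1h A m a b"
    if "u \<in> H1h A m a b" "v \<in> H1h A m a b" for u v :: "('n, 'N) sdf" and c
    using that by (rule H1h_comb)
  show "H1h_inner A m a b (\<lambda>J y. u J y + c *\<^sub>R v J y) w = H1h_inner A m a b u w + c * H1h_inner A m a b v w"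
    if u: "u \<in> H1h A m a b" and v: "v \<in> H1h A m a b" and w: "w \<in> H1h A m a b" for u v w :: "('n, 'N) sdf" and c
  proof -
    let ?I = "interior_idx m :: (nat^'n) set"
    have 1: "L2ip a b ?I (\<lambda>J y. u J y + c *\<^sub>R v J y) w = L2ip a b ?I u w + c * L2ip a b ?I v w"
      by (rule L2.ip_comb[OF H1h_in_L2S(1)[OF u] H1h_in_L2S(1)[OF v] H1h_in_L2S(1)[OF w]])
    have 2: "L2ip a b ?I (x_diff A m k (\<lambda>J y. u J y + c *\<^sub>R v J y)) (x_diff A m k w)
       = L2ip a b ?I (x_diff A m k u) (x_diff A m k w) + c * L2ip a b ?I (x_diff A m k v) (x_diff A m k w)" for k
    proof -
      have "x_diff A m k (\<lambda>J y. u J y + c *\<^sub>R v J y) = (\<lambda>J y. x_diff A m k u J y + c *\<^sub>R x_diff A m k v J y)"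
        by (simp add: fun_eq_iff x_diff_comb)
      then show ?thesis by (simp add: L2.ip_comb H1h_in_L2S u v w)
    qed
    have "L2ip a b ?I (y_deriv a b (\<lambda>J y. u J y + c *\<^sub>R v J y)) (y_deriv a b w)
       = L2ip a b ?I (\<lambda>J y. y_deriv a b u J y + c *\<^sub>R y_deriv a b v J y) (y_deriv a b w)"
      by (rule L2ip_cong_ae[OF y_deriv_comb_ae[OF u v _ assms]])
    also have "\<dots> = L2ip a b ?I (y_deriv a b u) (y_deriv a b w) + c * L2ip a b ?I (y_deriv a b v) (y_deriv a b w)"
      by (rule L2.ip_comb[OF H1h_in_L2S(3)[OF u] H1h_in_L2S(3)[OF v] H1h_in_L2S(3)[OF w]])
    finally show ?thesis
      by (simp add: H1h_inner_eq u v w H1h_comb 1 2 sum.distrib sum_distrib_left algebra_simps)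
  qed
  show "H1h_inner A m a b u v = H1h_inner A m a b v u" for u v :: "('n, 'N) sdf"
    by (simp add: H1h_inner_def inner_commute)
  show "0 \<le> H1h_inner A m a b u u" if "u \<in> H1h A m a b" for u :: "('n, 'N) sdf"
    using that by (auto simp: H1h_inner_eq intro!: add_nonneg_nonneg sum_nonneg mult_nonneg_nonneg L2.ip_nonneg H1h_in_L2S)
qed

lemma H1h_norm_eq_nrm:
  "a \<le> b \<Longrightarrow> H1h_norm A m a b Q = semi_inner.nrm (H1h_inner A m a b) Q"
  unfolding semi_inner.nrm_def[OF semi_inner_H1h] by (simp add: H1h_norm_def H1h_inner_def power2_norm_eq_inner)

lemma H1h_norm_square:
  fixes Q :: "('n::finite, 'N::finite) sdf"
  assumes "a \<le> b" and Q: "Q \<in> H1h A m a b"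
  shows "(H1h_norm A m a b Q)\<^sup>2 = real CARD('n) * (L2h_norm m a b Q)\<^sup>2
    + (\<Sum>k\<in>UNIV. (L2h_norm m a b (x_diff A m k Q))\<^sup>2) + real CARD('n) * (L2h_norm m a b (y_deriv a b Q))\<^sup>2"
proof -
  interpret H1: semi_inner "H1h A m a b :: ('n, 'N) sdf set" "H1h_inner A m a b"
    by (rule semi_inner_H1h[OF assms(1)])
  show ?thesis
    unfolding H1h_norm_eq_nrm[OF assms(1)] H1.nrm_square[OF Q] H1h_inner_eq[OF Q Q] L2h_norm_eq_nrm
    by (simp add: L2.nrm_square H1h_in_L2S[OF Q])
qed

lemma L2h_norm_nonneg:
  assumes "Q \<in> L2S a b (interior_idx m)"
  shows "0 \<le> L2h_norm m a b Q"
  unfolding L2h_norm_eq_nrm by (rule L2.nrm_nonneg[OF assms])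

lemma H1h_norm_nonneg: "a \<le> b \<Longrightarrow> Q \<in> H1h A m a b \<Longrightarrow> 0 \<le> H1h_norm A m a b Q"
  unfolding H1h_norm_eq_nrm by (rule semi_inner.nrm_nonneg[OF semi_inner_H1h])

lemma L2h_norms_le_H1h_norm:
  fixes Q :: "('n::finite, 'N::finite) sdf"
  assumes "a \<le> b" and Q: "Q \<in> H1h A m a b"
  shows "L2h_norm m a b Q \<le> H1h_norm A m a b Q"
    "L2h_norm m a b (x_diff A m k Q) \<le> H1h_norm A m a b Q"
    "L2h_norm m a b (y_deriv a b Q) \<le> H1h_norm A m a b Q"
proof -
  have n: "real CARD('n) \<ge> 1" by (simp add: Suc_leI)
  have le: "x \<le> real CARD('n) * x" if "0 \<le> x" for x
    using mult_right_mono[OF n that] by simp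
  let ?X = "\<lambda>k. (L2h_norm m a b (x_diff A m k Q))\<^sup>2"
  have k: "?X k \<le> (\<Sum>k\<in>UNIV. ?X k)" by (rule member_le_sum) auto
  have s: "0 \<le> (\<Sum>k\<in>UNIV. ?X k)" by (intro sum_nonneg) auto
  note sq = H1h_norm_square[OF assms]
  note l = le[of "(L2h_norm m a b Q)\<^sup>2"] le[of "(L2h_norm m a b (y_deriv a b Q))\<^sup>2"]
  have p: "0 \<le> (L2h_norm m a b Q)\<^sup>2" "0 \<le> (L2h_norm m a b (y_deriv a b Q))\<^sup>2" by auto
  have "(L2h_norm m a b Q)\<^sup>2 \<le> (H1h_norm A m a b Q)\<^sup>2"
    "?X k \<le> (H1h_norm A m a b Q)\<^sup>2"
    "(L2h_norm m a b (y_deriv a b Q))\<^sup>2 \<le> (H1h_norm A m a b Q)\<^sup>2"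
    unfolding sq using l p s k by linarith+
  then show "L2h_norm m a b Q \<le> H1h_norm A m a b Q"
    "L2h_norm m a b (x_diff A m k Q) \<le> H1h_norm A m a b Q"
    "L2h_norm m a b (y_deriv a b Q) \<le> H1h_norm A m a b Q"
    using H1h_norm_nonneg[OF assms] power2_le_imp_le by blast+
qed

lemma L2h_norm_square:
  assumes "Q \<in> L2S a b (interior_idx m)"
  shows "(L2h_norm m a b Q)\<^sup>2 = (\<Sum>J\<in>interior_idx m. (L2n a b (Q J))\<^sup>2)"
  unfolding L2h_norm_eq_nrm L2.nrm_square[OF assms] L2ip_def
  by (intro sum.cong refl) (use assms in \<open>auto simp: L2S_def L2n_square power2_norm_eq_inner\<close>)

lemma L2n_le_L2h_norm:
  assumes Q: "Q \<in> L2S a b (interior_idx m)" and J: "J \<in> interior_idx m"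
  shows "L2n a b (Q J) \<le> L2h_norm m a b Q"
proof -
  have "(L2n a b (Q J))\<^sup>2 \<le> (L2h_norm m a b Q)\<^sup>2"
    unfolding L2h_norm_square[OF Q] by (rule member_le_sum[OF J]) (auto simp: finite_interior_idx)
  then show ?thesis by (rule power2_le_imp_le) (rule L2h_norm_nonneg[OF Q])
qed

text \<open>The constant of the embedding of \<open>H\<^sup>1(a,b)\<close> into the continuous
  functions: it is what \<open>H1_deriv_sup_bound\<close> gives when both norms are replaced by a
  common bound.\<close>

definition sob :: "real \<Rightarrow> real \<Rightarrow> real" where
  "sob a b = sqrt ((2 + 2 * (b - a)\<^sup>2) / (b - a))"

text \<open>Each grid line is one-dimensional, so the embedding needs the \<open>y\<close>
  derivative only, and its constant depends neither on the dimension nor on the grid.\<close>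

lemma H1h_sup_bound:
  assumes "a < b" and Q: "Q \<in> H1h A m a b" and J: "J \<in> interior_idx m" and y: "y \<in> {a..b}"
  shows "norm (Q J y) \<le> sob a b * H1h_norm A m a b Q"
proof -
  let ?H = "H1h_norm A m a b Q"
  have ab: "a \<le> b" using \<open>a < b\<close> by simp
  have "L2n a b (Q J) \<le> ?H" "L2n a b (y_deriv a b Q J) \<le> ?H"
    using L2n_le_L2h_norm[OF H1h_in_L2S(1)[OF Q] J] L2n_le_L2h_norm[OF H1h_in_L2S(3)[OF Q] J]
      L2h_norms_le_H1h_norm[OF ab Q] by (auto intro: order_trans)
  then have sq: "(L2n a b (Q J))\<^sup>2 \<le> ?H\<^sup>2" "(L2n a b (y_deriv a b Q J))\<^sup>2 \<le> ?H\<^sup>2"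
    by (auto intro!: power_mono L2n_nonneg H1h_L2[OF Q J])
  have "(b - a) * (norm (Q J y))\<^sup>2 \<le> 2 * (L2n a b (Q J))\<^sup>2 + 2 * (b - a)\<^sup>2 * (L2n a b (y_deriv a b Q J))\<^sup>2"
    by (rule H1_deriv_sup_bound[OF y_deriv_H1_deriv[OF Q J] \<open>a < b\<close> y])
  also have "\<dots> \<le> 2 * ?H\<^sup>2 + 2 * (b - a)\<^sup>2 * ?H\<^sup>2"
    by (intro add_mono mult_left_mono sq) auto
  finally have "(norm (Q J y))\<^sup>2 \<le> (2 + 2 * (b - a)\<^sup>2) / (b - a) * ?H\<^sup>2"
    using \<open>a < b\<close> by (simp add: field_simps)
  also have "\<dots> = (sob a b * ?H)\<^sup>2"
    using \<open>a < b\<close> by (simp add: sob_def power_mult_distrib)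
  finally show ?thesis
    by (rule power2_le_imp_le) (use H1h_norm_nonneg[OF ab Q] \<open>a < b\<close> in \<open>simp add: sob_def\<close>)
qed

section \<open>Zero boundary values: discrete inequalities and completeness\<close>

lemma H1h0_D:
  assumes "v \<in> H1h0 A m a b"
  shows "v \<in> H1h A m a b" "J \<notin> interior_idx m \<Longrightarrow> v J y = 0" "a \<le> b \<Longrightarrow> v J a = 0" "a \<le> b \<Longrightarrow> v J b = 0"
proof -
  show H: "v \<in> H1h A m a b" using assms by (simp add: H1h0_def)
  have off: "J \<notin> grid_idx m \<or> y \<notin> {a..b} \<Longrightarrow> v J y = 0" for J y
    using H unfolding H1h_def by blast
  have bd: "(J, y) \<in> boundary_h m a b \<Longrightarrow> v J y = 0" for J y
    using assms unfolding H1h0_def boundary_eq_def by blast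
  \<comment> \<open>Either \<open>(J, y)\<close> is a boundary point or the normalization of
    \<open>H1h\<close> applies; thus \<open>v\<close> is its own extension by zero beyond the
    interior lines.\<close>
  show "v J y = 0" if "J \<notin> interior_idx m" for J y
    using off[of J y] bd[of J y] that by (auto simp: boundary_h_def)
  show "v J a = 0" "v J b = 0" if "a \<le> b" for J
    using off[of J a] off[of J b] bd[of J a] bd[of J b] that by (auto simp: boundary_h_def)
qed

lemma H1h0_comb: "u \<in> H1h0 A m a b \<Longrightarrow> v \<in> H1h0 A m a b \<Longrightarrow> (\<lambda>J y. u J y + c *\<^sub>R v J y) \<in> H1h0 A m a b"
  unfolding H1h0_def using H1h_comb by (fastforce simp: boundary_eq_def)

lemma H1h0_diff: 
  assumes "V \<in> H1h A m a b" "W \<in> H1h A m a b" "boundary_eq m a b V P" "boundary_eq m a b W P"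
  shows "(\<lambda>J y. V J y - W J y) \<in> H1h0 A m a b"
  using H1h_comb[OF assms(1,2), of "-1"] assms(3,4) by (fastforce simp: boundary_eq_def H1h0_def)

lemma H1h0_add:
  assumes "W \<in> H1h A m a b" "boundary_eq m a b W P" "v \<in> H1h0 A m a b"
  shows "(\<lambda>J y. W J y + v J y) \<in> H1h A m a b" "boundary_eq m a b (\<lambda>J y. W J y + v J y) P"
  using H1h_comb[OF assms(1) H1h0_D(1)[OF assms(3)], of 1] assms(2,3)
  by (fastforce simp: boundary_eq_def H1h0_def)+

lemma semi_inner_H1h0:
  assumes "a \<le> b"
  shows "semi_inner (H1h0 A m a b :: ('n::finite, 'N::finite) sdf set) (H1h_inner A m a b)"
proof -
  interpret H1: semi_inner "H1h A m a b :: ('n, 'N) sdf set" "H1h_inner A m a b"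
    by (rule semi_inner_H1h[OF assms])
  have "(\<lambda>J y. 0) \<in> (H1h0 A m a b :: ('n, 'N) sdf set)"
    using H1.S_zero by (simp add: H1h0_def boundary_eq_def)
  then show ?thesis
    by unfold_locales (auto intro: H1h0_comb H1.ip_comb H1.ip_commute H1.ip_nonneg H1h0_D(1))
qed

lemma H1h0_L2: "v \<in> H1h0 A m a b \<Longrightarrow> L2_fun a b (v J)"
proof (cases "J \<in> interior_idx m")
  case False
  assume "v \<in> H1h0 A m a b"
  then have "v J = (\<lambda>y. 0)" using H1h0_D(2)[of v A m a b J] False by blast
  then show ?thesis by (simp add: L2_fun_zero)
next
  case True
  assume "v \<in> H1h0 A m a b"
  then show ?thesis by (rule H1h_L2(2)[OF H1h0_D(1) True])
qed

text \<open>A shifted index may leave the interior, where \<open>v\<close> is zero, and injectivity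
  prevents a line from being counted twice; so the shifted norm is a sum over a subset of the
  interior lines.\<close>

lemma L2h_norm_shift:
  fixes v :: "('n::finite, 'N::finite) sdf" and \<sigma> :: "nat^'n \<Rightarrow> nat^'n"
  assumes v: "v \<in> H1h0 A m a b" and inj: "inj_on \<sigma> (interior_idx m)"
  shows "(\<lambda>J. v (\<sigma> J)) \<in> L2S a b (interior_idx m)" "L2h_norm m a b (\<lambda>J. v (\<sigma> J)) \<le> L2h_norm m a b v"
proof -
  let ?I = "interior_idx m :: (nat^'n) set"
  define q where "q J = integral {a..b} (\<lambda>y. (norm (v J y))\<^sup>2)" for J
  have q0: "0 \<le> q J" for J
    unfolding q_def by (intro integral_nonneg L2_fun_square_integrable H1h0_L2[OF v]) auto
  have qz: "q J = 0" if "J \<notin> ?I" for J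
    unfolding q_def using H1h0_D(2)[OF v that] by simp
  have "(\<Sum>J\<in>?I. q (\<sigma> J)) = sum q (\<sigma> ` ?I)" by (simp add: sum.reindex[OF inj])
  also have "\<dots> = sum q (\<sigma> ` ?I \<inter> ?I)"
    by (intro sum.mono_neutral_right) (auto simp: finite_interior_idx qz)
  also have "\<dots> \<le> sum q ?I" by (intro sum_mono2) (auto simp: finite_interior_idx q0)
  finally show "L2h_norm m a b (\<lambda>J. v (\<sigma> J)) \<le> L2h_norm m a b v"
    unfolding L2h_norm_def q_def by (rule real_sqrt_le_mono)
  show "(\<lambda>J. v (\<sigma> J)) \<in> L2S a b ?I" by (simp add: L2S_def H1h0_L2[OF v])
qed

text \<open>An inverse inequality: the central difference consists of two shifts, each of norm at
  most that of \<open>v\<close>, and the divisor \<open>2 * step A m\<close> absorbs the two. With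
  the step bounded below, differences are controlled by \<open>v\<close> itself.\<close>

lemma L2h_norm_x_diff_le:
  fixes v :: "('n::finite, 'N::finite) sdf"
  assumes v: "v \<in> H1h0 A m a b" and s: "step A m > 0"
  shows "L2h_norm m a b (x_diff A m k v) \<le> (1 / step A m) * L2h_norm m a b v"
proof -
  let ?I = "interior_idx m :: (nat^'n) set"
  have "inj_on (\<lambda>J. J + axis k 1) ?I" by (auto simp: inj_on_def)
  note p = L2h_norm_shift[OF v this]
  \<comment> \<open>Subtraction on \<open>nat\<close> truncates, but every coordinate of an interior
    index is at least 1.\<close>
  have "inj_on (\<lambda>J. J - axis k 1) ?I"
  proof (rule inj_onI)
    fix J J' assume J: "J \<in> ?I" "J' \<in> ?I" and eq: "J - axis k 1 = J' - axis k 1"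
    have "J $ i = J' $ i" for i
    proof -
      have "J $ i \<ge> 1" "J' $ i \<ge> 1" using J by (auto simp: interior_idx_def)
      moreover have "J $ i - axis k 1 $ i = J' $ i - axis k 1 $ i" using eq by (metis vector_minus_component)
      ultimately show ?thesis by (cases "i = k") (auto simp: axis_def)
    qed
    then show "J = J'" by (simp add: vec_eq_iff)
  qed
  note q = L2h_norm_shift[OF v this]
  let ?p = "\<lambda>J. v (J + axis k 1)" and ?q = "\<lambda>J. v (J - axis k 1)"
  have "L2h_norm m a b (x_diff A m k v) = L2.nrm a b ?I (\<lambda>J y. (1 / (2 * step A m)) *\<^sub>R (?p J y - ?q J y))"
    unfolding L2h_norm_eq_nrm by (rule arg_cong[of _ _ "L2.nrm a b ?I"]) (simp add: x_diff_def fun_eq_iff)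
  also have "\<dots> = 1 / (2 * step A m) * L2.nrm a b ?I (\<lambda>J y. ?p J y - ?q J y)"
    using s by (subst L2.nrm_scale[OF L2.S_diff[OF p(1) q(1)]]) simp
  also have "\<dots> \<le> 1 / (2 * step A m) * (2 * L2h_norm m a b v)"
  proof (rule mult_left_mono)
    have "L2.nrm a b ?I (\<lambda>J y. ?p J y - ?q J y) \<le> L2.nrm a b ?I ?p + L2.nrm a b ?I ?q"
      using L2.nrm_triangle[OF p(1) L2.S_scale[OF q(1), of "-1"]] L2.nrm_scale[OF q(1), of "-1"] by simp
    then show "L2.nrm a b ?I (\<lambda>J y. ?p J y - ?q J y) \<le> 2 * L2h_norm m a b v"
      using p(2) q(2) unfolding L2h_norm_eq_nrm by linarith
  qed (use s in simp)
  finally show ?thesis by simp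
qed

text \<open>Poincare's inequality along each line: \<open>v\<close> vanishes at
  \<open>y = a\<close>, so its values are integrals of its derivative.\<close>

lemma L2h_norm_poincare:
  fixes v :: "('n::finite, 'N::finite) sdf"
  assumes "a \<le> b" and v: "v \<in> H1h0 A m a b"
  shows "L2h_norm m a b v \<le> (b - a) * L2h_norm m a b (y_deriv a b v)"
proof -
  note H = H1h0_D(1)[OF v]
  have J: "(L2n a b (v J))\<^sup>2 \<le> (b - a)\<^sup>2 * (L2n a b (y_deriv a b v J))\<^sup>2" if J: "J \<in> interior_idx m" for J
  proof -
    have pt: "(norm (v J y))\<^sup>2 \<le> (b - a) * (L2n a b (y_deriv a b v J))\<^sup>2" if "y \<in> {a..b}" for y
    proof -
      have "norm (v J y) \<le> sqrt (b - a) * L2n a b (y_deriv a b v J)"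
        using H1_deriv_dist_le[OF y_deriv_H1_deriv[OF H J] that, of a] H1h0_D(3)[OF v \<open>a \<le> b\<close>, of J] \<open>a \<le> b\<close> by simp
      then have "(norm (v J y))\<^sup>2 \<le> (sqrt (b - a) * L2n a b (y_deriv a b v J))\<^sup>2"
        by (intro power_mono) auto
      then show ?thesis using \<open>a \<le> b\<close> by (simp add: power_mult_distrib)
    qed
    have "(L2n a b (v J))\<^sup>2 \<le> integral {a..b} (\<lambda>y. (b - a) * (L2n a b (y_deriv a b v J))\<^sup>2)"
      unfolding L2n_square[OF H1h0_L2[OF v]]
      by (intro integral_le pt L2_fun_square_integrable H1h0_L2[OF v]) auto
    also have "\<dots> = (b - a)\<^sup>2 * (L2n a b (y_deriv a b v J))\<^sup>2"
      using \<open>a \<le> b\<close> by (simp add: power2_eq_square)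
    finally show ?thesis .
  qed
  have "(L2h_norm m a b v)\<^sup>2 \<le> ((b - a) * L2h_norm m a b (y_deriv a b v))\<^sup>2"
    unfolding power_mult_distrib L2h_norm_square[OF H1h_in_L2S(1)[OF H]] L2h_norm_square[OF H1h_in_L2S(3)[OF H]]
      sum_distrib_left by (intro sum_mono J)
  then show ?thesis
    by (rule power2_le_imp_le) (use assms(1) L2h_norm_nonneg[OF H1h_in_L2S(3)[OF H]] in simp)
qed

text \<open>The supremum bound settles the interior lines, the boundary condition and the
  normalization all other points. The seminorm is thus definite on \<open>H1h0\<close>, from which
  the uniqueness of gradients and of minimizers follows.\<close>

lemma H1h0_norm_zero:
  assumes "a < b" and v: "v \<in> H1h0 A m a b" and z: "H1h_norm A m a b v = 0"
  shows "v = (\<lambda>J y. 0)"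
proof -
  note H = H1h0_D(1)[OF v]
  have "v J y = 0" for J y
  proof (cases "J \<in> interior_idx m \<and> y \<in> {a..b}")
    case True
    then show ?thesis using H1h_sup_bound[OF assms(1) H, of J y] z by simp
  next
    case False
    then show ?thesis using H1h0_D(2)[OF v, of J y] H unfolding H1h_def by blast
  qed
  then show ?thesis by (simp add: fun_eq_iff)
qed

lemma H1h0_norm_le:
  fixes v :: "('n::finite, 'N::finite) sdf"
  assumes "a \<le> b" and v: "v \<in> H1h0 A m a b" and s: "step A m > 0"
  shows "(H1h_norm A m a b v)\<^sup>2 \<le> real CARD('n) * ((1 + 1 / (step A m)\<^sup>2) * (L2h_norm m a b v)\<^sup>2
     + (L2h_norm m a b (y_deriv a b v))\<^sup>2)"
proof -
  note H = H1h0_D(1)[OF v]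
  have "(\<Sum>k\<in>(UNIV::'n set). (L2h_norm m a b (x_diff A m k v))\<^sup>2)
      \<le> (\<Sum>k\<in>(UNIV::'n set). ((1 / step A m) * L2h_norm m a b v)\<^sup>2)"
    by (intro sum_mono power_mono L2h_norm_x_diff_le[OF v s] L2h_norm_nonneg H1h_in_L2S[OF H])
  then show ?thesis
    unfolding H1h_norm_square[OF assms(1) H] by (simp add: power_mult_distrib power_divide algebra_simps)
qed

text \<open>On \<open>H1h0\<close> the full norm is bounded by the norm of the \<open>y\<close>
  derivative, through \<open>H1h0_norm_le\<close> and \<open>L2h_norm_poincare\<close>. So it
  suffices to take the \<open>L\<^sub>2\<close> limit of the derivatives on each line and to
  integrate it from \<open>a\<close>.\<close>

lemma H1h0_complete:
  fixes s :: "nat \<Rightarrow> ('n::finite, 'N::finite) sdf"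
  assumes "a < b" and step: "step A m > 0" and s: "\<And>i. s i \<in> H1h0 A m a b"
    and cauchy: "\<And>e. e > 0 \<Longrightarrow> \<exists>M. \<forall>i\<ge>M. \<forall>j\<ge>M. H1h_norm A m a b (\<lambda>J y. s i J y - s j J y) < e"
  shows "\<exists>l\<in>H1h0 A m a b. (\<lambda>i. H1h_norm A m a b (\<lambda>J y. s i J y - l J y)) \<longlonglongrightarrow> 0"
proof -
  let ?I = "interior_idx m :: (nat^'n) set"
  have ab: "a \<le> b" using \<open>a < b\<close> by simp
  have diff: "(\<lambda>J y. u J y - v J y) \<in> H1h0 A m a b" if "u \<in> H1h0 A m a b" "v \<in> H1h0 A m a b"
    for u v :: "('n, 'N) sdf"
    using H1h0_comb[OF that, of "-1"] by simp
  define d where "d i J = y_deriv a b (s i) J" for i J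
  have d: "H1_deriv a b (s i J) (d i J)" if "J \<in> ?I" for i J
    unfolding d_def by (rule y_deriv_H1_deriv[OF H1h0_D(1)[OF s] that])
  \<comment> \<open>The derivative of a difference may be computed with any representative
    \<open>g\<close> of the derivative of \<open>v\<close>.\<close>
  have n_ae: "L2n a b (y_deriv a b (\<lambda>J y. u J y - v J y) J) = L2n a b (\<lambda>y. y_deriv a b u J y - g y)"
    if u: "u \<in> H1h0 A m a b" and v: "v \<in> H1h0 A m a b" and J: "J \<in> ?I" and g: "H1_deriv a b (v J) g"
    for u v :: "('n, 'N) sdf" and J g
  proof -
    have "H1_deriv a b (\<lambda>y. u J y + (-1) *\<^sub>R v J y) (\<lambda>y. y_deriv a b u J y + (-1) *\<^sub>R g y)"
      by (rule H1_deriv_comb[OF y_deriv_H1_deriv[OF H1h0_D(1)[OF u] J] g])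
    moreover have "H1_deriv a b (\<lambda>y. u J y + (-1) *\<^sub>R v J y) (y_deriv a b (\<lambda>J y. u J y - v J y) J)"
      using y_deriv_H1_deriv[OF H1h0_D(1)[OF diff[OF u v]] J] by simp
    ultimately obtain N where "negligible N"
      "\<forall>y\<in>{a..b} - N. y_deriv a b u J y - g y = y_deriv a b (\<lambda>J y. u J y - v J y) J y"
      using H1_deriv_unique[OF _ _ ab] by fastforce
    then show ?thesis
      unfolding L2n_def by (intro arg_cong[of _ _ sqrt] integral_spike[of N]) auto
  qed
  have "\<exists>g. L2_fun a b g \<and> (\<lambda>i. L2n a b (\<lambda>y. d i J y - g y)) \<longlonglongrightarrow> 0" if J: "J \<in> ?I" for J
  proof (rule L2_complete[OF _ ab])
    show "L2_fun a b (d i J)" for i using d[OF J] by (rule H1_deriv_L2)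
    fix e :: real assume "e > 0"
    then obtain M where M: "\<And>i j. i \<ge> M \<Longrightarrow> j \<ge> M \<Longrightarrow> H1h_norm A m a b (\<lambda>J y. s i J y - s j J y) < e"
      using cauchy by blast
    have "L2n a b (\<lambda>y. d i J y - d j J y) < e" if "i \<ge> M" "j \<ge> M" for i j
    proof -
      have "L2n a b (\<lambda>y. d i J y - d j J y) = L2n a b (y_deriv a b (\<lambda>J y. s i J y - s j J y) J)"
        using n_ae[OF s s J d[OF J]] by (simp add: d_def)
      also have "\<dots> \<le> L2h_norm m a b (y_deriv a b (\<lambda>J y. s i J y - s j J y))"
        by (rule L2n_le_L2h_norm[OF H1h_in_L2S(3)[OF H1h0_D(1)[OF diff[OF s s]]] J])
      also have "\<dots> \<le> H1h_norm A m a b (\<lambda>J y. s i J y - s j J y)"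
        by (rule L2h_norms_le_H1h_norm(3)[OF ab H1h0_D(1)[OF diff[OF s s]]])
      finally show ?thesis using M[OF that] by simp
    qed
    then show "\<exists>M. \<forall>i\<ge>M. \<forall>j\<ge>M. L2n a b (\<lambda>y. d i J y - d j J y) < e" by blast
  qed
  then have "\<forall>J\<in>?I. \<exists>g. L2_fun a b g \<and> (\<lambda>i. L2n a b (\<lambda>y. d i J y - g y)) \<longlonglongrightarrow> 0" by blast
  from bchoice[OF this] obtain g where g: "\<And>J. J \<in> ?I \<Longrightarrow> L2_fun a b (g J)"
    "\<And>J. J \<in> ?I \<Longrightarrow> (\<lambda>i. L2n a b (\<lambda>y. d i J y - g J y)) \<longlonglongrightarrow> 0" by blast
  define l :: "('n, 'N) sdf" where
    "l J y = (if J \<in> ?I \<and> y \<in> {a..b} then integral {a..y} (g J) else 0)" for J y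
  have l_deriv: "H1_deriv a b (l J) (g J)" if "J \<in> ?I" for J
    unfolding H1_deriv_def using g(1)[OF that] that ab by (simp add: l_def)
  \<comment> \<open>The antiderivative vanishes at \<open>a\<close> by construction; at
    \<open>b\<close> it vanishes as the limit of the values \<open>s i J b = 0\<close>.\<close>
  have l_b: "l J b = 0" if J: "J \<in> ?I" for J
  proof -
    have "norm (l J b) \<le> sqrt (b - a) * L2n a b (\<lambda>y. d i J y - g J y)" for i
    proof -
      have H: "H1_deriv a b (\<lambda>y. s i J y + (-1) *\<^sub>R l J y) (\<lambda>y. d i J y + (-1) *\<^sub>R g J y)"
        by (rule H1_deriv_comb[OF d[OF J] l_deriv[OF J]])
      have "l J a = 0" by (simp add: l_def)
      then show ?thesis
        using H1_deriv_dist_le[OF H, of b a] H1h0_D(3,4)[OF s ab, of i J] ab by simp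
    qed
    moreover have "(\<lambda>i. sqrt (b - a) * L2n a b (\<lambda>y. d i J y - g J y)) \<longlonglongrightarrow> 0"
      using tendsto_mult_right_zero[OF g(2)[OF J]] by simp
    ultimately have "norm (l J b) \<le> 0" by (intro LIMSEQ_le_const) auto
    then show ?thesis by simp
  qed
  have l_L2: "L2_fun a b (l J)" for J
  proof (cases "J \<in> ?I")
    case True
    then show ?thesis by (intro L2_fun_continuous H1_deriv_continuous[OF l_deriv])
  next
    case False
    then have "l J = (\<lambda>y. 0)" by (simp add: l_def fun_eq_iff)
    then show ?thesis by (simp add: L2_fun_zero)
  qed
  have "l \<in> H1h A m a b"
  proof -
    have "L2_fun a b (x_diff A m k l J)" for k J
      unfolding x_diff_def by (intro L2_fun_scale L2_fun_diff l_L2)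
    moreover have "J \<in> grid_idx m" if "J \<in> ?I" for J using that interior_idx_subset by blast
    ultimately show ?thesis unfolding H1h_def using l_deriv by (fastforce simp: l_def)
  qed
  then have l: "l \<in> H1h0 A m a b"
    using l_b by (auto simp: H1h0_def boundary_eq_def boundary_h_def l_def)
  \<comment> \<open>The factor in \<open>H1h0_norm_le\<close> after the norm of the function has
    been estimated by \<open>L2h_norm_poincare\<close>.\<close>
  define c where "c = real CARD('n) * ((1 + 1 / (step A m)\<^sup>2) * (b - a)\<^sup>2 + 1)"
  have bound: "(H1h_norm A m a b (\<lambda>J y. s i J y - l J y))\<^sup>2 \<le> c * (\<Sum>J\<in>?I. (L2n a b (\<lambda>y. d i J y - g J y))\<^sup>2)" for i
  proof -
    let ?v = "\<lambda>J y. s i J y - l J y"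
    note v = diff[OF s[of i] l]
    let ?D = "L2h_norm m a b (y_deriv a b ?v)"
    have "(H1h_norm A m a b ?v)\<^sup>2 \<le> real CARD('n) * ((1 + 1 / (step A m)\<^sup>2) * (L2h_norm m a b ?v)\<^sup>2 + ?D\<^sup>2)"
      by (rule H1h0_norm_le[OF ab v step])
    also have "\<dots> \<le> real CARD('n) * ((1 + 1 / (step A m)\<^sup>2) * ((b - a) * ?D)\<^sup>2 + ?D\<^sup>2)"
      by (intro mult_left_mono add_right_mono power_mono L2h_norm_poincare[OF ab v] L2h_norm_nonneg
          H1h_in_L2S(1)[OF H1h0_D(1)[OF v]]) auto
    also have "\<dots> = c * ?D\<^sup>2" unfolding c_def power_mult_distrib by (simp add: distrib_left distrib_right mult.assoc)
    also have "?D\<^sup>2 = (\<Sum>J\<in>?I. (L2n a b (\<lambda>y. d i J y - g J y))\<^sup>2)"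
      unfolding L2h_norm_square[OF H1h_in_L2S(3)[OF H1h0_D(1)[OF v]]]
      by (intro sum.cong refl) (simp add: n_ae[OF s l _ l_deriv] d_def)
    finally show ?thesis .
  qed
  have lim0: "(\<lambda>i. c * (\<Sum>J\<in>?I. (L2n a b (\<lambda>y. d i J y - g J y))\<^sup>2)) \<longlonglongrightarrow> 0"
  proof -
    have "(\<lambda>i. c * (\<Sum>J\<in>?I. (L2n a b (\<lambda>y. d i J y - g J y))\<^sup>2)) \<longlonglongrightarrow> c * (\<Sum>J\<in>?I. 0\<^sup>2)"
      by (intro tendsto_mult tendsto_const tendsto_sum tendsto_power g(2))
    then show ?thesis by simp
  qed
  have "(\<lambda>i. (H1h_norm A m a b (\<lambda>J y. s i J y - l J y))\<^sup>2) \<longlonglongrightarrow> 0"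
    by (rule Lim_null_comparison[OF _ lim0]) (simp add: bound)
  then have "(\<lambda>i. sqrt ((H1h_norm A m a b (\<lambda>J y. s i J y - l J y))\<^sup>2)) \<longlonglongrightarrow> sqrt 0"
    by (rule tendsto_real_sqrt)
  moreover have "sqrt ((H1h_norm A m a b (\<lambda>J y. s i J y - l J y))\<^sup>2) = H1h_norm A m a b (\<lambda>J y. s i J y - l J y)" for i
    using H1h_norm_nonneg[OF ab H1h0_D(1)[OF diff[OF s l]]] by simp
  ultimately have "(\<lambda>i. H1h_norm A m a b (\<lambda>J y. s i J y - l J y)) \<longlonglongrightarrow> 0" by simp
  with l show ?thesis by blast
qed

section \<open>The coefficients\<close>

text \<open>Separates the shape of one Gram-Schmidt step from the values of its coefficients, so
  that \<open>Psi_C1\<close> is an induction over a fixed formula.\<close>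

lemma Psi_form: "\<exists>c k. Psi d r = (\<lambda>t. (t ^ r * exp t - (\<Sum>s<r. c s * Psi d s t)) / k)"
  by (subst Psi.simps, unfold Let_def) (intro exI, rule refl)

lemma Psi_C1: "\<exists>\<psi>. (\<forall>t. (Psi d r has_real_derivative \<psi> t) (at t)) \<and> continuous_on UNIV \<psi>"
proof (induction r rule: less_induct)
  case (less r)
  have "\<forall>s\<in>{..<r}. \<exists>\<psi>. (\<forall>t. (Psi d s has_real_derivative \<psi> t) (at t)) \<and> continuous_on UNIV \<psi>"
    using less by blast
  from bchoice[OF this] obtain \<psi> where
    \<psi>: "\<And>s t. s < r \<Longrightarrow> (Psi d s has_real_derivative \<psi> s t) (at t)" "\<And>s. s < r \<Longrightarrow> continuous_on UNIV (\<psi> s)"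
    by blast
  obtain c k where eq: "Psi d r = (\<lambda>t. (t ^ r * exp t - (\<Sum>s<r. c s * Psi d s t)) / k)"
    using Psi_form by blast
  have D: "((\<lambda>t. \<Sum>s<r. c s * Psi d s t) has_real_derivative (\<Sum>s<r. c s * \<psi> s t)) (at t)" for t
    by (intro DERIV_sum DERIV_cmult \<psi>) auto
  have "(Psi d r has_real_derivative
      (real r * t ^ (r - 1) * exp t + t ^ r * exp t - (\<Sum>s<r. c s * \<psi> s t)) / k) (at t)" for t
    unfolding eq divide_inverse
    by (rule derivative_eq_intros D refl | simp)+
  moreover have "continuous_on UNIV (\<lambda>t. (real r * t ^ (r - 1) * exp t + t ^ r * exp t - (\<Sum>s<r. c s * \<psi> s t)) / k)"
    unfolding divide_inverse by (intro continuous_intros \<psi>) auto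
  ultimately show ?case
    by (intro exI[of _ "\<lambda>t. (real r * t ^ (r - 1) * exp t + t ^ r * exp t - (\<Sum>s<r. c s * \<psi> s t)) / k"] conjI allI)
qed

lemma Psi_deriv: "(Psi d r has_real_derivative deriv (Psi d r) t) (at t)"
  using Psi_C1[of d r] DERIV_imp_deriv by metis

lemma continuous_Psi_deriv: "continuous_on UNIV (deriv (Psi d r))"
proof -
  obtain \<psi> where \<psi>: "\<And>t. (Psi d r has_real_derivative \<psi> t) (at t)" "continuous_on UNIV \<psi>"
    using Psi_C1[of d r] by blast
  then have "deriv (Psi d r) = \<psi>" using DERIV_imp_deriv by blast
  then show ?thesis using \<psi> by simp
qed

lemma continuous_Psi: "continuous_on UNIV (Psi d r)"
  by (rule DERIV_continuous_on[of _ _ "deriv (Psi d r)"]) (use Psi_deriv in auto)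

lemmas continuous_Psi_intros =
  continuous_on_compose2[OF continuous_Psi _ subset_UNIV] continuous_on_compose2[OF continuous_Psi_deriv _ subset_UNIV]

section \<open>Distance to the source and closed forms of the coefficients\<close>

definition rho :: "(real^'n::finite) \<times> real \<Rightarrow> real \<Rightarrow> real" where
  "rho x \<alpha> = norm (x - source \<alpha>)"

text \<open>The sources lie in the plane \<open>y = 0\<close>; for \<open>y > 0\<close> neither
  \<open>1 / rho\<close> nor \<open>1 / y\<close> is singular, and \<open>a > 1\<close> puts the
  closed domain in this region.\<close>

definition halfspace :: "((real^'n::finite) \<times> real) set" where
  "halfspace = {x. snd x > 0}"

lemma source_scaleR: "source \<alpha> = \<alpha> *\<^sub>R source 1"
  by (simp add: source_def axis_def vec_eq_iff)

lemma rho_eq: "rho x \<alpha> = norm (x - \<alpha> *\<^sub>R source 1)"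
  unfolding rho_def by (subst source_scaleR) (rule refl)

lemma rho_pos: "x \<in> halfspace \<Longrightarrow> rho x \<alpha> > 0"
  by (auto simp: rho_def halfspace_def source_def prod_eq_iff)

lemma halfspace_nonzero: "x \<in> halfspace \<Longrightarrow> rho x \<alpha> \<noteq> 0" "x \<in> halfspace \<Longrightarrow> snd x \<noteq> 0"
  using rho_pos[of x \<alpha>] by (auto simp: halfspace_def)

lemma continuous_rho: "continuous_on T f \<Longrightarrow> continuous_on T g \<Longrightarrow> continuous_on T (\<lambda>z. rho (f z) (g z))"
  unfolding rho_eq by (intro continuous_intros)

lemma rho_deriv:
  assumes "x \<in> halfspace"
  shows "(rho x has_real_derivative (\<alpha> - fst x $ first_coord) / rho x \<alpha>) (at \<alpha>)"
proof -
  have nz: "x - \<alpha> *\<^sub>R source 1 \<noteq> 0" using rho_pos[OF assms, of \<alpha>] by (simp add: rho_eq)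
  have eq: "rho x = norm \<circ> (\<lambda>t. x - t *\<^sub>R source 1)"
    by (simp add: fun_eq_iff rho_eq)
  have 1: "((\<lambda>t. x - t *\<^sub>R source 1) has_derivative (\<lambda>h. - (h *\<^sub>R source 1))) (at \<alpha>)"
    by (auto intro!: derivative_eq_intros)
  have 2: "(norm has_derivative (\<lambda>h. sgn (x - \<alpha> *\<^sub>R source 1) \<bullet> h)) (at (x - \<alpha> *\<^sub>R source 1))"
    using has_derivative_norm[OF nz] by (simp add: inner_commute)
  have D: "(rho x has_derivative (\<lambda>h. sgn (x - \<alpha> *\<^sub>R source 1) \<bullet> (- (h *\<^sub>R source 1)))) (at \<alpha>)"
    unfolding eq using diff_chain_at[OF 1 2] by (simp add: o_def)
  have k: "sgn (x - \<alpha> *\<^sub>R source 1) \<bullet> (- (h *\<^sub>R source 1)) = (\<alpha> - fst x $ first_coord) / rho x \<alpha> * h" for h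
  proof -
    have key: "(x - \<alpha> *\<^sub>R source 1) \<bullet> source 1 = fst x $ first_coord - \<alpha>"
      by (simp add: source_def inner_prod_def inner_axis inner_diff_left)
    show ?thesis
      unfolding sgn_div_norm rho_eq inner_minus_right inner_scaleR_left inner_scaleR_right key
      by (simp add: divide_inverse algebra_simps)
  qed
  show ?thesis using D unfolding has_field_derivative_def k .
qed

lemma snd_nu: "snd (nu x \<alpha>) = snd x / rho x \<alpha>"
  by (simp add: nu_def rho_def source_def)

lemma fst_nu: "fst (nu x \<alpha>) $ i = (fst x $ i - (if i = first_coord then \<alpha> else 0)) / rho x \<alpha>"
  by (simp add: nu_def rho_def source_def axis_def)

text \<open>The last component of \<open>nu\<close> is \<open>y / rho\<close>, so the quotient is
  minus the logarithmic derivative of \<open>rho\<close>.\<close>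

lemma deriv_snd_nu_quotient:
  assumes x: "x \<in> halfspace"
  shows "deriv (\<lambda>t. snd (nu x t)) \<alpha> / snd (nu x \<alpha>) = - (\<alpha> - fst x $ first_coord) / (rho x \<alpha>)\<^sup>2"
proof -
  have "((\<lambda>t. snd (nu x t)) has_real_derivative
      - snd x * ((\<alpha> - fst x $ first_coord) / rho x \<alpha>) / (rho x \<alpha>)\<^sup>2) (at \<alpha>)"
    unfolding snd_nu
    by (rule DERIV_cong[OF DERIV_divide[OF DERIV_const rho_deriv[OF x]]])
      (use rho_pos[OF x, of \<alpha>] in \<open>simp_all add: power2_eq_square\<close>)
  then have "deriv (\<lambda>t. snd (nu x t)) \<alpha> = - snd x * ((\<alpha> - fst x $ first_coord) / rho x \<alpha>) / (rho x \<alpha>)\<^sup>2"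
    by (rule DERIV_imp_deriv)
  then show ?thesis using x rho_pos[OF x, of \<alpha>] by (simp add: snd_nu halfspace_def field_simps)
qed

text \<open>\<open>\<delta>\<close> records that only the first coordinate of the source moves with
  \<alpha>; one factor \<open>1 / rho\<close> cancels against the denominator
  \<open>y / rho\<close>.\<close>

lemma deriv_fst_nu_quotient:
  fixes x :: "(real^'n::finite) \<times> real" and i :: 'n
  assumes x: "x \<in> halfspace"
  defines "\<delta> \<equiv> (if i = first_coord then 1 else 0)"
  shows "deriv (\<lambda>t. fst (nu x t) $ i) \<alpha> / snd (nu x \<alpha>)
    = (- \<delta> - (fst x $ i - \<delta> * \<alpha>) * (\<alpha> - fst x $ first_coord) / (rho x \<alpha>)\<^sup>2) / snd x"
proof -
  have d: "fst (nu x t) $ i = (fst x $ i - \<delta> * t) / rho x t" for t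
    by (simp add: fst_nu \<delta>_def)
  have "((\<lambda>t. fst (nu x t) $ i) has_real_derivative
      (- \<delta> * rho x \<alpha> - (fst x $ i - \<delta> * \<alpha>) * ((\<alpha> - fst x $ first_coord) / rho x \<alpha>)) / (rho x \<alpha>)\<^sup>2) (at \<alpha>)"
    unfolding d
    by (rule DERIV_cong[OF DERIV_divide[OF DERIV_diff[OF DERIV_const DERIV_cmult[OF DERIV_ident]] rho_deriv[OF x]]])
      (use rho_pos[OF x, of \<alpha>] in \<open>simp_all add: power2_eq_square\<close>)
  then have "deriv (\<lambda>t. fst (nu x t) $ i) \<alpha>
      = (- \<delta> * rho x \<alpha> - (fst x $ i - \<delta> * \<alpha>) * ((\<alpha> - fst x $ first_coord) / rho x \<alpha>)) / (rho x \<alpha>)\<^sup>2"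
    by (rule DERIV_imp_deriv)
  moreover have "((- \<delta> * r - u * (s / r)) / r\<^sup>2) / (y / r) = (- \<delta> - u * s / r\<^sup>2) / y" if "r > 0" "y > 0" for r u s y :: real
    using that by (simp add: field_simps power2_eq_square)
  ultimately show ?thesis using x rho_pos[OF x, of \<alpha>] by (simp add: snd_nu halfspace_def)
qed

lemma fst_nu_quotient:
  assumes x: "x \<in> halfspace"
  shows "fst (nu x \<alpha>) $ i / snd (nu x \<alpha>) = (fst x $ i - (if i = first_coord then 1 else 0) * \<alpha>) / snd x"
  using x rho_pos[OF x, of \<alpha>] by (simp add: fst_nu snd_nu halfspace_def)

lemma continuous_integral_halfspace:
  fixes f :: "(real^'n::finite) \<times> real \<Rightarrow> real \<Rightarrow> real"
  assumes "continuous_on (halfspace \<times> UNIV) (\<lambda>z. f (fst z) (snd z))"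
  shows "continuous_on halfspace (\<lambda>x. integral {-d..d} (f x))"
proof -
  have "continuous_on (halfspace \<times> cbox (-d) d) (\<lambda>(x, t). f x t)"
    using continuous_on_subset[OF assms, of "halfspace \<times> cbox (-d) d"] by (simp add: split_def subset_iff)
  from integral_continuous_on_param[OF this] show ?thesis by simp
qed

text \<open>\<open>deriv\<close> under the integral hides the dependence on \<open>x\<close>. The
  closed form of the quotient is jointly continuous away from the sources, and then so is the
  parameter integral.\<close>

lemma continuous_Ay_mat: "continuous_on halfspace (Ay_mat d :: (real^'n::finite) \<times> real \<Rightarrow> real^'N::finite^'N)"
proof -
  have "continuous_on halfspace (\<lambda>x :: (real^'n) \<times> real. integral {-d..d} (\<lambda>\<alpha>.
      - (\<alpha> - fst x $ first_coord) / (rho x \<alpha>)\<^sup>2 * Psi d (idx r) \<alpha> * Psi d (idx k) \<alpha>))" for k r :: 'N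
    by (intro continuous_integral_halfspace continuous_intros continuous_rho continuous_Psi_intros)
      (auto simp: halfspace_nonzero)
  then have "continuous_on halfspace (\<lambda>x :: (real^'n) \<times> real. (\<chi> k r. integral {-d..d} (\<lambda>\<alpha>.
      - (\<alpha> - fst x $ first_coord) / (rho x \<alpha>)\<^sup>2 * Psi d (idx r) \<alpha> * Psi d (idx k) \<alpha>)) :: real^'N^'N)"
    by (intro continuous_on_vec_lambda)
  then show ?thesis
    by (rule continuous_on_eq) (simp add: Ay_mat_def deriv_snd_nu_quotient)
qed

lemma continuous_D_mat: "continuous_on halfspace (D_mat d :: (real^'n::finite) \<times> real \<Rightarrow> real^'N::finite^'N)"
  unfolding D_mat_def[abs_def] by (intro continuous_intros continuous_Ay_mat)

lemma continuous_A_mat: "continuous_on halfspace (A_mat d i :: (real^'n::finite) \<times> real \<Rightarrow> real^'N::finite^'N)"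
proof -
  define \<delta> :: real where "\<delta> = (if i = first_coord then 1 else 0)"
  have "continuous_on halfspace (\<lambda>x :: (real^'n) \<times> real. integral {-d..d} (\<lambda>\<alpha>.
      ((fst x $ i - \<delta> * \<alpha>) / snd x * deriv (Psi d (idx r)) \<alpha> +
       (- \<delta> - (fst x $ i - \<delta> * \<alpha>) * (\<alpha> - fst x $ first_coord) / (rho x \<alpha>)\<^sup>2) / snd x * Psi d (idx r) \<alpha>)
      * Psi d (idx k) \<alpha>))" for k r :: 'N
    by (intro continuous_integral_halfspace continuous_intros continuous_rho continuous_Psi_intros)
      (auto simp: halfspace_nonzero)
  then have "continuous_on halfspace (\<lambda>x. (\<chi> k r. integral {-d..d} (\<lambda>\<alpha>.
      ((fst x $ i - \<delta> * \<alpha>) / snd x * deriv (Psi d (idx r)) \<alpha> +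
       (- \<delta> - (fst x $ i - \<delta> * \<alpha>) * (\<alpha> - fst x $ first_coord) / (rho x \<alpha>)\<^sup>2) / snd x * Psi d (idx r) \<alpha>)
      * Psi d (idx k) \<alpha>)) :: real^'N^'N)"
    by (intro continuous_on_vec_lambda)
  then show ?thesis
    by (rule continuous_on_eq) (simp add: A_mat_def deriv_fst_nu_quotient fst_nu_quotient \<delta>_def)
qed

lemma Omega_box: "Omega A a b = box ((\<chi> i. - A), a) ((\<chi> i. A), b)"
  by (auto simp: Omega_def box_prod mem_box_cart)

lemma closure_Omega:
  assumes "A > 0" "a < b"
  shows "closure (Omega A a b :: ((real^'n::finite) \<times> real) set) = cbox ((\<chi> i. - A), a) ((\<chi> i. A), b)"
proof -
  have "(0, (a + b) / 2) \<in> (Omega A a b :: ((real^'n) \<times> real) set)"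
    using assms by (simp add: Omega_def)
  then show ?thesis unfolding Omega_box by (intro closure_box) blast
qed

lemma closure_Omega_halfspace:
  assumes "A > 0" "1 < a" "a < b"
  shows "closure (Omega A a b) \<subseteq> halfspace"
  using assms by (auto simp: closure_Omega halfspace_def)

lemma compact_closure_Omega:
  assumes "A > 0" "a < b"
  shows "compact (closure (Omega A a b :: ((real^'n::finite) \<times> real) set))"
  by (simp add: closure_Omega assms)

lemma grid_point_in_closure:
  assumes "A > 0" "a < b" and J: "J \<in> interior_idx m" and y: "y \<in> {a..b}"
  shows "grid_point A m J y \<in> closure (Omega A a b)"
proof -
  have "0 \<le> real (J $ i) * step A m \<and> real (J $ i) * step A m \<le> 2 * A" for i
  proof -
    have Ji: "1 \<le> J $ i" "J $ i \<le> m - 1" using J by (auto simp: interior_idx_def)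
    then have "m > 0" by linarith
    have le: "real (J $ i) \<le> real m" using Ji by simp
    have "real (J $ i) * (2 * A) \<le> real m * (2 * A)" using le assms(1) by (intro mult_right_mono) auto
    then have "real (J $ i) * step A m \<le> 2 * A"
      using \<open>m > 0\<close> by (simp add: step_def field_simps)
    then show ?thesis using assms(1) by (simp add: step_def)
  qed
  then show ?thesis
    using y by (auto simp: closure_Omega[OF assms(1,2)] grid_point_def mem_box_cart)
qed

lemma continuous_grid_point: "continuous_on T (grid_point A m J)"
  unfolding grid_point_def[abs_def] by (intro continuous_intros)

lemma matrix_vector_bounded:
  fixes M :: "'a \<Rightarrow> real^'n::finite^'m::finite"
  assumes "bounded (M ` S)"
  shows "\<exists>c>0. \<forall>x\<in>S. \<forall>v. norm (M x *v v) \<le> c * norm v"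
proof -
  obtain B where B: "B > 0" "\<And>(X :: real^'n^'m) v. norm (X *v v) \<le> B * norm X * norm v"
    using bilinear_bounded_pos[OF bilinear_matrix_vector_mult] by blast
  obtain D where D: "D > 0" "\<And>x. x \<in> S \<Longrightarrow> norm (M x) \<le> D"
    using assms unfolding bounded_pos by blast
  have "norm (M x *v v) \<le> B * D * norm v" if "x \<in> S" for x v
    by (rule order_trans[OF B(2)]) (use B(1) D(2)[OF that] in \<open>simp add: mult_right_mono\<close>)
  then show ?thesis using B(1) D(1) by (intro exI[of _ "B * D"]) simp
qed

section \<open>The nonlinearity\<close>

text \<open>Integrating by parts in \<open>\<alpha>\<close> removes the derivative from the bracket in \<open>F\<close>. What remains is a linear functional,
  bounded in terms of \<open>sup |K|\<close> only, applied to \<open>(\<alpha>, \<beta>) \<mapsto> exp (\<Sum>\<^sub>r w\<^sub>r (\<Psi>\<^sub>r \<beta> - \<Psi>\<^sub>r \<alpha>))\<close>; so the smoothness of \<open>F\<close> in \<open>W\<close>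
  is that of the exponential.\<close>

definition phi :: "real \<Rightarrow> 'N::finite \<Rightarrow> (real^'n::finite) \<times> real \<Rightarrow> real \<Rightarrow> real" where
  "phi d k x t = Psi d (idx k) t * rho x t / snd x"

definition dphi :: "real \<Rightarrow> 'N::finite \<Rightarrow> (real^'n::finite) \<times> real \<Rightarrow> real \<Rightarrow> real" where
  "dphi d k x t = (deriv (Psi d (idx k)) t * rho x t + Psi d (idx k) t * ((t - fst x $ first_coord) / rho x t)) / snd x"

text \<open>Chosen so that \<open>W \<bullet> cvec d t \<beta>\<close> is the exponent of the
  product of the two exponentials in \<open>F\<close>.\<close>

definition cvec :: "real \<Rightarrow> real \<Rightarrow> real \<Rightarrow> real^'N::finite" where
  "cvec d t \<beta> = (\<chi> r. Psi d (idx r) \<beta> - Psi d (idx r) t)"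

text \<open>\<open>phi d k x t\<close> is \<open>Psi\<close> divided by the last component of
  \<open>nu\<close>, the factor of the derivative in \<open>F\<close>. The first two terms are the
  boundary values at \<open>d\<close> and \<open>-d\<close>, the third is the integral with the
  derivative moved to \<open>phi\<close>. The kernel \<open>f\<close> is arbitrary, so that
  \<open>F\<close>, its derivative and its Taylor remainder are values of the same
  functional.\<close>

definition Lam :: "real \<Rightarrow> ((real^'n::finite) \<times> real \<Rightarrow> real) \<Rightarrow> (((real^'n) \<times> real) \<times> real \<times> real \<Rightarrow> real) \<Rightarrow>
    (real^'n) \<times> real \<Rightarrow> 'N::finite \<Rightarrow> (real \<Rightarrow> real \<Rightarrow> real) \<Rightarrow> real" where
  "Lam d mus K x k f = - mus x * (phi d k x d * integral {-d..d} (\<lambda>\<beta>. K (x, d, \<beta>) * f d \<beta>)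
     - phi d k x (-d) * integral {-d..d} (\<lambda>\<beta>. K (x, -d, \<beta>) * f (-d) \<beta>)
     - integral {-d..d} (\<lambda>t. dphi d k x t * integral {-d..d} (\<lambda>\<beta>. K (x, t, \<beta>) * f t \<beta>)))"

text \<open>The exponential is differentiated in the direction \<open>v\<close> under
  \<open>Lam\<close>; that this is the derivative of \<open>F\<close> in \<open>W\<close> is the
  last estimate of \<open>F_estimates\<close>.\<close>

definition dF :: "real \<Rightarrow> ((real^'n::finite) \<times> real \<Rightarrow> real) \<Rightarrow> (((real^'n) \<times> real) \<times> real \<times> real \<Rightarrow> real) \<Rightarrow>
    (real^'n) \<times> real \<Rightarrow> real^'N::finite \<Rightarrow> real^'N \<Rightarrow> real^'N" where
  "dF d mus K x W v = (\<chi> k. Lam d mus K x k (\<lambda>t \<beta>. exp (W \<bullet> cvec d t \<beta>) * (v \<bullet> cvec d t \<beta>)))"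

text \<open>Everything follows from the tangent inequality
  \<open>exp v * (u - v) \<le> exp u - exp v\<close>, used in both directions: it yields the
  Lipschitz bound, and it bounds the remainder by \<open>(exp s - exp t) * (s - t)\<close>.\<close>

lemma exp_bounds:
  fixes s t M :: real
  assumes "\<bar>s\<bar> \<le> M" "\<bar>t\<bar> \<le> M"
  shows "\<bar>exp s - exp t\<bar> \<le> exp M * \<bar>s - t\<bar>" "\<bar>exp s - exp t - exp t * (s - t)\<bar> \<le> exp M * (s - t)\<^sup>2"
proof -
  have conv: "exp v * (u - v) \<le> exp u - exp v" for u v :: real
    using mult_left_mono[OF exp_ge_add_one_self[of "u - v"], of "exp v"]
    by (simp add: exp_diff algebra_simps)
  have lip: "\<bar>exp u - exp v\<bar> \<le> exp M * \<bar>u - v\<bar>" if "u \<le> M" "v \<le> M" for u v :: real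
  proof -
    have "exp u - exp v \<le> exp M * \<bar>u - v\<bar>" if "u \<le> M" for u v :: real
    proof -
      have "exp u - exp v \<le> exp u * (u - v)" using conv[of u v] by (simp add: algebra_simps)
      also have "\<dots> \<le> exp u * \<bar>u - v\<bar>" by (intro mult_left_mono) auto
      also have "\<dots> \<le> exp M * \<bar>u - v\<bar>" using that by (intro mult_right_mono) auto
      finally show ?thesis .
    qed
    from this[OF \<open>u \<le> M\<close>, of v] this[OF \<open>v \<le> M\<close>, of u] show ?thesis by (simp add: abs_le_iff abs_minus_commute)
  qed
  show L: "\<bar>exp s - exp t\<bar> \<le> exp M * \<bar>s - t\<bar>" using lip assms by simp
  have "0 \<le> exp s - exp t - exp t * (s - t)" using conv[of t s] by simp
  moreover have "exp s - exp t - exp t * (s - t) \<le> (exp s - exp t) * (s - t)"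
    using conv[of s t] by (simp add: algebra_simps)
  moreover have "(exp s - exp t) * (s - t) \<le> \<bar>exp s - exp t\<bar> * \<bar>s - t\<bar>"
    by (metis abs_ge_self abs_mult)
  moreover have "\<bar>exp s - exp t\<bar> * \<bar>s - t\<bar> \<le> exp M * \<bar>s - t\<bar> * \<bar>s - t\<bar>"
    by (intro mult_right_mono L) auto
  ultimately show "\<bar>exp s - exp t - exp t * (s - t)\<bar> \<le> exp M * (s - t)\<^sup>2"
    by (simp add: power2_eq_square)
qed

lemma continuous_cvec:
  assumes "continuous_on T f" "continuous_on T g"
  shows "continuous_on T (\<lambda>z. cvec d (f z) (g z))"
  unfolding cvec_def by (intro continuous_intros continuous_Psi_intros assms)

lemma cvec_bounded: "\<exists>c>0. \<forall>t\<in>{-d..d}. \<forall>\<beta>\<in>{-d..d}. norm (cvec d t \<beta> :: real^'N::finite) \<le> c"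
proof -
  have "bounded ((\<lambda>z. cvec d (fst z) (snd z) :: real^'N) ` ({-d..d} \<times> {-d..d}))"
    by (intro compact_imp_bounded compact_continuous_image continuous_cvec continuous_intros compact_Times) auto
  then obtain c where "c > 0" "\<forall>z\<in>{-d..d} \<times> {-d..d}. norm (cvec d (fst z) (snd z) :: real^'N) \<le> c"
    unfolding bounded_pos by auto
  then show ?thesis by (intro exI[of _ c]) auto
qed

lemma phi_deriv:
  assumes "x \<in> halfspace"
  shows "(phi d k x has_real_derivative dphi d k x t) (at t)"
  unfolding phi_def[abs_def] dphi_def
  by (rule DERIV_cong[OF DERIV_cdivide[OF DERIV_mult[OF Psi_deriv rho_deriv[OF assms]]]]) (simp add: mult.commute)

lemma continuous_phi:
  assumes "continuous_on T f" "continuous_on T g" "f ` T \<subseteq> halfspace"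
  shows "continuous_on T (\<lambda>z. phi d k (f z) (g z))" "continuous_on T (\<lambda>z. dphi d k (f z) (g z))"
proof -
  have "snd (f z) \<noteq> 0" "rho (f z) (g z) \<noteq> 0" if "z \<in> T" for z
    using that assms(3) halfspace_nonzero by blast+
  then show "continuous_on T (\<lambda>z. phi d k (f z) (g z))" "continuous_on T (\<lambda>z. dphi d k (f z) (g z))"
    unfolding phi_def dphi_def
    by (intro continuous_intros continuous_Psi_intros continuous_rho assms; auto)+
qed

lemma phi_bounded:
  assumes "compact S" "S \<subseteq> halfspace"
  shows "\<exists>c>0. \<forall>x\<in>S. \<forall>t\<in>{-d..d}. \<forall>k::'N::finite. \<bar>phi d k x t\<bar> \<le> c \<and> \<bar>dphi d k x t\<bar> \<le> c"
proof -
  have "\<exists>c>0. \<forall>z\<in>S \<times> {-d..d}. \<bar>phi d k (fst z) (snd z)\<bar> + \<bar>dphi d k (fst z) (snd z)\<bar> \<le> c" for k :: 'N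
  proof -
    have "bounded ((\<lambda>z. \<bar>phi d k (fst z) (snd z)\<bar> + \<bar>dphi d k (fst z) (snd z)\<bar>) ` (S \<times> {-d..d}))"
      using assms by (intro compact_imp_bounded compact_continuous_image continuous_phi continuous_intros compact_Times) auto
    then show ?thesis unfolding bounded_pos by auto
  qed
  then obtain c where c: "\<And>k::'N. c k > 0"
    "\<And>k z. z \<in> S \<times> {-d..d} \<Longrightarrow> \<bar>phi d k (fst z) (snd z)\<bar> + \<bar>dphi d k (fst z) (snd z)\<bar> \<le> c k"
    by metis
  have le: "c k \<le> (\<Sum>k\<in>UNIV. c k)" for k by (rule member_le_sum) (use c(1) in \<open>auto intro: less_imp_le\<close>)
  have "\<bar>phi d k x t\<bar> \<le> (\<Sum>k\<in>UNIV. c k) \<and> \<bar>dphi d k x t\<bar> \<le> (\<Sum>k\<in>UNIV. c k)" if "x \<in> S" "t \<in> {-d..d}" for x t and k :: 'N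
    using c(2)[where z = "(x, t)" and k = k] le[of k] that by auto
  moreover have "(\<Sum>k\<in>UNIV. c k) > 0" using c(1) by (intro sum_pos) auto
  ultimately show ?thesis by blast
qed

locale transport =
  fixes A d a b :: real and mus :: "(real^'n::finite) \<times> real \<Rightarrow> real"
  assumes A: "A > 0" and d: "d > 0" and a: "1 < a" and ab: "a < b" and mus: "C2_on UNIV mus"
begin

abbreviation cl :: "((real^'n) \<times> real) set" where "cl \<equiv> closure (Omega A a b)"

lemma cl_halfspace: "cl \<subseteq> halfspace"
  using closure_Omega_halfspace[OF A a ab] .

lemma continuous_mus: "continuous_on T mus"
proof -
  have "continuous_on UNIV mus"
  proof -
    obtain g where "\<forall>x. (mus has_derivative (\<lambda>v. g x \<bullet> v)) (at x)"
      using mus unfolding C2_on_def by auto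
    then show ?thesis by (intro has_derivative_continuous_on) auto
  qed
  then show ?thesis by (rule continuous_on_subset) simp
qed

lemma Kdom_cbox: "Kdom A d a b = cbox (((\<chi> i. - A), a), (-d, -d)) (((\<chi> i. A), b), (d, d))"
  by (simp add: Kdom_def closure_Omega A ab cbox_Pair_eq)

section \<open>Continuity and bounds for a fixed kernel\<close>

context
  fixes K :: "((real^'n) \<times> real) \<times> real \<times> real \<Rightarrow> real" and \<kappa> :: real
  assumes K: "C2_on (Kdom A d a b) K" and \<kappa>: "C1_norm (Kdom A d a b) K = \<kappa>"
begin

lemma K_gradient:
  obtains g where "\<And>p. p \<in> Kdom A d a b \<Longrightarrow> (K has_derivative (\<lambda>v. g p \<bullet> v)) (at p within Kdom A d a b)"
    "continuous_on (Kdom A d a b) g"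
proof -
  obtain g H where g: "\<forall>p\<in>Kdom A d a b. (K has_derivative (\<lambda>v. g p \<bullet> v)) (at p within Kdom A d a b)"
    and H: "\<forall>p\<in>Kdom A d a b. (g has_derivative blinfun_apply (H p)) (at p within Kdom A d a b)"
    using K unfolding C2_on_def by blast
  have "continuous_on (Kdom A d a b) g"
    by (rule has_derivative_continuous_on) (use H in blast)
  then show ?thesis using that g by blast
qed

lemma continuous_K: "continuous_on (Kdom A d a b) K"
proof -
  obtain g where g: "\<And>p. p \<in> Kdom A d a b \<Longrightarrow> (K has_derivative (\<lambda>v. g p \<bullet> v)) (at p within Kdom A d a b)"
    using K_gradient by blast
  then show ?thesis by (rule has_derivative_continuous_on)
qed

text \<open>\<open>C1_norm\<close> is a sum of suprema, and the ones over derivatives are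
  nonnegative. Continuity of \<open>K\<close> and of its gradient on a compact box bounds the sets
  involved; a \<open>SUP\<close> over an unbounded set would carry no information.\<close>

lemma K_bound:
  assumes p: "p \<in> Kdom A d a b"
  shows "\<bar>K p\<bar> \<le> \<kappa>"
proof -
  let ?S = "Kdom A d a b"
  obtain g where g: "\<And>p. p \<in> ?S \<Longrightarrow> (K has_derivative (\<lambda>v. g p \<bullet> v)) (at p within ?S)"
    "continuous_on ?S g" using K_gradient by blast
  have S: "compact ?S" by (simp add: Kdom_cbox)
  \<comment> \<open>The box is nondegenerate in every direction, so the derivative within it is
    unique and \<open>frechet_derivative\<close> is given by the gradient \<open>g\<close>, also on
    the boundary.\<close>
  have fd: "frechet_derivative K (at q within ?S) = (\<lambda>v. g q \<bullet> v)" if "q \<in> ?S" for q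
    using g(1)[OF that] that unfolding Kdom_cbox
    by (intro frechet_derivative_within_cbox) (auto simp: Basis_prod_def Basis_vec_def A d ab inner_axis)
  have "0 \<le> (SUP q\<in>?S. \<bar>frechet_derivative K (at q within ?S) i\<bar>)" for i
  proof (rule cSUP_upper2[OF _ p])
    have "bounded ((\<lambda>q. \<bar>g q \<bullet> i\<bar>) ` ?S)"
      by (intro compact_imp_bounded compact_continuous_image continuous_intros g S)
    then have "bdd_above ((\<lambda>q. \<bar>g q \<bullet> i\<bar>) ` ?S)" by (rule bounded_imp_bdd_above)
    then show "bdd_above ((\<lambda>q. \<bar>frechet_derivative K (at q within ?S) i\<bar>) ` ?S)"
      by (simp add: fd cong: image_cong)
  qed simp
  moreover have "\<bar>K p\<bar> \<le> (SUP q\<in>?S. \<bar>K q\<bar>)"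
  proof (rule cSUP_upper[OF p])
    show "bdd_above ((\<lambda>q. \<bar>K q\<bar>) ` ?S)"
      by (intro bounded_imp_bdd_above compact_imp_bounded compact_continuous_image continuous_intros continuous_K S)
  qed
  ultimately show ?thesis
    using \<kappa> sum_nonneg[of Basis "\<lambda>i. SUP q\<in>?S. \<bar>frechet_derivative K (at q within ?S) i\<bar>"]
    unfolding C1_norm_def by simp
qed

lemma continuous_K_compose:
  assumes "continuous_on T p" "continuous_on T s" "continuous_on T t"
    and "\<And>z. z \<in> T \<Longrightarrow> p z \<in> cl" "\<And>z. z \<in> T \<Longrightarrow> s z \<in> {-d..d}" "\<And>z. z \<in> T \<Longrightarrow> t z \<in> {-d..d}"
  shows "continuous_on T (\<lambda>z. K (p z, s z, t z))"
  by (rule continuous_on_compose2[OF continuous_K]) (use assms in \<open>auto simp: Kdom_def intro!: continuous_intros\<close>)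

lemma continuous_inner_integral:
  fixes p :: "'t::topological_space \<Rightarrow> (real^'n) \<times> real"
  assumes p: "continuous_on T p" "\<And>y. y \<in> T \<Longrightarrow> p y \<in> cl"
    and f: "continuous_on (T \<times> {-d..d} \<times> {-d..d}) (\<lambda>z. f (fst z) (fst (snd z)) (snd (snd z)))"
  shows "continuous_on (T \<times> {-d..d}) (\<lambda>z. integral {-d..d} (\<lambda>\<beta>. K (p (fst z), snd z, \<beta>) * f (fst z) (snd z) \<beta>))"
proof -
  have "continuous_on ((T \<times> {-d..d}) \<times> cbox (-d) d) (\<lambda>(z, \<beta>). K (p (fst z), snd z, \<beta>) * f (fst z) (snd z) \<beta>)"
    unfolding split_def
  proof (intro continuous_on_mult continuous_K_compose)
    show "continuous_on ((T \<times> {-d..d}) \<times> cbox (-d) d) (\<lambda>z. f (fst (fst z)) (snd (fst z)) (snd z))"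
      using continuous_on_compose2[OF f, of "(T \<times> {-d..d}) \<times> cbox (-d) d" "\<lambda>z. (fst (fst z), snd (fst z), snd z)"]
      by (simp add: continuous_intros image_subset_iff)
    show "continuous_on ((T \<times> {-d..d}) \<times> cbox (-d) d) (\<lambda>z. p (fst (fst z)))"
      by (rule continuous_on_compose2[OF p(1)]) (auto intro!: continuous_intros)
  qed (use p(2) in \<open>auto intro!: continuous_intros\<close>)
  from integral_continuous_on_param[OF this] show ?thesis by simp
qed

lemma Lam_continuous:
  fixes p :: "'t::topological_space \<Rightarrow> (real^'n) \<times> real"
  assumes p: "continuous_on T p" "\<And>y. y \<in> T \<Longrightarrow> p y \<in> cl"
    and f: "continuous_on (T \<times> {-d..d} \<times> {-d..d}) (\<lambda>z. f (fst z) (fst (snd z)) (snd (snd z)))"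
  shows "continuous_on T (\<lambda>y. Lam d mus K (p y) k (f y))"
proof -
  define G where "G y t = integral {-d..d} (\<lambda>\<beta>. K (p y, t, \<beta>) * f y t \<beta>)" for y t
  have G: "continuous_on (T \<times> {-d..d}) (\<lambda>z. G (fst z) (snd z))"
    unfolding G_def by (rule continuous_inner_integral[OF p f])
  have Gt: "continuous_on T (\<lambda>y. G y t)" if "t \<in> {-d..d}" for t
    using continuous_on_compose2[OF G, of T "\<lambda>y. (y, t)"] that by (simp add: continuous_intros image_subset_iff)
  have hs: "p y \<in> halfspace" if "y \<in> T" for y using p(2)[OF that] cl_halfspace by blast
  have ph: "continuous_on T (\<lambda>y. phi d k (p y) t)" for t
    by (intro continuous_phi p(1) continuous_intros) (use hs in blast)
  have "continuous_on (T \<times> cbox (-d) d) (\<lambda>(y, t). dphi d k (p y) t * G y t)"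
    unfolding split_def
  proof (intro continuous_on_mult continuous_phi)
    show "continuous_on (T \<times> cbox (-d) d) (\<lambda>z. p (fst z))"
      by (rule continuous_on_compose2[OF p(1)]) (auto intro!: continuous_intros)
    show "continuous_on (T \<times> cbox (-d) d) (\<lambda>z. G (fst z) (snd z))" using G by simp
  qed (use hs in \<open>auto intro!: continuous_intros\<close>)
  from integral_continuous_on_param[OF this]
  have I: "continuous_on T (\<lambda>y. integral {-d..d} (\<lambda>t. dphi d k (p y) t * G y t))" by simp
  have m: "continuous_on T (\<lambda>y. mus (p y))"
    by (rule continuous_on_compose2[OF continuous_mus p(1) subset_UNIV])
  show ?thesis
    unfolding Lam_def G_def[symmetric]
    by (intro continuous_intros m ph Gt I) (use d in auto)
qed

lemma
  assumes x: "x \<in> cl"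
    and f: "continuous_on ({-d..d} \<times> {-d..d}) (\<lambda>z. f (fst z) (snd z))"
  shows continuous_inner: "continuous_on {-d..d} (\<lambda>t. integral {-d..d} (\<lambda>\<beta>. K (x, t, \<beta>) * f t \<beta>))"
    and continuous_integrand: "t \<in> {-d..d} \<Longrightarrow> continuous_on {-d..d} (\<lambda>\<beta>. K (x, t, \<beta>) * f t \<beta>)"
proof -
  \<comment> \<open>A one-point parameter set reduces the claim to
    \<open>continuous_inner_integral\<close>.\<close>
  have f': "continuous_on ({0 :: real} \<times> {-d..d} \<times> {-d..d}) (\<lambda>z. f (fst (snd z)) (snd (snd z)))"
    by (rule continuous_on_compose2[OF f, of _ snd, simplified]) (auto intro!: continuous_intros)
  have "continuous_on ({0 :: real} \<times> {-d..d}) (\<lambda>z. integral {-d..d} (\<lambda>\<beta>. K (x, snd z, \<beta>) * f (snd z) \<beta>))"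
    using continuous_inner_integral[of "{0 :: real}" "\<lambda>_. x" "\<lambda>_. f"] x f' by simp
  from continuous_on_compose2[OF this, of "{-d..d}" "\<lambda>t. (0, t)"]
  show "continuous_on {-d..d} (\<lambda>t. integral {-d..d} (\<lambda>\<beta>. K (x, t, \<beta>) * f t \<beta>))"
    by (simp add: continuous_intros image_subset_iff)
  show "continuous_on {-d..d} (\<lambda>\<beta>. K (x, t, \<beta>) * f t \<beta>)" if "t \<in> {-d..d}"
  proof (intro continuous_on_mult continuous_K_compose)
    show "continuous_on {-d..d} (\<lambda>\<beta>. f t \<beta>)"
      using continuous_on_compose2[OF f, of "{-d..d}" "\<lambda>\<beta>. (t, \<beta>)"] that by (simp add: continuous_intros image_subset_iff)
  qed (use x that in \<open>auto intro!: continuous_intros\<close>)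
qed

lemma Lam_comb:
  fixes k :: "'N::finite"
  assumes x: "x \<in> cl"
    and f: "continuous_on ({-d..d} \<times> {-d..d}) (\<lambda>z. f (fst z) (snd z))"
    and g: "continuous_on ({-d..d} \<times> {-d..d}) (\<lambda>z. g (fst z) (snd z))"
  shows "Lam d mus K x k (\<lambda>t \<beta>. f t \<beta> + c * g t \<beta>) = Lam d mus K x k f + c * Lam d mus K x k g"
proof -
  have hs: "x \<in> halfspace" using x cl_halfspace by blast
  have inner: "integral {-d..d} (\<lambda>\<beta>. K (x, t, \<beta>) * (f t \<beta> + c * g t \<beta>))
      = integral {-d..d} (\<lambda>\<beta>. K (x, t, \<beta>) * f t \<beta>) + c * integral {-d..d} (\<lambda>\<beta>. K (x, t, \<beta>) * g t \<beta>)"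
    if "t \<in> {-d..d}" for t
  proof -
    have "(\<lambda>\<beta>. K (x, t, \<beta>) * (f t \<beta> + c * g t \<beta>)) = (\<lambda>\<beta>. K (x, t, \<beta>) * f t \<beta> + c * (K (x, t, \<beta>) * g t \<beta>))"
      by (simp add: fun_eq_iff algebra_simps)
    moreover have "(\<lambda>\<beta>. K (x, t, \<beta>) * f t \<beta>) integrable_on {-d..d}" "(\<lambda>\<beta>. K (x, t, \<beta>) * g t \<beta>) integrable_on {-d..d}"
      using continuous_integrand[OF x f that] continuous_integrand[OF x g that] by (auto intro: integrable_continuous_real)
    ultimately show ?thesis
      by (simp add: Henstock_Kurzweil_Integration.integral_add integrable_on_mult_right)
  qed
  let ?If = "\<lambda>t. integral {-d..d} (\<lambda>\<beta>. K (x, t, \<beta>) * f t \<beta>)"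
  let ?Ig = "\<lambda>t. integral {-d..d} (\<lambda>\<beta>. K (x, t, \<beta>) * g t \<beta>)"
  have dp: "continuous_on {-d..d} (dphi d k x)"
    by (intro continuous_phi(2) continuous_intros) (use hs in auto)
  have "integral {-d..d} (\<lambda>t. dphi d k x t * integral {-d..d} (\<lambda>\<beta>. K (x, t, \<beta>) * (f t \<beta> + c * g t \<beta>)))
      = integral {-d..d} (\<lambda>t. dphi d k x t * ?If t + c * (dphi d k x t * ?Ig t))"
    by (rule Henstock_Kurzweil_Integration.integral_cong, subst inner) (auto simp: algebra_simps)
  also have "\<dots> = integral {-d..d} (\<lambda>t. dphi d k x t * ?If t) + c * integral {-d..d} (\<lambda>t. dphi d k x t * ?Ig t)"
  proof -
    have "(\<lambda>t. dphi d k x t * ?If t) integrable_on {-d..d}" "(\<lambda>t. dphi d k x t * ?Ig t) integrable_on {-d..d}"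
      by (intro integrable_continuous_real continuous_on_mult dp continuous_inner[OF x] f g)+
    then show ?thesis
      by (simp add: Henstock_Kurzweil_Integration.integral_add integrable_on_mult_right)
  qed
  finally have outer: "integral {-d..d} (\<lambda>t. dphi d k x t * integral {-d..d} (\<lambda>\<beta>. K (x, t, \<beta>) * (f t \<beta> + c * g t \<beta>)))
      = integral {-d..d} (\<lambda>t. dphi d k x t * ?If t) + c * integral {-d..d} (\<lambda>t. dphi d k x t * ?Ig t)" .
  have "d \<in> {-d..d}" "-d \<in> {-d..d}" using d by auto
  then show ?thesis
    unfolding Lam_def outer by (subst (1 2) inner) (auto simp: algebra_simps)
qed

text \<open>\<open>2 * d\<close> is the length of the inner interval; \<open>2 + 2 * d\<close>
  counts the two boundary terms and the length of the outer interval. The kernel enters through its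
  supremum bound \<open>\<kappa>\<close>.\<close>

lemma Lam_bound:
  fixes k :: "'N::finite"
  assumes x: "x \<in> cl"
    and f: "continuous_on ({-d..d} \<times> {-d..d}) (\<lambda>z. f (fst z) (snd z))"
    and s: "\<And>t \<beta>. t \<in> {-d..d} \<Longrightarrow> \<beta> \<in> {-d..d} \<Longrightarrow> \<bar>f t \<beta>\<bar> \<le> s"
    and C: "\<And>t. t \<in> {-d..d} \<Longrightarrow> \<bar>phi d k x t\<bar> \<le> C" "\<And>t. t \<in> {-d..d} \<Longrightarrow> \<bar>dphi d k x t\<bar> \<le> C"
    and m: "\<bar>mus x\<bar> \<le> m"
  shows "\<bar>Lam d mus K x k f\<bar> \<le> m * (C * (\<kappa> * s * (2 * d)) * (2 + 2 * d))"
proof -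
  have hs: "x \<in> halfspace" using x cl_halfspace by blast
  let ?I = "\<lambda>t. integral {-d..d} (\<lambda>\<beta>. K (x, t, \<beta>) * f t \<beta>)"
  have d0: "d \<in> {-d..d}" "-d \<in> {-d..d}" using d by auto
  have C0: "0 \<le> C" using C(1)[OF d0(1)] abs_ge_zero order_trans by blast
  have \<kappa>0: "0 \<le> \<kappa>"
    using K_bound[of "(x, d, d)"] x d0 abs_ge_zero order_trans by (fastforce simp: Kdom_def)
  have I: "\<bar>?I t\<bar> \<le> \<kappa> * s * (2 * d)" if t: "t \<in> {-d..d}" for t
  proof -
    have "\<bar>K (x, t, \<beta>) * f t \<beta>\<bar> \<le> \<kappa> * s" if "\<beta> \<in> {-d..d}" for \<beta>
      unfolding abs_mult using K_bound[of "(x, t, \<beta>)"] x t that s \<kappa>0 by (intro mult_mono) (auto simp: Kdom_def)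
    then have "norm (?I t) \<le> \<kappa> * s * (d - - d)"
      using d by (intro integral_bound continuous_integrand[OF x f t]) auto
    then show ?thesis by simp
  qed
  have dp: "continuous_on {-d..d} (dphi d k x)"
    by (intro continuous_phi(2) continuous_intros) (use hs in auto)
  have "norm (integral {-d..d} (\<lambda>t. dphi d k x t * ?I t)) \<le> C * (\<kappa> * s * (2 * d)) * (d - - d)"
    using d by (intro integral_bound continuous_on_mult dp continuous_inner[OF x f])
      (auto simp: abs_mult intro!: mult_mono C I C0)
  moreover have "\<bar>phi d k x t * ?I t\<bar> \<le> C * (\<kappa> * s * (2 * d))" if "t \<in> {-d..d}" for t
    unfolding abs_mult by (intro mult_mono C I C0 that) auto
  from this[OF d0(1)] this[OF d0(2)]
  have "\<bar>phi d k x d * ?I d\<bar> \<le> C * (\<kappa> * s * (2 * d))" "\<bar>phi d k x (-d) * ?I (-d)\<bar> \<le> C * (\<kappa> * s * (2 * d))" .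
  ultimately have "\<bar>phi d k x d * ?I d - phi d k x (-d) * ?I (-d) - integral {-d..d} (\<lambda>t. dphi d k x t * ?I t)\<bar>
      \<le> C * (\<kappa> * s * (2 * d)) * (2 + 2 * d)"
    by (simp add: algebra_simps)
  then show ?thesis
    unfolding Lam_def abs_mult abs_minus_cancel using m by (intro mult_mono) auto
qed

text \<open>Integration by parts against \<open>phi\<close>. \<open>K\<close> is differentiable only
  within its closed domain, so \<open>deriv\<close> of the bracket is known for interior
  \<open>t\<close> only; but the bracket is continuous up to the end points, which is all that the
  interior form of the fundamental theorem asks for there.\<close>

lemma F_vec_eq:
  fixes W :: "real^'N::finite"
  assumes x: "x \<in> cl"
  shows "F_vec d mus K W x = (\<chi> k. Lam d mus K x k (\<lambda>t \<beta>. exp (W \<bullet> cvec d t \<beta>)))"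
proof -
  have hs: "x \<in> halfspace" using x cl_halfspace by blast
  let ?D = "{-d..d}"
  define S where "S t = (\<Sum>r\<in>(UNIV::'N set). W $ r * Psi d (idx r) t)" for t
  define H where "H t = exp (- S t) * integral ?D (\<lambda>\<beta>. K (x, t, \<beta>) * exp (S \<beta>))" for t
  have S: "(S has_real_derivative (\<Sum>r\<in>(UNIV::'N set). W $ r * deriv (Psi d (idx r)) t)) (at t)" for t
    unfolding S_def[abs_def] by (intro DERIV_sum DERIV_cmult Psi_deriv)
  have S_cont: "continuous_on T S" for T
    using DERIV_continuous_on[OF DERIV_subset[OF S subset_UNIV]] by blast
  \<comment> \<open>The outer exponential does not depend on \<open>\<beta>\<close> and moves into
    the inner integral, where the exponents combine.\<close>
  have H_eq: "H t = integral ?D (\<lambda>\<beta>. K (x, t, \<beta>) * exp (W \<bullet> cvec d t \<beta>))" for t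
  proof -
    have Wc: "W \<bullet> cvec d t \<beta> = S \<beta> + - S t" for \<beta>
      by (simp add: S_def cvec_def inner_vec_def algebra_simps sum_subtractf)
    have Kc: "K (x, t, \<beta>) * exp (W \<bullet> cvec d t \<beta>) = exp (- S t) * (K (x, t, \<beta>) * exp (S \<beta>))" for \<beta>
      unfolding Wc exp_add by (simp only: mult_ac)
    show ?thesis unfolding H_def Kc by simp
  qed
  obtain g where g: "\<And>p. p \<in> Kdom A d a b \<Longrightarrow> (K has_derivative (\<lambda>v. g p \<bullet> v)) (at p within Kdom A d a b)"
    "continuous_on (Kdom A d a b) g" using K_gradient by blast
  define e :: "((real^'n) \<times> real) \<times> real \<times> real" where "e = (0, 1, 0)"
  have Kt: "((\<lambda>t. K (x, t, \<beta>)) has_real_derivative g (x, t, \<beta>) \<bullet> e) (at t within ?D)"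
    if "t \<in> ?D" "\<beta> \<in> ?D" for t \<beta>
  proof -
    have p: "(x, t, \<beta>) \<in> Kdom A d a b" using x that by (simp add: Kdom_def)
    have "((\<lambda>t. (x, t, \<beta>)) has_derivative (\<lambda>h. h *\<^sub>R e)) (at t within ?D)"
      by (auto intro!: derivative_eq_intros simp: e_def zero_prod_def)
    moreover have "(K has_derivative (\<lambda>v. g (x, t, \<beta>) \<bullet> v)) (at (x, t, \<beta>) within (\<lambda>t. (x, t, \<beta>)) ` ?D)"
      by (rule has_derivative_subset[OF g(1)[OF p]]) (use x that in \<open>auto simp: Kdom_def\<close>)
    ultimately have "((\<lambda>t. K (x, t, \<beta>)) has_derivative (\<lambda>h. g (x, t, \<beta>) \<bullet> (h *\<^sub>R e))) (at t within ?D)"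
      using diff_chain_within[of "\<lambda>t. (x, t, \<beta>)" "\<lambda>h. h *\<^sub>R e" t ?D K "\<lambda>v. g (x, t, \<beta>) \<bullet> v"] by (simp add: o_def)
    then show ?thesis
      unfolding has_field_derivative_def by (rule has_derivative_eq_rhs) (simp add: fun_eq_iff)
  qed
  have inner_deriv: "((\<lambda>t. integral (cbox (-d) d) (\<lambda>\<beta>. K (x, t, \<beta>) * exp (S \<beta>))) has_real_derivative
      integral (cbox (-d) d) (\<lambda>\<beta>. g (x, t, \<beta>) \<bullet> e * exp (S \<beta>))) (at t within ?D)" if t: "t \<in> ?D" for t
  proof (rule leibniz_rule_field_derivative[OF _ _ _ t])
    show "((\<lambda>t. K (x, t, \<beta>) * exp (S \<beta>)) has_real_derivative g (x, t, \<beta>) \<bullet> e * exp (S \<beta>)) (at t within ?D)"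
      if "t \<in> ?D" "\<beta> \<in> cbox (-d) d" for t \<beta>
      using Kt[of t \<beta>] that by (intro DERIV_cmult_right) auto
    show "(\<lambda>\<beta>. K (x, t, \<beta>) * exp (S \<beta>)) integrable_on cbox (-d) d" if "t \<in> ?D" for t
      by (intro integrable_continuous continuous_on_mult continuous_K_compose continuous_intros S_cont)
        (use x that in auto)
    have "continuous_on (?D \<times> cbox (-d) d) (\<lambda>z. g (x, fst z, snd z))"
      by (rule continuous_on_compose2[OF g(2)]) (use x in \<open>auto simp: Kdom_def intro!: continuous_intros\<close>)
    then show "continuous_on (?D \<times> cbox (-d) d) (\<lambda>(t, \<beta>). g (x, t, \<beta>) \<bullet> e * exp (S \<beta>))"
      unfolding split_def
      by (intro continuous_intros continuous_on_compose2[OF S_cont[of UNIV]]) auto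
  qed auto
  have H_within: "\<exists>D. (H has_real_derivative D) (at t within ?D)" if t: "t \<in> ?D" for t
  proof -
    have "((\<lambda>t. exp (- S t)) has_real_derivative
        exp (- S t) * - (\<Sum>r\<in>(UNIV::'N set). W $ r * deriv (Psi d (idx r)) t)) (at t within ?D)"
      using DERIV_fun_exp[OF DERIV_minus[OF S]] by (rule DERIV_subset) simp
    from DERIV_mult[OF this inner_deriv[OF t]] show ?thesis unfolding H_def[abs_def] by auto
  qed
  have H_cont: "continuous_on ?D H"
    using H_within by (meson DERIV_continuous_on)
  have H_at: "(H has_real_derivative deriv H t) (at t)" if t: "t \<in> {-d<..<d}" for t
  proof -
    obtain D where "(H has_real_derivative D) (at t within ?D)" using H_within[of t] t by auto
    moreover have "at t within ?D = at t" using t by (intro at_within_interior) (simp add: interior_atLeastAtMost_real)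
    ultimately show ?thesis using DERIV_imp_deriv by metis
  qed
  have "- integral ?D (\<lambda>t. mus x / snd (nu x t) * deriv H t * Psi d (idx k) t)
     = Lam d mus K x k (\<lambda>t \<beta>. exp (W \<bullet> cvec d t \<beta>))" for k :: 'N
  proof -
    have ph: "continuous_on ?D (phi d k x)" and dp: "continuous_on ?D (dphi d k x)"
      by (intro continuous_phi continuous_intros; use hs in auto)+
    have "((\<lambda>t. phi d k x t * deriv H t + dphi d k x t * H t) has_integral
        (phi d k x d * H d - phi d k x (-d) * H (-d))) ?D"
    proof (rule fundamental_theorem_of_calculus_interior)
      fix t assume "t \<in> {-d<..<d}"
      from DERIV_mult[OF phi_deriv[OF hs] H_at[OF this], of d k]
      show "((\<lambda>t. phi d k x t * H t) has_vector_derivative (phi d k x t * deriv H t + dphi d k x t * H t)) (at t)"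
        by (simp add: has_real_derivative_iff_has_vector_derivative[symmetric] algebra_simps)
    qed (use d in \<open>auto intro!: continuous_intros ph H_cont\<close>)
    \<comment> \<open>The continuity of \<open>deriv H\<close> is not established; the integrability
      of \<open>phi\<close> times \<open>deriv H\<close> results from subtracting this continuous
      term from the product rule.\<close>
    moreover have "((\<lambda>t. dphi d k x t * H t) has_integral integral ?D (\<lambda>t. dphi d k x t * H t)) ?D"
      by (intro integrable_integral integrable_continuous_real continuous_intros dp H_cont)
    ultimately have "((\<lambda>t. (phi d k x t * deriv H t + dphi d k x t * H t) - dphi d k x t * H t) has_integral
        (phi d k x d * H d - phi d k x (-d) * H (-d) - integral ?D (\<lambda>t. dphi d k x t * H t))) ?D"
      by (rule has_integral_diff)
    then have I: "integral ?D (\<lambda>t. phi d k x t * deriv H t)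
        = phi d k x d * H d - phi d k x (-d) * H (-d) - integral ?D (\<lambda>t. dphi d k x t * H t)"
      by (simp add: integral_unique)
    have "(\<lambda>t. mus x / snd (nu x t) * deriv H t * Psi d (idx k) t) = (\<lambda>t. mus x * (phi d k x t * deriv H t))"
      by (simp add: fun_eq_iff snd_nu phi_def)
    then have "- integral ?D (\<lambda>t. mus x / snd (nu x t) * deriv H t * Psi d (idx k) t)
        = - mus x * integral ?D (\<lambda>t. phi d k x t * deriv H t)" by simp
    then show ?thesis unfolding I Lam_def H_eq .
  qed
  then show ?thesis
    unfolding F_vec_def H_def[abs_def] S_def by (simp add: vec_eq_iff)
qed

lemma continuous_exp_cvec:
  assumes "continuous_on T W" "continuous_on T f" "continuous_on T g"
  shows "continuous_on T (\<lambda>z. exp (W z \<bullet> cvec d (f z) (g z)))"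
  by (intro continuous_intros continuous_cvec assms)

lemma continuous_dexp_cvec:
  assumes "continuous_on T W" "continuous_on T v" "continuous_on T f" "continuous_on T g"
  shows "continuous_on T (\<lambda>z. exp (W z \<bullet> cvec d (f z) (g z)) * (v z \<bullet> cvec d (f z) (g z)))"
  by (intro continuous_intros continuous_cvec assms)

lemma dF_comb:
  fixes W u v :: "real^'N::finite"
  assumes x: "x \<in> cl"
  shows "dF d mus K x W (u + c *\<^sub>R v) = dF d mus K x W u + c *\<^sub>R dF d mus K x W v"
proof -
  have cont: "continuous_on ({-d..d} \<times> {-d..d}) (\<lambda>z. exp (W \<bullet> cvec d (fst z) (snd z)) * (w \<bullet> cvec d (fst z) (snd z)))" for w
    by (intro continuous_dexp_cvec continuous_intros)
  have "Lam d mus K x k (\<lambda>t \<beta>. exp (W \<bullet> cvec d t \<beta>) * ((u + c *\<^sub>R v) \<bullet> cvec d t \<beta>))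
    = Lam d mus K x k (\<lambda>t \<beta>. exp (W \<bullet> cvec d t \<beta>) * (u \<bullet> cvec d t \<beta>))
      + c * Lam d mus K x k (\<lambda>t \<beta>. exp (W \<bullet> cvec d t \<beta>) * (v \<bullet> cvec d t \<beta>))" for k :: 'N
    using Lam_comb[OF x cont[of u] cont[of v], of k c] by (simp add: inner_add_left algebra_simps)
  then show ?thesis by (simp add: dF_def vec_eq_iff)
qed

lemma
  fixes p :: "real \<Rightarrow> (real^'n) \<times> real" and q v :: "real \<Rightarrow> real^'N::finite"
  assumes p: "continuous_on T p" "\<And>y. y \<in> T \<Longrightarrow> p y \<in> cl" and q: "continuous_on T q"
  shows F_vec_continuous: "continuous_on T (\<lambda>y. F_vec d mus K (q y) (p y))"
    and dF_continuous: "continuous_on T v \<Longrightarrow> continuous_on T (\<lambda>y. dF d mus K (p y) (q y) (v y))"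
proof -
  have c: "continuous_on (T \<times> {-d..d} \<times> {-d..d}) (\<lambda>z. w (fst z))" if "continuous_on T w" for w :: "real \<Rightarrow> real^'N"
    by (rule continuous_on_compose2[OF that]) (auto intro!: continuous_intros)
  have "continuous_on T (\<lambda>y. (\<chi> k. Lam d mus K (p y) k (\<lambda>t \<beta>. exp (q y \<bullet> cvec d t \<beta>))) :: real^'N)"
    by (intro continuous_on_vec_lambda Lam_continuous p continuous_exp_cvec c q continuous_intros)
  then show "continuous_on T (\<lambda>y. F_vec d mus K (q y) (p y))"
    by (rule continuous_on_eq) (simp add: F_vec_eq p(2))
  show "continuous_on T (\<lambda>y. dF d mus K (p y) (q y) (v y))" if "continuous_on T v"
    unfolding dF_def
    by (intro continuous_on_vec_lambda Lam_continuous p continuous_dexp_cvec c q that continuous_intros)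
qed

end

lemma norm_vec_le:
  fixes f :: "'N::finite \<Rightarrow> real"
  assumes "\<And>k. \<bar>f k\<bar> \<le> B"
  shows "norm (\<chi> k. f k) \<le> real CARD('N) * B"
proof -
  have "norm (\<chi> k. f k) \<le> (\<Sum>k\<in>UNIV. \<bar>f k\<bar>)" using norm_le_l1_cart[of "\<chi> k. f k"] by simp
  also have "\<dots> \<le> real CARD('N) * B" by (rule sum_bounded_above) (rule assms)
  finally show ?thesis .
qed

text \<open>\<open>C\<close> is fixed before \<open>K\<close>, \<open>x\<close> and the vectors. By
  linearity each quantity is \<open>Lam\<close> applied to a single kernel, which
  \<open>exp_bounds\<close> and Cauchy-Schwarz estimate pointwise, and \<open>Lam_bound\<close> sees
  \<open>K\<close> through \<open>\<kappa>\<close> only.\<close>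

lemma F_estimates:
  obtains C where "C > 0"
    "\<And>K x W. C2_on (Kdom A d a b) K \<Longrightarrow> C1_norm (Kdom A d a b) K = \<kappa> \<Longrightarrow> x \<in> cl \<Longrightarrow> norm W \<le> \<rho> \<Longrightarrow>
       norm (F_vec d mus K W x :: real^'N::finite) \<le> C"
    "\<And>K x W v. C2_on (Kdom A d a b) K \<Longrightarrow> C1_norm (Kdom A d a b) K = \<kappa> \<Longrightarrow> x \<in> cl \<Longrightarrow> norm W \<le> \<rho> \<Longrightarrow>
       norm (dF d mus K x W v :: real^'N) \<le> C * norm v"
    "\<And>K x W V v. C2_on (Kdom A d a b) K \<Longrightarrow> C1_norm (Kdom A d a b) K = \<kappa> \<Longrightarrow> x \<in> cl \<Longrightarrow> norm W \<le> \<rho> \<Longrightarrow> norm V \<le> \<rho> \<Longrightarrow>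
       norm (dF d mus K x V v - dF d mus K x W v :: real^'N) \<le> C * norm (V - W) * norm v"
    "\<And>K x W V. C2_on (Kdom A d a b) K \<Longrightarrow> C1_norm (Kdom A d a b) K = \<kappa> \<Longrightarrow> x \<in> cl \<Longrightarrow> norm W \<le> \<rho> \<Longrightarrow> norm V \<le> \<rho> \<Longrightarrow>
       norm (F_vec d mus K V x - F_vec d mus K W x - dF d mus K x W (V - W) :: real^'N) \<le> C * (norm (V - W))\<^sup>2"
proof -
  obtain c0 where c0: "c0 > 0" "\<And>t \<beta>. t \<in> {-d..d} \<Longrightarrow> \<beta> \<in> {-d..d} \<Longrightarrow> norm (cvec d t \<beta> :: real^'N) \<le> c0"
    using cvec_bounded by blast
  obtain C\<phi> where C\<phi>: "C\<phi> > 0" "\<And>x t k. x \<in> cl \<Longrightarrow> t \<in> {-d..d} \<Longrightarrow> \<bar>phi d (k::'N) x t\<bar> \<le> C\<phi>"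
    "\<And>x t k. x \<in> cl \<Longrightarrow> t \<in> {-d..d} \<Longrightarrow> \<bar>dphi d (k::'N) x t\<bar> \<le> C\<phi>"
    using phi_bounded[OF compact_closure_Omega[OF A ab] cl_halfspace] by meson
  have "bounded (mus ` cl)"
    by (intro compact_imp_bounded compact_continuous_image continuous_mus compact_closure_Omega A ab)
  then obtain Cm where Cm: "Cm > 0" "\<And>x. x \<in> cl \<Longrightarrow> \<bar>mus x\<bar> \<le> Cm"
    unfolding bounded_pos by auto
  \<comment> \<open>The absolute value makes \<open>L\<close> nonnegative before any kernel is
    given: \<open>\<kappa>\<close> is known to be nonnegative only once some \<open>K\<close> has it
    as its norm.\<close>
  define L where "L = real CARD('N) * (Cm * (C\<phi> * (\<bar>\<kappa>\<bar> * (2 * d)) * (2 + 2 * d)))"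
  define e where "e = exp (\<rho> * c0)"
  \<comment> \<open>The estimates carry the factors \<open>1\<close>, \<open>c0\<close>,
    \<open>c0\<^sup>2\<close> and \<open>c0\<^sup>2\<close>; the sum covers all of them, and the
    final 1 makes \<open>C\<close> positive.\<close>
  define C where "C = L * (e * (1 + c0 + c0\<^sup>2)) + 1"
  have L0: "L \<ge> 0" using Cm C\<phi> d by (simp add: L_def)
  have e0: "e > 0" by (simp add: e_def)
  have dot: "\<bar>W \<bullet> cvec d t \<beta>\<bar> \<le> norm W * c0" if "t \<in> {-d..d}" "\<beta> \<in> {-d..d}" for W :: "real^'N" and t \<beta>
    by (rule order_trans[OF Cauchy_Schwarz_ineq2]) (use c0(2)[OF that] in \<open>simp add: mult_left_mono\<close>)
  have dot\<rho>: "\<bar>W \<bullet> cvec d t \<beta>\<bar> \<le> \<rho> * c0" if "norm W \<le> \<rho>" "t \<in> {-d..d}" "\<beta> \<in> {-d..d}" for W :: "real^'N" and t \<beta>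
    using dot[OF that(2,3), of W] mult_right_mono[OF that(1), of c0] c0(1) by linarith
  have expW: "exp (W \<bullet> cvec d t \<beta>) \<le> e" if "norm W \<le> \<rho>" "t \<in> {-d..d}" "\<beta> \<in> {-d..d}" for W :: "real^'N" and t \<beta>
    using dot\<rho>[OF that] by (simp add: e_def)
  have vec: "norm (\<chi> k::'N. Lam d mus K x k f) \<le> C * r"
    if K: "C2_on (Kdom A d a b) K" "C1_norm (Kdom A d a b) K = \<kappa>" and x: "x \<in> cl"
      and f: "continuous_on ({-d..d} \<times> {-d..d}) (\<lambda>z. f (fst z) (snd z))"
      and s: "\<And>t \<beta>. t \<in> {-d..d} \<Longrightarrow> \<beta> \<in> {-d..d} \<Longrightarrow> \<bar>f t \<beta>\<bar> \<le> e * (1 + c0 + c0\<^sup>2) * r" and r: "r \<ge> 0"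
    for K x f r
  proof -
    have k: "\<kappa> \<le> \<bar>\<kappa>\<bar>" by simp
    let ?s = "e * (1 + c0 + c0\<^sup>2) * r"
    have s0: "?s \<ge> 0" using e0 c0(1) r by simp
    have "\<bar>Lam d mus K x k f\<bar> \<le> Cm * (C\<phi> * (\<bar>\<kappa>\<bar> * ?s * (2 * d)) * (2 + 2 * d))" for k :: 'N
    proof -
      have "\<bar>Lam d mus K x k f\<bar> \<le> Cm * (C\<phi> * (\<kappa> * ?s * (2 * d)) * (2 + 2 * d))"
        by (rule Lam_bound[OF K x f s C\<phi>(2,3)[OF x] Cm(2)[OF x]])
      also have "\<dots> \<le> Cm * (C\<phi> * (\<bar>\<kappa>\<bar> * ?s * (2 * d)) * (2 + 2 * d))"
        using Cm(1) C\<phi>(1) d s0 by (intro mult_left_mono mult_right_mono k) auto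
      finally show ?thesis .
    qed
    then have "norm (\<chi> k::'N. Lam d mus K x k f) \<le> real CARD('N) * (Cm * (C\<phi> * (\<bar>\<kappa>\<bar> * ?s * (2 * d)) * (2 + 2 * d)))"
      by (rule norm_vec_le)
    also have "\<dots> = L * (e * (1 + c0 + c0\<^sup>2)) * r" unfolding L_def by (simp only: mult_ac)
    also have "\<dots> \<le> C * r" using r by (intro mult_right_mono) (simp_all add: C_def)
    finally show ?thesis .
  qed
  have coef: "e \<le> e * (1 + c0 + c0\<^sup>2)" "e * c0 \<le> e * (1 + c0 + c0\<^sup>2)" "e * c0\<^sup>2 \<le> e * (1 + c0 + c0\<^sup>2)"
    using e0 c0(1) by (simp_all add: algebra_simps)
  have cont: "continuous_on ({-d..d} \<times> {-d..d}) (\<lambda>z. exp (W \<bullet> cvec d (fst z) (snd z)))"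
    "continuous_on ({-d..d} \<times> {-d..d}) (\<lambda>z. exp (W \<bullet> cvec d (fst z) (snd z)) * (v \<bullet> cvec d (fst z) (snd z)))"
    for W v :: "real^'N"
    by (intro continuous_intros continuous_cvec)+
  show ?thesis
  proof (rule that[of C])
    show "C > 0" using L0 e0 c0(1) by (simp add: C_def add_nonneg_pos)
    fix K :: "((real^'n) \<times> real) \<times> real \<times> real \<Rightarrow> real" and x and W V v :: "real^'N"
    assume K: "C2_on (Kdom A d a b) K" "C1_norm (Kdom A d a b) K = \<kappa>" and x: "x \<in> cl" and W: "norm W \<le> \<rho>"
    show "norm (F_vec d mus K W x) \<le> C"
    proof -
      have "norm (\<chi> k::'N. Lam d mus K x k (\<lambda>t \<beta>. exp (W \<bullet> cvec d t \<beta>))) \<le> C * 1"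
      proof (rule vec[OF K x cont(1)])
        fix t \<beta> assume t: "t \<in> {-d..d}" "\<beta> \<in> {-d..d}"
        show "\<bar>exp (W \<bullet> cvec d t \<beta>)\<bar> \<le> e * (1 + c0 + c0\<^sup>2) * 1"
          using expW[OF W t] coef(1) by simp
      qed simp
      then show ?thesis by (simp add: F_vec_eq[OF K x])
    qed
    show "norm (dF d mus K x W v) \<le> C * norm v"
      unfolding dF_def
    proof (rule vec[OF K x cont(2)])
      fix t \<beta> assume t: "t \<in> {-d..d}" "\<beta> \<in> {-d..d}"
      have "\<bar>exp (W \<bullet> cvec d t \<beta>) * (v \<bullet> cvec d t \<beta>)\<bar> \<le> e * (norm v * c0)"
        unfolding abs_mult using expW[OF W t] dot[OF t, of v] by (intro mult_mono) (auto simp: e0 less_imp_le)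
      also have "\<dots> = e * c0 * norm v" by simp
      also have "\<dots> \<le> e * (1 + c0 + c0\<^sup>2) * norm v" by (intro mult_right_mono coef) simp
      finally show "\<bar>exp (W \<bullet> cvec d t \<beta>) * (v \<bullet> cvec d t \<beta>)\<bar> \<le> e * (1 + c0 + c0\<^sup>2) * norm v" .
    qed simp
    assume V: "norm V \<le> \<rho>"
    have Lam_diff: "Lam d mus K x k f - Lam d mus K x k g = Lam d mus K x k (\<lambda>t \<beta>. f t \<beta> - g t \<beta>)"
      if "continuous_on ({-d..d} \<times> {-d..d}) (\<lambda>z. f (fst z) (snd z))"
        "continuous_on ({-d..d} \<times> {-d..d}) (\<lambda>z. g (fst z) (snd z))" for f g and k :: 'N
      using Lam_comb[OF K x that, of k "-1"] by simp
    have dVW: "(V - W) \<bullet> c = V \<bullet> c - W \<bullet> c" for c by (rule inner_diff_left)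
    have "dF d mus K x V v - dF d mus K x W v = (\<chi> k. Lam d mus K x k
        (\<lambda>t \<beta>. exp (V \<bullet> cvec d t \<beta>) * (v \<bullet> cvec d t \<beta>) - exp (W \<bullet> cvec d t \<beta>) * (v \<bullet> cvec d t \<beta>)))"
      unfolding dF_def using Lam_diff[OF cont(2) cont(2)] by (simp add: vec_eq_iff)
    also have "norm \<dots> \<le> C * (norm (V - W) * norm v)"
    proof (rule vec[OF K x])
      show "continuous_on ({-d..d} \<times> {-d..d}) (\<lambda>z. exp (V \<bullet> cvec d (fst z) (snd z)) * (v \<bullet> cvec d (fst z) (snd z))
          - exp (W \<bullet> cvec d (fst z) (snd z)) * (v \<bullet> cvec d (fst z) (snd z)))"
        by (intro continuous_on_diff cont)
      fix t \<beta> assume t: "t \<in> {-d..d}" "\<beta> \<in> {-d..d}"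
      have "\<bar>exp (V \<bullet> cvec d t \<beta>) * (v \<bullet> cvec d t \<beta>) - exp (W \<bullet> cvec d t \<beta>) * (v \<bullet> cvec d t \<beta>)\<bar>
          = \<bar>exp (V \<bullet> cvec d t \<beta>) - exp (W \<bullet> cvec d t \<beta>)\<bar> * \<bar>v \<bullet> cvec d t \<beta>\<bar>"
        by (simp add: abs_mult flip: left_diff_distrib)
      also have "\<dots> \<le> (e * (norm (V - W) * c0)) * (norm v * c0)"
      proof (rule mult_mono)
        have "\<bar>exp (V \<bullet> cvec d t \<beta>) - exp (W \<bullet> cvec d t \<beta>)\<bar> \<le> e * \<bar>(V - W) \<bullet> cvec d t \<beta>\<bar>"
          unfolding dVW e_def by (rule exp_bounds(1)[OF dot\<rho>[OF V t] dot\<rho>[OF W t]])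
        also have "\<dots> \<le> e * (norm (V - W) * c0)"
          using dot[OF t, of "V - W"] e0 by (intro mult_left_mono) auto
        finally show "\<bar>exp (V \<bullet> cvec d t \<beta>) - exp (W \<bullet> cvec d t \<beta>)\<bar> \<le> e * (norm (V - W) * c0)" .
      qed (use dot[OF t, of v] e0 c0(1) in auto)
      also have "\<dots> = e * c0\<^sup>2 * (norm (V - W) * norm v)" by (simp add: power2_eq_square)
      also have "\<dots> \<le> e * (1 + c0 + c0\<^sup>2) * (norm (V - W) * norm v)" by (intro mult_right_mono coef) simp
      finally show "\<bar>exp (V \<bullet> cvec d t \<beta>) * (v \<bullet> cvec d t \<beta>) - exp (W \<bullet> cvec d t \<beta>) * (v \<bullet> cvec d t \<beta>)\<bar>
          \<le> e * (1 + c0 + c0\<^sup>2) * (norm (V - W) * norm v)" .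
    qed simp
    finally show "norm (dF d mus K x V v - dF d mus K x W v) \<le> C * norm (V - W) * norm v" by simp
    have "F_vec d mus K V x - F_vec d mus K W x - dF d mus K x W (V - W) = (\<chi> k. Lam d mus K x k
        (\<lambda>t \<beta>. exp (V \<bullet> cvec d t \<beta>) - exp (W \<bullet> cvec d t \<beta>) - exp (W \<bullet> cvec d t \<beta>) * ((V - W) \<bullet> cvec d t \<beta>)))"
      unfolding dF_def F_vec_eq[OF K x]
      using Lam_diff[OF cont(1) cont(1)] Lam_diff[OF continuous_on_diff[OF cont(1) cont(1)] cont(2)]
      by (simp add: vec_eq_iff)
    also have "norm \<dots> \<le> C * (norm (V - W))\<^sup>2"
    proof (rule vec[OF K x])
      show "continuous_on ({-d..d} \<times> {-d..d}) (\<lambda>z. exp (V \<bullet> cvec d (fst z) (snd z)) - exp (W \<bullet> cvec d (fst z) (snd z))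
          - exp (W \<bullet> cvec d (fst z) (snd z)) * ((V - W) \<bullet> cvec d (fst z) (snd z)))"
        by (intro continuous_on_diff cont)
      fix t \<beta> assume t: "t \<in> {-d..d}" "\<beta> \<in> {-d..d}"
      have "\<bar>exp (V \<bullet> cvec d t \<beta>) - exp (W \<bullet> cvec d t \<beta>) - exp (W \<bullet> cvec d t \<beta>) * ((V - W) \<bullet> cvec d t \<beta>)\<bar>
          \<le> e * ((V - W) \<bullet> cvec d t \<beta>)\<^sup>2"
        unfolding dVW e_def by (rule exp_bounds(2)[OF dot\<rho>[OF V t] dot\<rho>[OF W t]])
      also have "\<dots> \<le> e * (norm (V - W) * c0)\<^sup>2"
        using power_mono[OF dot[OF t, of "V - W"], of 2] e0 by (intro mult_left_mono) auto
      also have "\<dots> = e * c0\<^sup>2 * (norm (V - W))\<^sup>2" by (simp add: power_mult_distrib)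
      also have "\<dots> \<le> e * (1 + c0 + c0\<^sup>2) * (norm (V - W))\<^sup>2" by (intro mult_right_mono coef) simp
      finally show "\<bar>exp (V \<bullet> cvec d t \<beta>) - exp (W \<bullet> cvec d t \<beta>) - exp (W \<bullet> cvec d t \<beta>) * ((V - W) \<bullet> cvec d t \<beta>)\<bar>
          \<le> e * (1 + c0 + c0\<^sup>2) * (norm (V - W))\<^sup>2" .
    qed simp
    finally show "norm (F_vec d mus K V x - F_vec d mus K W x - dF d mus K x W (V - W)) \<le> C * (norm (V - W))\<^sup>2" .
  qed
qed

end

section \<open>The weighted least squares functional\<close>

text \<open>Both expansions are tested with small multiples of \<open>w = g - g'\<close>, which
  bounds the squared norm of \<open>w\<close> by \<open>2 e\<close> times its norm for every
  \<open>e\<close>. Definiteness on \<open>H1h0\<close> turns norm zero into equality, so the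
  \<open>THE\<close> in \<open>gradient\<close> is meaningful.\<close>

lemma has_gradient_unique:
  fixes g g' :: "('n::finite, 'N::finite) sdf"
  assumes "a < b" and g: "has_gradient A m a b \<Phi> W g" and g': "has_gradient A m a b \<Phi> W g'"
  shows "g = g'"
proof -
  have ab: "a \<le> b" using \<open>a < b\<close> by simp
  interpret H0: semi_inner "H1h0 A m a b :: ('n, 'N) sdf set" "H1h_inner A m a b"
    by (rule semi_inner_H1h0[OF ab])
  let ?N = "H1h_norm A m a b :: ('n, 'N) sdf \<Rightarrow> real"
  have N: "?N u = H0.nrm u" for u by (rule H1h_norm_eq_nrm[OF ab])
  define w where "w = (\<lambda>J y. g J y - g' J y)"
  have gs: "g \<in> H1h0 A m a b" "g' \<in> H1h0 A m a b" using g g' by (auto simp: has_gradient_def)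
  have w: "w \<in> H1h0 A m a b" unfolding w_def by (rule H0.S_diff[OF gs])
  have "(?N w)\<^sup>2 \<le> \<epsilon>" if "\<epsilon> > 0" for \<epsilon>
  proof -
    \<comment> \<open>Chosen so that \<open>2 * e * (?N w + 1) = \<epsilon>\<close>; the added 1
      excludes division by zero, here and in \<open>t\<close>.\<close>
    define e where "e = \<epsilon> / 2 / (?N w + 1)"
    have cancel: "x / M * M = x" if "M \<noteq> 0" for x M :: real using that by simp
    have N0: "?N w \<ge> 0" unfolding N by (rule H0.nrm_nonneg[OF w])
    have e: "e > 0" using that N0 by (simp add: e_def)
    obtain d1 where d1: "d1 > 0" "\<And>v. v \<in> H1h0 A m a b \<Longrightarrow> ?N v < d1 \<Longrightarrow>
        \<bar>\<Phi> (\<lambda>J y. W J y + v J y) - \<Phi> W - H1h_inner A m a b g v\<bar> \<le> e * ?N v"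
      using g e unfolding has_gradient_def by blast
    obtain d2 where d2: "d2 > 0" "\<And>v. v \<in> H1h0 A m a b \<Longrightarrow> ?N v < d2 \<Longrightarrow>
        \<bar>\<Phi> (\<lambda>J y. W J y + v J y) - \<Phi> W - H1h_inner A m a b g' v\<bar> \<le> e * ?N v"
      using g' e unfolding has_gradient_def by blast
    define t where "t = min d1 d2 / 2 / (?N w + 1)"
    define v where "v = (\<lambda>J y. t *\<^sub>R w J y)"
    have t: "t > 0" using d1(1) d2(1) N0 by (simp add: t_def)
    have v: "v \<in> H1h0 A m a b" unfolding v_def by (rule H0.S_scale[OF w])
    have Nv: "?N v = t * ?N w" unfolding v_def N using H0.nrm_scale[OF w] t by simp
    have "?N v < min d1 d2"
    proof -
      have "t * ?N w \<le> t * (?N w + 1)" using t by simp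
      also have "\<dots> = min d1 d2 / 2"
        unfolding t_def by (rule cancel) (use N0 in linarith)
      also have "\<dots> < min d1 d2" using d1(1) d2(1) by (auto simp: min_def)
      finally show ?thesis using Nv by simp
    qed
    then have "\<bar>H1h_inner A m a b g v - H1h_inner A m a b g' v\<bar> \<le> 2 * (e * ?N v)"
      using d1(2)[OF v] d2(2)[OF v] by simp
    moreover have "H1h_inner A m a b g v - H1h_inner A m a b g' v = t * (?N w)\<^sup>2"
      using H0.ip_diff[OF gs v] H0.ip_scale_right[OF w w, of t] H0.nrm_square[OF w]
      by (simp add: N v_def w_def)
    ultimately have "t * (?N w)\<^sup>2 \<le> t * (2 * e * ?N w)"
      using t by (simp add: Nv mult_ac)
    then have "(?N w)\<^sup>2 \<le> 2 * e * ?N w" using t by simp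
    also have "\<dots> \<le> 2 * e * (?N w + 1)" using e by simp
    also have "\<dots> = 2 * (\<epsilon> / 2)"
      unfolding e_def mult.assoc by (subst cancel) (use N0 in auto)
    finally have "(?N w)\<^sup>2 \<le> 2 * (\<epsilon> / 2)" .
    then show ?thesis by simp
  qed
  then have "(?N w)\<^sup>2 \<le> 0" by (rule field_le_epsilon[of _ 0, simplified])
  then have "w = (\<lambda>J y. 0)" using H1h0_norm_zero[OF \<open>a < b\<close> w] by simp
  then show ?thesis by (simp add: w_def fun_eq_iff)
qed

lemma L2_nrm_le:
  assumes Q: "Q \<in> L2S a b I" and V: "V \<in> L2S a b I" and k: "k \<ge> 0"
    and le: "\<And>J y. J \<in> I \<Longrightarrow> y \<in> {a..b} \<Longrightarrow> norm (Q J y) \<le> k * norm (V J y)"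
  shows "L2.nrm a b I Q \<le> k * L2.nrm a b I V"
proof -
  have "L2ip a b I Q Q \<le> k\<^sup>2 * L2ip a b I V V"
    unfolding L2ip_def sum_distrib_left
  proof (rule sum_mono)
    fix J assume J: "J \<in> I"
    have i: "(\<lambda>y. Q J y \<bullet> Q J y) integrable_on {a..b}" "(\<lambda>y. V J y \<bullet> V J y) integrable_on {a..b}"
      using Q V J by (auto simp: L2S_def intro: L2_fun_inner_integrable)
    have "integral {a..b} (\<lambda>y. Q J y \<bullet> Q J y) \<le> integral {a..b} (\<lambda>y. k\<^sup>2 * (V J y \<bullet> V J y))"
    proof (rule integral_le[OF i(1) integrable_on_mult_right[OF i(2)]])
      fix y assume "y \<in> {a..b}"
      from power_mono[OF le[OF J this], of 2]
      show "Q J y \<bullet> Q J y \<le> k\<^sup>2 * (V J y \<bullet> V J y)"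
        by (simp add: power_mult_distrib power2_norm_eq_inner)
    qed
    then show "integral {a..b} (\<lambda>y. Q J y \<bullet> Q J y) \<le> k\<^sup>2 * integral {a..b} (\<lambda>y. V J y \<bullet> V J y)" by simp
  qed
  then have "sqrt (L2ip a b I Q Q) \<le> sqrt (k\<^sup>2 * L2ip a b I V V)" by (rule real_sqrt_le_mono)
  then show ?thesis using k by (simp add: L2.nrm_def real_sqrt_mult)
qed

lemma L2S_sum:
  assumes "\<And>i. i \<in> I' \<Longrightarrow> Q i \<in> L2S a b I"
  shows "(\<lambda>J y. \<Sum>i\<in>I'. Q i J y) \<in> L2S a b I"
  using assms by (auto simp: L2S_def intro: L2_fun_sum)

lemma L2_nrm_sum:
  assumes "finite I'" "\<And>i. i \<in> I' \<Longrightarrow> Q i \<in> L2S a b I"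
  shows "L2.nrm a b I (\<lambda>J y. \<Sum>i\<in>I'. Q i J y) \<le> (\<Sum>i\<in>I'. L2.nrm a b I (Q i))"
  using assms
proof (induction I' rule: finite_induct)
  case (insert i I')
  then have "L2.nrm a b I (\<lambda>J y. Q i J y + (\<Sum>i\<in>I'. Q i J y))
      \<le> L2.nrm a b I (Q i) + L2.nrm a b I (\<lambda>J y. \<Sum>i\<in>I'. Q i J y)"
    by (intro L2.nrm_triangle L2S_sum) auto
  with insert show ?case by simp
qed (simp add: L2.nrm_zero)

text \<open>The coefficients are abstract functions along the grid lines, and all their bounds are
  parameters. \<open>\<rho>\<close> exceeds the supremum bound on the ball of radius
  \<open>R\<close> by 1, which leaves room for small increments; \<open>n0\<close> bounds the number
  of interior lines.\<close>

locale functional =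
  fixes A a b :: real and m :: nat and lam :: real
    and D :: "nat^'n::finite \<Rightarrow> real \<Rightarrow> real^'N::finite^'N" and B :: "'n \<Rightarrow> nat^'n \<Rightarrow> real \<Rightarrow> real^'N^'N"
    and F :: "nat^'n \<Rightarrow> real \<Rightarrow> real^'N \<Rightarrow> real^'N" and F' :: "nat^'n \<Rightarrow> real \<Rightarrow> real^'N \<Rightarrow> real^'N \<Rightarrow> real^'N"
    and c C R \<rho> n0 :: real
  assumes ab: "a < b" and step: "step A m > 0" and lam: "lam \<ge> 0" and c: "c > 0" and C: "C > 0" and R: "R > 0"
    and \<rho>: "sob a b * R + 1 \<le> \<rho>" and n0: "real (card (interior_idx m :: (nat^'n) set)) \<le> n0"
    and D_cont: "J \<in> interior_idx m \<Longrightarrow> continuous_on {a..b} (D J)"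
    and D_bound: "J \<in> interior_idx m \<Longrightarrow> y \<in> {a..b} \<Longrightarrow> norm (D J y *v w) \<le> c * norm w"
    and B_cont: "J \<in> interior_idx m \<Longrightarrow> continuous_on {a..b} (B i J)"
    and B_bound: "J \<in> interior_idx m \<Longrightarrow> y \<in> {a..b} \<Longrightarrow> norm (B i J y *v w) \<le> c * norm w"
    and F_cont: "J \<in> interior_idx m \<Longrightarrow> continuous_on {a..b} f \<Longrightarrow> continuous_on {a..b} (\<lambda>y. F J y (f y))"
    and F'_cont: "J \<in> interior_idx m \<Longrightarrow> continuous_on {a..b} f \<Longrightarrow> continuous_on {a..b} g \<Longrightarrow>
      continuous_on {a..b} (\<lambda>y. F' J y (f y) (g y))"
    and F'_comb: "J \<in> interior_idx m \<Longrightarrow> y \<in> {a..b} \<Longrightarrow> F' J y w (p + k *\<^sub>R q) = F' J y w p + k *\<^sub>R F' J y w q"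
    and F_bound: "J \<in> interior_idx m \<Longrightarrow> y \<in> {a..b} \<Longrightarrow> norm w \<le> \<rho> \<Longrightarrow> norm (F J y w) \<le> C"
    and F'_bound: "J \<in> interior_idx m \<Longrightarrow> y \<in> {a..b} \<Longrightarrow> norm w \<le> \<rho> \<Longrightarrow> norm (F' J y w p) \<le> C * norm p"
    and F'_lipschitz: "J \<in> interior_idx m \<Longrightarrow> y \<in> {a..b} \<Longrightarrow> norm w \<le> \<rho> \<Longrightarrow> norm u \<le> \<rho> \<Longrightarrow>
      norm (F' J y u p - F' J y w p) \<le> C * norm (u - w) * norm p"
    and F_taylor: "J \<in> interior_idx m \<Longrightarrow> y \<in> {a..b} \<Longrightarrow> norm w \<le> \<rho> \<Longrightarrow> norm u \<le> \<rho> \<Longrightarrow>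
      norm (F J y u - F J y w - F' J y w (u - w)) \<le> C * (norm (u - w))\<^sup>2"
begin

abbreviation int :: "(nat^'n) set" where "int \<equiv> interior_idx m"
abbreviation H :: "('n, 'N) sdf set" where "H \<equiv> H1h A m a b"
abbreviation H0 :: "('n, 'N) sdf set" where "H0 \<equiv> H1h0 A m a b"
abbreviation L2sp :: "('n, 'N) sdf set" where "L2sp \<equiv> L2S a b int"
abbreviation nX :: "('n, 'N) sdf \<Rightarrow> real" where "nX \<equiv> H1h_norm A m a b"
abbreviation nY :: "('n, 'N) sdf \<Rightarrow> real" where "nY \<equiv> L2.nrm a b int"
abbreviation ipY :: "('n, 'N) sdf \<Rightarrow> ('n, 'N) sdf \<Rightarrow> real" where "ipY \<equiv> L2ip a b int"
abbreviation ipX :: "('n, 'N) sdf \<Rightarrow> ('n, 'N) sdf \<Rightarrow> real" where "ipX \<equiv> H1h_inner A m a b"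

definition wt :: "('n, 'N) sdf \<Rightarrow> ('n, 'N) sdf" where
  "wt Q J y = exp (lam * y) *\<^sub>R Q J y"
definition Lop :: "('n, 'N) sdf \<Rightarrow> ('n, 'N) sdf" where
  "Lop W J y = D J y *v y_deriv a b W J y + (\<Sum>i\<in>UNIV. B i J y *v x_diff A m i W J y)"
definition N0 :: "('n, 'N) sdf \<Rightarrow> ('n, 'N) sdf" where
  "N0 W J y = F J y (W J y)"
definition N1 :: "('n, 'N) sdf \<Rightarrow> ('n, 'N) sdf \<Rightarrow> ('n, 'N) sdf" where
  "N1 W v J y = F' J y (W J y) (v J y)"
definition N2 :: "('n, 'N) sdf \<Rightarrow> ('n, 'N) sdf \<Rightarrow> ('n, 'N) sdf" where
  "N2 W v J y = F J y (W J y + v J y) - F J y (W J y) - F' J y (W J y) (v J y)"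
definition res :: "('n, 'N) sdf \<Rightarrow> ('n, 'N) sdf" where
  "res W J y = Lop W J y + N0 W J y"
definition lin :: "('n, 'N) sdf \<Rightarrow> ('n, 'N) sdf \<Rightarrow> ('n, 'N) sdf" where
  "lin W v J y = Lop v J y + N1 W v J y"
definition Jf :: "('n, 'N) sdf \<Rightarrow> real" where
  "Jf W = (nY (wt (res W)))\<^sup>2"
definition dJ :: "('n, 'N) sdf \<Rightarrow> ('n, 'N) sdf \<Rightarrow> real" where
  "dJ W v = 2 * ipY (wt (res W)) (wt (lin W v))"

definition ball :: "('n, 'N) sdf set" where
  "ball = {W \<in> H. nX W \<le> R}"

text \<open>\<open>c1\<close> bounds \<open>Lop\<close> from \<open>H1h\<close> to
  \<open>L\<^sub>2\<close>, with one term for \<open>D\<close> and one for each \<open>B i\<close>.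
  \<open>E\<close> bounds the weight. \<open>KR\<close> bounds the unweighted residual on the ball,
  where \<open>n0 * (b - a)\<close> dominates the total length of the grid lines. \<open>KD\<close>
  bounds the weighted linearization. Of these only \<open>E\<close> and \<open>KD\<close> contain
  \<open>lam\<close>.\<close>

definition c1 :: real where "c1 = c * (real CARD('n) + 1)"
definition E :: real where "E = exp (lam * b)"
definition KR :: real where "KR = c1 * R + C * sqrt (n0 * (b - a))"
definition KD :: real where "KD = E * (c1 + C)"

lemma le_ab: "a \<le> b" using ab by simp

sublocale X: semi_inner H ipX
  rewrites "semi_inner.nrm ipX = nX"
proof -
  show "semi_inner H ipX" by (rule semi_inner_H1h[OF le_ab])
  show "semi_inner.nrm ipX = nX" by (simp add: fun_eq_iff H1h_norm_eq_nrm[OF le_ab])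
qed

sublocale X0: semi_inner H0 ipX
  rewrites "semi_inner.nrm ipX = nX"
proof -
  show "semi_inner H0 ipX" by (rule semi_inner_H1h0[OF le_ab])
  show "semi_inner.nrm ipX = nX" by (simp add: fun_eq_iff H1h_norm_eq_nrm[OF le_ab])
qed

lemma sob_pos: "sob a b > 0"
  using ab by (simp add: sob_def add_pos_nonneg)

lemma E_pos: "E > 0" by (simp add: E_def)

lemma c1_pos: "c1 > 0" using c by (simp add: c1_def add_nonneg_pos)

lemma KD_pos: "KD > 0" using E_pos c1_pos C by (simp add: KD_def)

lemma \<rho>_pos: "\<rho> > 0" using \<rho> sob_pos R by (smt (verit) mult_pos_pos)

lemma KR_pos: "KR > 0"
proof -
  have "0 \<le> n0" using n0 by linarith
  then show ?thesis using c1_pos R C ab by (simp add: KR_def add_pos_nonneg)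
qed

lemma wt_in: "Q \<in> L2sp \<Longrightarrow> wt Q \<in> L2sp"
  unfolding L2S_def wt_def[abs_def] by (auto intro!: L2_fun_weight continuous_intros)

lemma wt_le: "Q \<in> L2sp \<Longrightarrow> nY (wt Q) \<le> E * nY Q"
proof (rule L2_nrm_le[OF wt_in])
  fix J :: "nat^'n" and y assume "y \<in> {a..b}"
  then have "exp (lam * y) \<le> E" using lam by (simp add: E_def mult_left_mono)
  then show "norm (wt Q J y) \<le> E * norm (Q J y)" by (simp add: wt_def mult_right_mono)
qed (use E_pos in auto)

lemma wt_ge: "Q \<in> L2sp \<Longrightarrow> exp (lam * a) * nY Q \<le> nY (wt Q)"
proof -
  assume Q: "Q \<in> L2sp"
  have "nY Q \<le> exp (- (lam * a)) * nY (wt Q)"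
  proof (rule L2_nrm_le[OF Q wt_in[OF Q]])
    fix J :: "nat^'n" and y assume "y \<in> {a..b}"
    then have "lam * a \<le> lam * y" using lam by (simp add: mult_left_mono)
    then have "1 \<le> exp (- (lam * a)) * exp (lam * y)" by (simp add: exp_minus_inverse flip: exp_add)
    from mult_right_mono[OF this, of "norm (Q J y)"]
    show "norm (Q J y) \<le> exp (- (lam * a)) * norm (wt Q J y)" by (simp add: wt_def mult.assoc)
  qed simp
  then have "exp (lam * a) * nY Q \<le> exp (lam * a) * (exp (- (lam * a)) * nY (wt Q))"
    by (intro mult_left_mono) auto
  then show ?thesis by (simp add: exp_minus_inverse flip: mult.assoc)
qed

lemma D_in: "W \<in> H \<Longrightarrow> (\<lambda>J y. D J y *v y_deriv a b W J y) \<in> L2sp"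
  unfolding L2S_def by (auto intro!: L2_fun_matrix D_cont D_bound H1h_L2(4))

lemma B_in: "W \<in> H \<Longrightarrow> (\<lambda>J y. B i J y *v x_diff A m i W J y) \<in> L2sp"
  unfolding L2S_def by (auto intro!: L2_fun_matrix B_cont B_bound H1h_L2(3))

lemma Lop_in: "W \<in> H \<Longrightarrow> Lop W \<in> L2sp"
  unfolding Lop_def[abs_def] by (intro L2.S_add D_in L2S_sum B_in)

lemma N_in:
  assumes "W \<in> H" "v \<in> H"
  shows "N0 W \<in> L2sp" "N1 W v \<in> L2sp" "N2 W v \<in> L2sp"
proof -
  have c: "continuous_on {a..b} (W J)" "continuous_on {a..b} (v J)" if "J \<in> int" for J
    using H1h_L2(1)[OF assms(1) that] H1h_L2(1)[OF assms(2) that] by auto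
  show "N0 W \<in> L2sp" "N1 W v \<in> L2sp" "N2 W v \<in> L2sp"
    unfolding L2S_def N0_def[abs_def] N1_def[abs_def] N2_def[abs_def]
    by (auto intro!: L2_fun_continuous continuous_intros F_cont F'_cont c)
qed

lemma res_in: "W \<in> H \<Longrightarrow> res W \<in> L2sp"
  unfolding res_def[abs_def] by (intro L2.S_add Lop_in N_in)

lemma lin_in: "W \<in> H \<Longrightarrow> v \<in> H \<Longrightarrow> lin W v \<in> L2sp"
  unfolding lin_def[abs_def] by (intro L2.S_add Lop_in N_in)

lemma Lop_le:
  assumes W: "W \<in> H"
  shows "nY (Lop W) \<le> c1 * nX W"
proof -
  have "nY (\<lambda>J y. D J y *v y_deriv a b W J y) \<le> c * nY (y_deriv a b W)"
    by (rule L2_nrm_le[OF D_in[OF W] H1h_in_L2S(3)[OF W]]) (use c D_bound in auto)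
  then have 1: "nY (\<lambda>J y. D J y *v y_deriv a b W J y) \<le> c * nX W"
    using L2h_norms_le_H1h_norm(3)[OF le_ab W] c unfolding L2h_norm_eq_nrm
    by (meson less_imp_le mult_left_mono order_trans)
  have 2: "nY (\<lambda>J y. B i J y *v x_diff A m i W J y) \<le> c * nX W" for i
  proof -
    have "nY (\<lambda>J y. B i J y *v x_diff A m i W J y) \<le> c * nY (x_diff A m i W)"
      by (rule L2_nrm_le[OF B_in[OF W] H1h_in_L2S(2)[OF W]]) (use c B_bound in auto)
    then show ?thesis
      using L2h_norms_le_H1h_norm(2)[OF le_ab W] c unfolding L2h_norm_eq_nrm
      by (meson less_imp_le mult_left_mono order_trans)
  qed
  have "nY (Lop W) \<le> nY (\<lambda>J y. D J y *v y_deriv a b W J y) + nY (\<lambda>J y. \<Sum>i\<in>UNIV. B i J y *v x_diff A m i W J y)"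
    unfolding Lop_def[abs_def] by (intro L2.nrm_triangle D_in L2S_sum B_in W)
  also have "nY (\<lambda>J y. \<Sum>i\<in>UNIV. B i J y *v x_diff A m i W J y)
      \<le> (\<Sum>i\<in>(UNIV::'n set). nY (\<lambda>J y. B i J y *v x_diff A m i W J y))"
    by (rule L2_nrm_sum) (auto intro: B_in W)
  also have "\<dots> \<le> real CARD('n) * (c * nX W)"
    by (rule sum_bounded_above) (rule 2)
  finally show ?thesis using 1 by (simp add: c1_def algebra_simps)
qed

lemma nrm_le_nX: "v \<in> H \<Longrightarrow> nY v \<le> nX v"
  using L2h_norms_le_H1h_norm(1)[OF le_ab] unfolding L2h_norm_eq_nrm .

lemma sup_le: "v \<in> H \<Longrightarrow> J \<in> int \<Longrightarrow> y \<in> {a..b} \<Longrightarrow> norm (v J y) \<le> sob a b * nX v"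
  by (rule H1h_sup_bound[OF ab])

lemma ballD:
  assumes "W \<in> ball"
  shows "W \<in> H" "nX W \<le> R" "J \<in> int \<Longrightarrow> y \<in> {a..b} \<Longrightarrow> norm (W J y) \<le> \<rho> - 1"
proof -
  show W: "W \<in> H" "nX W \<le> R" using assms by (auto simp: ball_def)
  show "norm (W J y) \<le> \<rho> - 1" if "J \<in> int" "y \<in> {a..b}"
    using sup_le[OF W(1) that] mult_left_mono[OF W(2), of "sob a b"] sob_pos \<rho> by linarith
qed

lemma res_le:
  assumes W: "W \<in> ball"
  shows "nY (res W) \<le> KR"
proof -
  note H = ballD(1)[OF W]
  have "(nY (N0 W))\<^sup>2 \<le> (C * sqrt (real (card int) * (b - a)))\<^sup>2"
  proof -
    have N: "N0 W \<in> L2sp" using N_in(1)[OF H H] .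
    have "(nY (N0 W))\<^sup>2 = (\<Sum>J\<in>int. integral {a..b} (\<lambda>y. (norm (N0 W J y))\<^sup>2))"
      unfolding L2.nrm_square[OF N] L2ip_def by (simp add: power2_norm_eq_inner)
    also have "\<dots> \<le> (\<Sum>J\<in>int. integral {a..b} (\<lambda>y. C\<^sup>2))"
    proof (intro sum_mono integral_le)
      fix J y assume J: "J \<in> int" and y: "y \<in> {a..b}"
      have "norm (F J y (W J y)) \<le> C" using ballD(3)[OF W J y] by (intro F_bound J y) auto
      then show "(norm (N0 W J y))\<^sup>2 \<le> C\<^sup>2" unfolding N0_def by (intro power_mono) auto
    qed (use N in \<open>auto simp: L2S_def intro: L2_fun_square_integrable\<close>)
    also have "\<dots> = (C * sqrt (real (card int) * (b - a)))\<^sup>2"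
      using ab by (simp add: power_mult_distrib)
    finally show ?thesis .
  qed
  then have "nY (N0 W) \<le> C * sqrt (real (card int) * (b - a))"
    by (rule power2_le_imp_le) (use C ab in simp)
  moreover have "C * sqrt (real (card int) * (b - a)) \<le> C * sqrt (n0 * (b - a))"
    using C n0 ab by (intro mult_left_mono real_sqrt_le_mono mult_right_mono) auto
  moreover have "nY (Lop W) \<le> c1 * R"
    using Lop_le[OF H] mult_left_mono[OF ballD(2)[OF W], of c1] c1_pos by linarith
  ultimately show ?thesis
    using L2.nrm_triangle[OF Lop_in[OF H] N_in(1)[OF H H]] unfolding res_def[abs_def] KR_def by linarith
qed

lemma lin_le:
  assumes W: "W \<in> ball" and v: "v \<in> H"
  shows "nY (wt (lin W v)) \<le> KD * nX v"
proof -
  note H = ballD(1)[OF W]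
  have "nY (N1 W v) \<le> C * nY v"
  proof (rule L2_nrm_le[OF N_in(2)[OF H v] H1h_in_L2S(1)[OF v]])
    fix J y assume J: "J \<in> int" and y: "y \<in> {a..b}"
    show "norm (N1 W v J y) \<le> C * norm (v J y)"
      unfolding N1_def using ballD(3)[OF W J y] by (intro F'_bound J y) auto
  qed (use C in auto)
  also have "\<dots> \<le> C * nX v" using C by (intro mult_left_mono nrm_le_nX v) auto
  finally have "nY (lin W v) \<le> (c1 + C) * nX v"
    using L2.nrm_triangle[OF Lop_in[OF v] N_in(2)[OF H v]] Lop_le[OF v]
    unfolding lin_def[abs_def] by (simp add: algebra_simps)
  then have "E * nY (lin W v) \<le> E * ((c1 + C) * nX v)" using E_pos by (intro mult_left_mono) auto
  then show ?thesis using wt_le[OF lin_in[OF H v]] by (simp add: KD_def mult.assoc)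
qed

text \<open>The linear bound follows from the quadratic one because
  \<open>norm (v J y) \<le> 2 * \<rho>\<close>. The quadratic bound serves where the remainder
  stands alone against the residual, the linear one where it is squared.\<close>

lemma N2_pointwise:
  assumes "norm (W J y) \<le> \<rho>" "norm (W J y + v J y) \<le> \<rho>" "J \<in> int" "y \<in> {a..b}"
  shows "norm (N2 W v J y) \<le> C * (norm (v J y))\<^sup>2" "norm (N2 W v J y) \<le> 2 * \<rho> * C * norm (v J y)"
proof -
  show 1: "norm (N2 W v J y) \<le> C * (norm (v J y))\<^sup>2"
    unfolding N2_def using F_taylor[OF assms(3,4,1,2)] by simp
  have "norm (v J y) \<le> 2 * \<rho>"
    using norm_triangle_ineq4[of "W J y + v J y" "W J y"] assms(1,2) by simp
  then have "C * (norm (v J y) * norm (v J y)) \<le> C * (2 * \<rho> * norm (v J y))"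
    using C by (intro mult_left_mono mult_right_mono) auto
  then show "norm (N2 W v J y) \<le> 2 * \<rho> * C * norm (v J y)"
    using 1 by (simp add: power2_eq_square mult_ac)
qed

lemma N2_le:
  assumes W: "W \<in> ball" and v: "v \<in> H"
    and Wv: "\<And>J y. J \<in> int \<Longrightarrow> y \<in> {a..b} \<Longrightarrow> norm (W J y + v J y) \<le> \<rho>"
  shows "nY (wt (N2 W v)) \<le> E * C * sob a b * (nX v)\<^sup>2" "nY (wt (N2 W v)) \<le> E * (2 * \<rho> * C) * nX v"
proof -
  note H = ballD(1)[OF W]
  note N = N_in(3)[OF H v]
  note V = H1h_in_L2S(1)[OF v]
  have pt: "norm (N2 W v J y) \<le> C * (norm (v J y))\<^sup>2" "norm (N2 W v J y) \<le> 2 * \<rho> * C * norm (v J y)"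
    if J: "J \<in> int" and y: "y \<in> {a..b}" for J y
    using N2_pointwise[of W J y v, OF _ Wv[OF that] that] ballD(3)[OF W that] by auto
  have "nY (N2 W v) \<le> (C * sob a b * nX v) * nY v"
  proof (rule L2_nrm_le[OF N V])
    show "0 \<le> C * sob a b * nX v" using C sob_pos X.nrm_nonneg[OF v] by simp
    fix J y assume J: "J \<in> int" and y: "y \<in> {a..b}"
    have "C * (norm (v J y))\<^sup>2 \<le> C * (sob a b * nX v) * norm (v J y)"
      using C mult_right_mono[OF sup_le[OF v J y], of "norm (v J y)"] by (simp add: power2_eq_square mult.assoc)
    then show "norm (N2 W v J y) \<le> C * sob a b * nX v * norm (v J y)" using pt(1)[OF J y] by simp
  qed
  also have "\<dots> \<le> (C * sob a b * nX v) * nX v"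
    using C sob_pos X.nrm_nonneg[OF v] by (intro mult_left_mono nrm_le_nX v) auto
  finally have "nY (N2 W v) \<le> C * sob a b * (nX v)\<^sup>2" by (simp add: power2_eq_square)
  then have "E * nY (N2 W v) \<le> E * (C * sob a b * (nX v)\<^sup>2)" using E_pos by (intro mult_left_mono) auto
  then show "nY (wt (N2 W v)) \<le> E * C * sob a b * (nX v)\<^sup>2"
    using wt_le[OF N] by (simp add: mult.assoc)
  have "nY (N2 W v) \<le> 2 * \<rho> * C * nY v"
    by (rule L2_nrm_le[OF N V]) (use pt(2) C \<rho>_pos in auto)
  also have "\<dots> \<le> 2 * \<rho> * C * nX v" using C \<rho>_pos by (intro mult_left_mono nrm_le_nX v) auto
  finally have "E * nY (N2 W v) \<le> E * (2 * \<rho> * C * nX v)" using E_pos by (intro mult_left_mono) auto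
  then show "nY (wt (N2 W v)) \<le> E * (2 * \<rho> * C) * nX v"
    using wt_le[OF N] by (simp add: mult.assoc)
qed

lemma Lop_comb_ae:
  assumes W: "W \<in> H" and v: "v \<in> H" and J: "J \<in> int"
  shows "\<exists>N. negligible N \<and> (\<forall>y\<in>{a..b} - N. Lop (\<lambda>J y. W J y + k *\<^sub>R v J y) J y = Lop W J y + k *\<^sub>R Lop v J y)"
proof -
  from y_deriv_comb_ae[OF W v J le_ab, of k] obtain N where N: "negligible N" "\<forall>y\<in>{a..b} - N.
      y_deriv a b (\<lambda>J y. W J y + k *\<^sub>R v J y) J y = y_deriv a b W J y + k *\<^sub>R y_deriv a b v J y"
    by (elim exE conjE)
  have "\<forall>y\<in>{a..b} - N. Lop (\<lambda>J y. W J y + k *\<^sub>R v J y) J y = Lop W J y + k *\<^sub>R Lop v J y"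
  proof
    fix y assume y: "y \<in> {a..b} - N"
    show "Lop (\<lambda>J y. W J y + k *\<^sub>R v J y) J y = Lop W J y + k *\<^sub>R Lop v J y"
      unfolding Lop_def bspec[OF N(2) y] x_diff_comb
      by (simp add: matrix_vector_right_distrib matrix_vector_mult_scaleR sum.distrib scaleR_sum_right scaleR_add_right)
  qed
  with N(1) show ?thesis by (intro exI conjI)
qed

lemma res_add_ae:
  assumes W: "W \<in> H" and v: "v \<in> H" and J: "J \<in> int"
  shows "\<exists>N. negligible N \<and> (\<forall>y\<in>{a..b} - N. wt (res (\<lambda>J y. W J y + v J y)) J y
     = wt (res W) J y + (wt (lin W v) J y + wt (N2 W v) J y))"
proof -
  from Lop_comb_ae[OF W v J, of 1, unfolded scaleR_one] obtain N where N: "negligible N"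
    "\<forall>y\<in>{a..b} - N. Lop (\<lambda>J y. W J y + v J y) J y = Lop W J y + Lop v J y"
    by (elim exE conjE)
  have "\<forall>y\<in>{a..b} - N. wt (res (\<lambda>J y. W J y + v J y)) J y = wt (res W) J y + (wt (lin W v) J y + wt (N2 W v) J y)"
  proof
    fix y assume y: "y \<in> {a..b} - N"
    show "wt (res (\<lambda>J y. W J y + v J y)) J y = wt (res W) J y + (wt (lin W v) J y + wt (N2 W v) J y)"
      unfolding wt_def res_def lin_def bspec[OF N(2) y] N0_def N1_def N2_def by (simp add: algebra_simps)
  qed
  with N(1) show ?thesis by (intro exI conjI)
qed

lemma lin_comb_ae:
  assumes W: "W \<in> H" and u: "u \<in> H" and v: "v \<in> H" and J: "J \<in> int"
  shows "\<exists>N. negligible N \<and> (\<forall>y\<in>{a..b} - N. wt (lin W (\<lambda>J y. u J y + k *\<^sub>R v J y)) J y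
     = wt (lin W u) J y + k *\<^sub>R wt (lin W v) J y)"
proof -
  from Lop_comb_ae[OF u v J, of k] obtain N where N: "negligible N"
    "\<forall>y\<in>{a..b} - N. Lop (\<lambda>J y. u J y + k *\<^sub>R v J y) J y = Lop u J y + k *\<^sub>R Lop v J y"
    by (elim exE conjE)
  have "\<forall>y\<in>{a..b} - N. wt (lin W (\<lambda>J y. u J y + k *\<^sub>R v J y)) J y = wt (lin W u) J y + k *\<^sub>R wt (lin W v) J y"
  proof
    fix y assume y: "y \<in> {a..b} - N"
    then have F': "F' J y (W J y) (u J y + k *\<^sub>R v J y) = F' J y (W J y) (u J y) + k *\<^sub>R F' J y (W J y) (v J y)"
      by (intro F'_comb[OF J]) auto
    show "wt (lin W (\<lambda>J y. u J y + k *\<^sub>R v J y)) J y = wt (lin W u) J y + k *\<^sub>R wt (lin W v) J y"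
      unfolding wt_def lin_def bspec[OF N(2) y] N1_def F' by (simp add: algebra_simps)
  qed
  with N(1) show ?thesis by (intro exI conjI)
qed

text \<open>The square of \<open>p + (q + r)\<close> with residual \<open>p\<close>, linearization
  \<open>q\<close> and Taylor remainder \<open>r\<close>; \<open>dJ\<close> is the mixed term of
  \<open>p\<close> and \<open>q\<close>. The identity is exact and serves both differentiability and
  convexity.\<close>

lemma J_expansion:
  assumes W: "W \<in> H" and v: "v \<in> H"
  shows "Jf (\<lambda>J y. W J y + v J y) - Jf W - dJ W v
    = 2 * ipY (wt (res W)) (wt (N2 W v)) + (nY (\<lambda>J y. wt (lin W v) J y + wt (N2 W v) J y))\<^sup>2"
proof -
  let ?p = "wt (res W)" and ?q = "wt (lin W v)" and ?r = "wt (N2 W v)"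
  have in': "?p \<in> L2sp" "?q \<in> L2sp" "?r \<in> L2sp"
    by (intro wt_in res_in lin_in N_in W v)+
  have "nY (wt (res (\<lambda>J y. W J y + v J y))) = nY (\<lambda>J y. ?p J y + (?q J y + ?r J y))"
    by (rule L2_nrm_cong_ae) (rule res_add_ae[OF W v])
  then have "Jf (\<lambda>J y. W J y + v J y) = (nY ?p)\<^sup>2 + 2 * ipY ?p (\<lambda>J y. ?q J y + ?r J y) + (nY (\<lambda>J y. ?q J y + ?r J y))\<^sup>2"
    using L2.nrm_square_add[OF in'(1) L2.S_add[OF in'(2,3)]] by (simp add: Jf_def)
  then show ?thesis
    using L2.ip_add_right[OF in'(2,3,1)] by (simp add: Jf_def dJ_def)
qed

lemma J_remainder:
  assumes W: "W \<in> ball" and v: "v \<in> H"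
    and Wv: "\<And>J y. J \<in> int \<Longrightarrow> y \<in> {a..b} \<Longrightarrow> norm (W J y + v J y) \<le> \<rho>"
  shows "\<bar>Jf (\<lambda>J y. W J y + v J y) - Jf W - dJ W v\<bar>
     \<le> (2 * (E * KR) * (E * C * sob a b) + (KD + E * (2 * \<rho> * C))\<^sup>2) * (nX v)\<^sup>2"
proof -
  note H = ballD(1)[OF W]
  let ?p = "wt (res W)" and ?q = "wt (lin W v)" and ?r = "wt (N2 W v)"
  have in': "?p \<in> L2sp" "?q \<in> L2sp" "?r \<in> L2sp"
    by (intro wt_in res_in lin_in N_in H v)+
  have p: "nY ?p \<le> E * KR"
    using wt_le[OF res_in[OF H]] mult_left_mono[OF res_le[OF W], of E] E_pos by linarith
  have "\<bar>ipY ?p ?r\<bar> \<le> nY ?p * nY ?r" by (rule L2.cauchy_schwarz[OF in'(1,3)])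
  also have "\<dots> \<le> (E * KR) * (E * C * sob a b * (nX v)\<^sup>2)"
    using E_pos KR_pos by (intro mult_mono p N2_le(1)[OF W v Wv] L2.nrm_nonneg in') auto
  finally have 1: "\<bar>2 * ipY ?p ?r\<bar> \<le> 2 * (E * KR) * (E * C * sob a b) * (nX v)\<^sup>2" by simp
  have "nY (\<lambda>J y. ?q J y + ?r J y) \<le> nY ?q + nY ?r" by (rule L2.nrm_triangle[OF in'(2,3)])
  also have "\<dots> \<le> (KD + E * (2 * \<rho> * C)) * nX v"
    unfolding distrib_right by (intro add_mono lin_le[OF W v] N2_le(2)[OF W v Wv])
  finally have "(nY (\<lambda>J y. ?q J y + ?r J y))\<^sup>2 \<le> ((KD + E * (2 * \<rho> * C)) * nX v)\<^sup>2"
    by (intro power_mono L2.nrm_nonneg L2.S_add in')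
  then have 2: "(nY (\<lambda>J y. ?q J y + ?r J y))\<^sup>2 \<le> (KD + E * (2 * \<rho> * C))\<^sup>2 * (nX v)\<^sup>2"
    unfolding power_mult_distrib .
  show ?thesis
    unfolding J_expansion[OF H v] distrib_right[of _ _ "(nX v)\<^sup>2"]
    using 1 2 zero_le_power2[of "nY (\<lambda>J y. ?q J y + ?r J y)"] by linarith
qed

lemma dJ_comb:
  assumes W: "W \<in> H" and u: "u \<in> H" and v: "v \<in> H"
  shows "dJ W (\<lambda>J y. u J y + k *\<^sub>R v J y) = dJ W u + k * dJ W v"
proof -
  have "ipY (wt (res W)) (wt (lin W (\<lambda>J y. u J y + k *\<^sub>R v J y)))
      = ipY (\<lambda>J y. wt (lin W u) J y + k *\<^sub>R wt (lin W v) J y) (wt (res W))"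
    unfolding L2ip_commute[of a b int "wt (res W)"] by (rule L2ip_cong_ae) (rule lin_comb_ae[OF W u v])
  also have "\<dots> = ipY (wt (lin W u)) (wt (res W)) + k * ipY (wt (lin W v)) (wt (res W))"
    by (intro L2.ip_comb wt_in lin_in res_in W u v)
  finally show ?thesis
    by (simp add: dJ_def L2ip_commute[of a b int _ "wt (res W)"] algebra_simps)
qed

lemma dJ_bound:
  assumes W: "W \<in> ball" and v: "v \<in> H"
  shows "\<bar>dJ W v\<bar> \<le> 2 * (E * KR) * KD * nX v"
proof -
  note H = ballD(1)[OF W]
  have p: "nY (wt (res W)) \<le> E * KR"
    using wt_le[OF res_in[OF H]] mult_left_mono[OF res_le[OF W], of E] E_pos by linarith
  have "\<bar>ipY (wt (res W)) (wt (lin W v))\<bar> \<le> nY (wt (res W)) * nY (wt (lin W v))"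
    by (intro L2.cauchy_schwarz wt_in res_in lin_in H v)
  also have "\<dots> \<le> (E * KR) * (KD * nX v)"
    using E_pos KR_pos by (intro mult_mono p lin_le[OF W v] L2.nrm_nonneg wt_in lin_in H v) auto
  finally show ?thesis by (simp add: dJ_def)
qed

text \<open>\<open>dJ W\<close> is linear and bounded on \<open>H1h0\<close>, so the Riesz theorem
  represents it; the quadratic remainder makes the representative a gradient.\<close>

lemma gradient_exists:
  assumes W: "W \<in> ball"
  shows "\<exists>g\<in>H0. (\<forall>v\<in>H0. ipX g v = dJ W v) \<and> has_gradient A m a b Jf W g"
proof -
  have "\<exists>g\<in>H0. \<forall>v\<in>H0. ipX g v = dJ W v"
  proof (rule X0.riesz)
    show "\<exists>l\<in>H0. (\<lambda>i. nX (\<lambda>k y. s i k y - l k y)) \<longlonglongrightarrow> 0"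
      if "\<And>i. s i \<in> H0" "\<And>e. e > 0 \<Longrightarrow> \<exists>M::nat. \<forall>i\<ge>M. \<forall>j\<ge>M. nX (\<lambda>k y. s i k y - s j k y) < e" for s
      by (rule H1h0_complete[OF ab step that])
    show "dJ W (\<lambda>j y. u j y + k *\<^sub>R v j y) = dJ W u + k * dJ W v" if "u \<in> H0" "v \<in> H0" for u v k
      by (intro dJ_comb ballD(1)[OF W] H1h0_D(1) that)
    show "\<bar>dJ W u\<bar> \<le> 2 * (E * KR) * KD * nX u" if "u \<in> H0" for u
      by (rule dJ_bound[OF W H1h0_D(1)[OF that]])
  qed
  then obtain g where g: "g \<in> H0" "\<forall>v\<in>H0. ipX g v = dJ W v" by blast
  have "has_gradient A m a b Jf W g"
    unfolding has_gradient_def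
  proof (intro conjI allI impI)
    fix \<epsilon> :: real assume \<epsilon>: "\<epsilon> > 0"
    define K where "K = 2 * (E * KR) * (E * C * sob a b) + (KD + E * (2 * \<rho> * C))\<^sup>2"
    have K: "K \<ge> 0" unfolding K_def using E_pos KR_pos C sob_pos by simp
    \<comment> \<open>The first bound gives \<open>norm (v J y) \<le> 1\<close>, the margin built
      into \<open>\<rho>\<close>; the second makes the quadratic remainder at most
      \<open>\<epsilon> * nX v\<close>.\<close>
    define \<delta> where "\<delta> = min (1 / sob a b) (\<epsilon> / (K + 1))"
    have \<delta>: "\<delta> > 0" using sob_pos \<epsilon> K by (simp add: \<delta>_def)
    have "\<bar>Jf (\<lambda>J y. W J y + v J y) - Jf W - ipX g v\<bar> \<le> \<epsilon> * nX v" if v: "v \<in> H0" and s: "nX v < \<delta>" for v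
    proof -
      have vH: "v \<in> H" by (rule H1h0_D(1)[OF v])
      have n0: "nX v \<ge> 0" by (rule X.nrm_nonneg[OF vH])
      have "norm (W J y + v J y) \<le> \<rho>" if "J \<in> int" "y \<in> {a..b}" for J y
      proof -
        have "sob a b * nX v \<le> 1" using s sob_pos by (simp add: \<delta>_def field_simps)
        then show ?thesis
          using norm_triangle_ineq[of "W J y" "v J y"] ballD(3)[OF W that] sup_le[OF vH that] by linarith
      qed
      then have "\<bar>Jf (\<lambda>J y. W J y + v J y) - Jf W - dJ W v\<bar> \<le> K * (nX v)\<^sup>2"
        unfolding K_def by (rule J_remainder[OF W vH])
      also have "\<dots> = (K * nX v) * nX v" by (simp add: power2_eq_square)
      also have "\<dots> \<le> \<epsilon> * nX v"
      proof (rule mult_right_mono[OF _ n0])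
        have "K * nX v \<le> (K + 1) * nX v" using n0 by (intro mult_right_mono) auto
        also have "\<dots> \<le> (K + 1) * (\<epsilon> / (K + 1))" using s K by (intro mult_left_mono) (auto simp: \<delta>_def)
        also have "\<dots> = \<epsilon>" using K by simp
        finally show "K * nX v \<le> \<epsilon>" .
      qed
      finally show ?thesis using g(2) v by simp
    qed
    with \<delta> show "\<exists>\<delta>>0. \<forall>v\<in>H0. nX v < \<delta> \<longrightarrow> \<bar>Jf (\<lambda>J y. W J y + v J y) - Jf W - ipX g v\<bar> \<le> \<epsilon> * nX v"
      by blast
  qed (rule g(1))
  with g show ?thesis by blast
qed

lemma gradient_ex1: "W \<in> ball \<Longrightarrow> \<exists>!g. has_gradient A m a b Jf W g"
  using gradient_exists has_gradient_unique[OF ab] by blast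

lemma gradient_props:
  assumes W: "W \<in> ball"
  shows "gradient A m a b Jf W \<in> H0" "v \<in> H0 \<Longrightarrow> ipX (gradient A m a b Jf W) v = dJ W v"
proof -
  obtain g where g: "g \<in> H0" "\<forall>v\<in>H0. ipX g v = dJ W v" "has_gradient A m a b Jf W g"
    using gradient_exists[OF W] by blast
  have "gradient A m a b Jf W = g"
    unfolding gradient_def by (rule the_equality[of "\<lambda>g. has_gradient A m a b Jf W g", OF g(3)]) (rule has_gradient_unique[OF ab _ g(3)])
  then show "gradient A m a b Jf W \<in> H0" "v \<in> H0 \<Longrightarrow> ipX (gradient A m a b Jf W) v = dJ W v"
    using g by auto
qed

text \<open>The first summand accounts for the change of the residual, the second for the change of
  the linearization, as split in \<open>gradient_lipschitz\<close>.\<close>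

definition K4 :: real where
  "K4 = 2 * ((KD + E * (2 * \<rho> * C)) * KD + E * KR * (E * C * sob a b))"

lemma K4_pos: "K4 > 0"
  unfolding K4_def using KD_pos E_pos C \<rho>_pos KR_pos sob_pos by (intro mult_pos_pos add_pos_pos) auto

text \<open>For \<open>w\<close>, the difference of the gradients, the squared norm of
  \<open>w\<close> is \<open>dJ V w - dJ W w\<close>. This difference of two inner products is split
  as usual for products; each part is at most a constant times \<open>nX u * nX w\<close>, and one
  factor \<open>nX w\<close> cancels.\<close>

lemma gradient_lipschitz:
  assumes W: "W \<in> ball" and V: "V \<in> ball" and u: "(\<lambda>J y. V J y - W J y) \<in> H0"
  shows "nX (\<lambda>J y. gradient A m a b Jf V J y - gradient A m a b Jf W J y) \<le> K4 * nX (\<lambda>J y. V J y - W J y)"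
proof -
  note HW = ballD(1)[OF W] and HV = ballD(1)[OF V]
  define u where "u = (\<lambda>J y. V J y - W J y)"
  have uH: "u \<in> H" using H1h0_D(1)[OF assms(3)] by (simp add: u_def)
  have VW: "V = (\<lambda>J y. W J y + u J y)" by (simp add: u_def)
  define w where "w = (\<lambda>J y. gradient A m a b Jf V J y - gradient A m a b Jf W J y)"
  note gs = gradient_props(1)[OF V] gradient_props(1)[OF W]
  have w0: "w \<in> H0" unfolding w_def by (rule X0.S_diff[OF gs])
  then have w: "w \<in> H" by (rule H1h0_D(1))
  let ?pV = "wt (res V)" and ?pW = "wt (res W)" and ?qV = "wt (lin V w)" and ?qW = "wt (lin W w)"
  have in': "?pV \<in> L2sp" "?pW \<in> L2sp" "?qV \<in> L2sp" "?qW \<in> L2sp"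
    by (intro wt_in res_in lin_in HV HW w)+
  have "(nX w)\<^sup>2 = dJ V w - dJ W w"
    unfolding X.nrm_square[OF w] using X0.ip_diff[OF gs w0] gradient_props(2)[OF V w0] gradient_props(2)[OF W w0]
    by (simp add: w_def)
  also have "\<dots> = 2 * (ipY (\<lambda>J y. ?pV J y - ?pW J y) ?qV + ipY ?pW (\<lambda>J y. ?qV J y - ?qW J y))"
    unfolding dJ_def L2.ip_diff[OF in'(1,2,3)] L2.ip_diff_right[OF in'(3,4,2)] by simp
  also have "\<dots> \<le> 2 * (((KD + E * (2 * \<rho> * C)) * nX u) * (KD * nX w) + (E * KR) * (E * C * sob a b * nX u * nX w))"
  proof (intro mult_left_mono add_mono)
    have n0: "0 \<le> nX u" "0 \<le> nX w" by (intro X.nrm_nonneg uH w)+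
    have "nY (\<lambda>J y. ?pV J y - ?pW J y) = nY (\<lambda>J y. wt (lin W u) J y + wt (N2 W u) J y)"
    proof (rule L2_nrm_cong_ae)
      fix J assume "J \<in> int"
      from res_add_ae[OF HW uH this, folded VW] obtain N where "negligible N" "\<forall>y\<in>{a..b} - N.
        wt (res V) J y = wt (res W) J y + (wt (lin W u) J y + wt (N2 W u) J y)" by (elim exE conjE)
      then show "\<exists>N. negligible N \<and> (\<forall>y\<in>{a..b} - N. ?pV J y - ?pW J y = wt (lin W u) J y + wt (N2 W u) J y)"
        by (intro exI[of _ N]) auto
    qed
    also have "\<dots> \<le> nY (wt (lin W u)) + nY (wt (N2 W u))"
      by (intro L2.nrm_triangle wt_in lin_in N_in HW uH)
    also have "\<dots> \<le> (KD + E * (2 * \<rho> * C)) * nX u"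
      unfolding distrib_right
    proof (intro add_mono lin_le[OF W uH] N2_le(2)[OF W uH])
      show "norm (W J y + u J y) \<le> \<rho>" if "J \<in> int" "y \<in> {a..b}" for J y
        using ballD(3)[OF V that] by (simp add: u_def)
    qed
    finally have 1: "nY (\<lambda>J y. ?pV J y - ?pW J y) \<le> (KD + E * (2 * \<rho> * C)) * nX u" .
    have "ipY (\<lambda>J y. ?pV J y - ?pW J y) ?qV \<le> nY (\<lambda>J y. ?pV J y - ?pW J y) * nY ?qV"
      using L2.cauchy_schwarz[OF L2.S_diff[OF in'(1,2)] in'(3)] by simp
    also have "\<dots> \<le> ((KD + E * (2 * \<rho> * C)) * nX u) * (KD * nX w)"
      using KD_pos E_pos \<rho>_pos C n0 by (intro mult_mono 1 lin_le[OF V w] L2.nrm_nonneg in') auto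
    finally show "ipY (\<lambda>J y. ?pV J y - ?pW J y) ?qV \<le> ((KD + E * (2 * \<rho> * C)) * nX u) * (KD * nX w)" .
    have "nY (\<lambda>J y. ?qV J y - ?qW J y) \<le> (E * C * sob a b * nX u) * nY w"
    proof (rule L2_nrm_le[OF L2.S_diff[OF in'(3,4)] H1h_in_L2S(1)[OF w]])
      show "0 \<le> E * C * sob a b * nX u" using E_pos C sob_pos n0 by simp
      fix J y assume J: "J \<in> int" and y: "y \<in> {a..b}"
      have "norm (N1 V w J y - N1 W w J y) \<le> C * norm (u J y) * norm (w J y)"
        unfolding N1_def u_def using ballD(3)[OF V J y] ballD(3)[OF W J y] by (intro F'_lipschitz J y) auto
      also have "\<dots> \<le> C * (sob a b * nX u) * norm (w J y)"
        using C by (intro mult_right_mono mult_left_mono sup_le uH J y) auto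
      finally have "exp (lam * y) * norm (N1 V w J y - N1 W w J y) \<le> E * (C * (sob a b * nX u) * norm (w J y))"
        using y lam E_pos by (intro mult_mono) (auto simp: E_def mult_left_mono)
      \<comment> \<open>The terms \<open>Lop w\<close> cancel, so that only the Lipschitz bound of
        \<open>F'\<close> is at work.\<close>
      moreover have "?qV J y - ?qW J y = exp (lam * y) *\<^sub>R (N1 V w J y - N1 W w J y)"
        by (simp add: wt_def lin_def algebra_simps)
      ultimately show "norm (?qV J y - ?qW J y) \<le> E * C * sob a b * nX u * norm (w J y)" by (simp add: mult.assoc)
    qed
    also have "\<dots> \<le> E * C * sob a b * nX u * nX w"
      using E_pos C sob_pos n0 by (intro mult_left_mono nrm_le_nX w) auto
    finally have 2: "nY (\<lambda>J y. ?qV J y - ?qW J y) \<le> E * C * sob a b * nX u * nX w" .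
    have p: "nY ?pW \<le> E * KR"
      using wt_le[OF res_in[OF HW]] mult_left_mono[OF res_le[OF W], of E] E_pos by linarith
    have "ipY ?pW (\<lambda>J y. ?qV J y - ?qW J y) \<le> nY ?pW * nY (\<lambda>J y. ?qV J y - ?qW J y)"
      using L2.cauchy_schwarz[OF in'(2) L2.S_diff[OF in'(3,4)]] by simp
    also have "\<dots> \<le> (E * KR) * (E * C * sob a b * nX u * nX w)"
      using E_pos KR_pos by (intro mult_mono p 2 L2.nrm_nonneg L2.S_diff in') auto
    finally show "ipY ?pW (\<lambda>J y. ?qV J y - ?qW J y) \<le> (E * KR) * (E * C * sob a b * nX u * nX w)" .
  qed simp
  also have "\<dots> = (K4 * nX u) * nX w" by (simp add: K4_def algebra_simps)
  finally have "nX w * nX w \<le> (K4 * nX u) * nX w" by (simp add: power2_eq_square)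
  moreover have "0 \<le> K4 * nX u" using K4_pos X.nrm_nonneg[OF uH] by simp
  ultimately have "nX w \<le> K4 * nX u"
    using X.nrm_nonneg[OF w] by (cases "nX w = 0") auto
  then show ?thesis by (simp add: w_def u_def)
qed

end

section \<open>Strict convexity and the minimizer\<close>

context functional
begin

text \<open>The integral runs from \<open>y\<close> to \<open>b\<close> because the squared
  reciprocal of the weight decays: its integral to the right of \<open>y\<close> is at most
  \<open>exp (- (2 * lam * y))\<close>, which exactly compensates the weight at \<open>y\<close>.
  Starting at \<open>a\<close> would recover only the weight at \<open>a\<close>.\<close>

lemma weighted_sup:
  assumes lam1: "lam \<ge> 1" and v: "v \<in> H0" and J: "J \<in> int" and y: "y \<in> {a..b}"
  shows "exp (lam * y) * norm (v J y) \<le> nY (wt (y_deriv a b v))"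
proof -
  note H = H1h0_D(1)[OF v]
  note d = y_deriv_H1_deriv[OF H J]
  let ?g = "y_deriv a b v J"
  have L: "L2_fun a b ?g" using d by (rule H1_deriv_L2)
  have wL: "L2_fun a b (\<lambda>t. exp (lam * t) *\<^sub>R ?g t)"
    by (rule L2_fun_weight[OF _ L]) (intro continuous_intros)
  have "v J b = v J y + integral {y..b} ?g"
    using H1_deriv_diff_eq[OF d, of y b] y by simp
  then have "norm (v J y) = norm (integral {y..b} ?g)"
    using H1h0_D(4)[OF v le_ab, of J] by (simp add: eq_neg_iff_add_eq_0[symmetric])
  also have "\<dots> \<le> sqrt (integral {y..b} (\<lambda>t. (1 / exp (lam * t))\<^sup>2)) * L2n a b (\<lambda>t. exp (lam * t) *\<^sub>R ?g t)"
    by (rule norm_integral_weight_le[OF L]) (use y in \<open>auto intro!: continuous_intros\<close>)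
  also have "\<dots> \<le> exp (- (lam * y)) * nY (wt (y_deriv a b v))"
  proof (rule mult_mono)
    have "((\<lambda>t. (1 / exp (lam * t))\<^sup>2) has_integral
        (- exp (- (2 * lam * b)) / (2 * lam) - - exp (- (2 * lam * y)) / (2 * lam))) {y..b}"
    proof (rule fundamental_theorem_of_calculus)
      show "((\<lambda>t. - exp (- (2 * lam * t)) / (2 * lam)) has_vector_derivative (1 / exp (lam * t))\<^sup>2) (at t within {y..b})" for t
      proof -
        have "((\<lambda>t. - exp (- (2 * lam * t)) / (2 * lam)) has_real_derivative exp (- (2 * lam * t))) (at t within {y..b})"
          using lam1 by (auto intro!: derivative_eq_intros simp: field_simps)
        moreover have "exp (- (2 * lam * t)) = (1 / exp (lam * t))\<^sup>2"
          by (simp add: power2_eq_square exp_minus inverse_eq_divide flip: exp_add)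
        ultimately show ?thesis by (simp add: has_real_derivative_iff_has_vector_derivative)
      qed
    qed (use y in auto)
    then have "integral {y..b} (\<lambda>t. (1 / exp (lam * t))\<^sup>2)
        = - exp (- (2 * lam * b)) / (2 * lam) - - exp (- (2 * lam * y)) / (2 * lam)" by (rule integral_unique)
    also have "\<dots> \<le> exp (- (2 * lam * y)) / (2 * lam)" using lam1 by simp
    also have "\<dots> \<le> exp (- (2 * lam * y)) / 1" using lam1 by (intro divide_left_mono) auto
    also have "\<dots> = (exp (- (lam * y)))\<^sup>2" by (simp add: power2_eq_square flip: exp_add)
    finally show "sqrt (integral {y..b} (\<lambda>t. (1 / exp (lam * t))\<^sup>2)) \<le> exp (- (lam * y))"
      by (rule real_le_lsqrt[rotated -1]) auto
    have "L2n a b (wt (y_deriv a b v) J) \<le> nY (wt (y_deriv a b v))"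
      using L2n_le_L2h_norm[OF wt_in[OF H1h_in_L2S(3)[OF H]] J] unfolding L2h_norm_eq_nrm .
    then show "L2n a b (\<lambda>t. exp (lam * t) *\<^sub>R ?g t) \<le> nY (wt (y_deriv a b v))"
      by (simp add: wt_def[abs_def])
  qed (use L2n_nonneg[OF wL] in auto)
  finally have "exp (lam * y) * norm (v J y) \<le> exp (lam * y) * (exp (- (lam * y)) * nY (wt (y_deriv a b v)))"
    by (intro mult_left_mono) auto
  then show ?thesis by (simp add: exp_minus_inverse flip: mult.assoc)
qed

text \<open>A Lipschitz constant of \<open>F\<close> on the ball of radius \<open>\<rho>\<close>,
  the sum of the bounds for \<open>N1\<close> and \<open>N2\<close>.\<close>

definition Cq :: real where "Cq = C + 2 * \<rho> * C"

lemma Cq_pos: "Cq > 0" using C \<rho>_pos by (simp add: Cq_def add_pos_pos)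

text \<open>With \<open>S\<close> the bracket in the Carleman bound, half of that bound,
  \<open>C1 / 2 * S\<close>, survives the separation of \<open>Lop v\<close> from the increment of
  \<open>F\<close>. The losses are at most \<open>Cq\<^sup>2 * S / lam\<close> and
  \<open>KR * C * S / lam\<close>, and the threshold on \<open>lam\<close> makes their sum at most
  \<open>C1 / 4 * S\<close>. Neither \<open>Cq\<close> nor \<open>KR\<close> contains
  \<open>lam\<close>, so the threshold is not circular.\<close>

lemma lower_bound:
  assumes lam1: "lam \<ge> 1" and v: "v \<in> H0" and W: "W \<in> ball" and V: "(\<lambda>J y. W J y + v J y) \<in> ball"
    and C1: "C1 > 0" "4 * (Cq\<^sup>2 + KR * C) / C1 \<le> lam"
    and carl: "C1 * ((nY (wt (y_deriv a b v)))\<^sup>2 + lam\<^sup>2 * (nY (wt v))\<^sup>2) \<le> (nY (wt (Lop v)))\<^sup>2"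
  shows "C1 / 4 * ((nY (wt (y_deriv a b v)))\<^sup>2 + lam\<^sup>2 * (nY (wt v))\<^sup>2)
    \<le> Jf (\<lambda>J y. W J y + v J y) - Jf W - dJ W v"
proof -
  note H = ballD(1)[OF W]
  note vH = H1h0_D(1)[OF v]
  define Y where "Y = nY (wt (y_deriv a b v))"
  define X where "X = lam * nY (wt v)"
  define S where "S = Y\<^sup>2 + X\<^sup>2"
  \<comment> \<open>The full increment \<open>F (W + v) - F W\<close>, linear part and remainder
    together.\<close>
  define q where "q = (\<lambda>J y. N1 W v J y + N2 W v J y)"
  have Wb: "norm (W J y) \<le> \<rho>" "norm (W J y + v J y) \<le> \<rho>" if "J \<in> int" "y \<in> {a..b}" for J y
    using ballD(3)[OF W that] ballD(3)[OF V that] by auto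
  have wv: "wt v \<in> L2sp" by (rule wt_in[OF H1h_in_L2S(1)[OF vH]])
  have X0: "X \<ge> 0" and Y0: "Y \<ge> 0"
    using lam L2.nrm_nonneg[OF wv] L2.nrm_nonneg[OF wt_in[OF H1h_in_L2S(3)[OF vH]]] by (auto simp: X_def Y_def)
  have Xlam: "nY (wt v) = X / lam" using lam1 by (simp add: X_def)
  have q: "q \<in> L2sp" unfolding q_def by (intro L2.S_add N_in H vH)
  have qle: "nY (wt q) \<le> Cq * (X / lam)"
  proof -
    have "nY (wt q) \<le> Cq * nY (wt v)"
    proof (rule L2_nrm_le[OF wt_in[OF q] wv])
      fix J y assume J: "J \<in> int" and y: "y \<in> {a..b}"
      have "norm (N1 W v J y) \<le> C * norm (v J y)"
        unfolding N1_def by (rule F'_bound[OF J y Wb(1)[OF J y]])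
      then have "norm (q J y) \<le> Cq * norm (v J y)"
        using N2_pointwise(2)[of W J y v, OF Wb[OF J y] J y] norm_triangle_ineq[of "N1 W v J y" "N2 W v J y"]
        unfolding q_def Cq_def distrib_right by linarith
      then have "exp (lam * y) * norm (q J y) \<le> exp (lam * y) * (Cq * norm (v J y))" by (intro mult_left_mono) auto
      then show "norm (wt q J y) \<le> Cq * norm (wt v J y)" by (simp add: wt_def mult_ac)
    qed (use Cq_pos in simp)
    then show ?thesis by (simp add: Xlam)
  qed
  have p: "wt (Lop v) \<in> L2sp" by (intro wt_in Lop_in vH)
  have split: "(\<lambda>J y. wt (lin W v) J y + wt (N2 W v) J y) = (\<lambda>J y. wt (Lop v) J y + wt q J y)"
    by (simp add: fun_eq_iff wt_def lin_def q_def algebra_simps)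
  \<comment> \<open>An instance of \<open>|p + q|^2 \<ge> |p|^2 / 2 - |q|^2\<close>.\<close>
  have half: "(nY (wt (Lop v)))\<^sup>2 / 2 - (Cq * (X / lam))\<^sup>2 \<le> (nY (\<lambda>J y. wt (lin W v) J y + wt (N2 W v) J y))\<^sup>2"
  proof -
    have "\<bar>ipY (wt (Lop v)) (wt q)\<bar> \<le> nY (wt (Lop v)) * nY (wt q)"
      by (rule L2.cauchy_schwarz[OF p wt_in[OF q]])
    moreover have "2 * (nY (wt (Lop v)) * nY (wt q)) \<le> (nY (wt (Lop v)))\<^sup>2 / 2 + 2 * (nY (wt q))\<^sup>2"
      using zero_le_power2[of "nY (wt (Lop v)) - 2 * nY (wt q)"] by (simp add: power2_eq_square algebra_simps)
    moreover have "(nY (wt q))\<^sup>2 \<le> (Cq * (X / lam))\<^sup>2"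
      by (intro power_mono qle L2.nrm_nonneg wt_in q)
    ultimately show ?thesis
      unfolding split L2.nrm_square_add[OF p wt_in[OF q]] by linarith
  qed
  have cross: "\<bar>2 * ipY (wt (res W)) (wt (N2 W v))\<bar> \<le> KR * C * (S / lam)"
  proof -
    have N2: "N2 W v \<in> L2sp" by (rule N_in(3)[OF H vH])
    \<comment> \<open>Both weights are moved to the remainder: the residual has a bound free of
      \<open>lam\<close> only in the unweighted norm, while the remainder is quadratic in
      \<open>v\<close> and takes one weight for each factor.\<close>
    have eq: "ipY (wt (res W)) (wt (N2 W v)) = ipY (res W) (wt (wt (N2 W v)))"
      unfolding L2ip_def wt_def by (simp add: mult.assoc)
    have "\<bar>ipY (res W) (wt (wt (N2 W v)))\<bar> \<le> nY (res W) * nY (wt (wt (N2 W v)))"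
      by (intro L2.cauchy_schwarz res_in wt_in N2 H)
    also have "\<dots> \<le> KR * (C * Y * nY (wt v))"
    proof (rule mult_mono[OF res_le[OF W]])
      show "nY (wt (wt (N2 W v))) \<le> C * Y * nY (wt v)"
      proof (rule L2_nrm_le[OF wt_in[OF wt_in[OF N2]] wv])
        fix J y assume J: "J \<in> int" and y: "y \<in> {a..b}"
        have "norm (wt (wt (N2 W v)) J y) = exp (lam * y) * (exp (lam * y) * norm (N2 W v J y))"
          by (simp add: wt_def)
        also have "\<dots> \<le> exp (lam * y) * (exp (lam * y) * (C * (norm (v J y))\<^sup>2))"
          by (intro mult_left_mono N2_pointwise(1) Wb J y) auto
        also have "\<dots> = C * (exp (lam * y) * norm (v J y)) * norm (wt v J y)"
          by (simp add: wt_def power2_eq_square)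
        also have "\<dots> \<le> C * Y * norm (wt v J y)"
          unfolding Y_def using C by (intro mult_right_mono mult_left_mono weighted_sup[OF lam1 v J y]) auto
        finally show "norm (wt (wt (N2 W v)) J y) \<le> C * Y * norm (wt v J y)" .
      qed (use C Y0 in simp)
    qed (use KR_pos L2.nrm_nonneg[OF wt_in[OF wt_in[OF N2]]] in auto)
    finally have "\<bar>2 * ipY (wt (res W)) (wt (N2 W v))\<bar> \<le> 2 * (KR * (C * Y * (X / lam)))"
      unfolding eq by (simp add: Xlam)
    also have "\<dots> = KR * C / lam * (2 * Y * X)" by simp
    also have "\<dots> \<le> KR * C / lam * S"
      unfolding S_def using KR_pos C lam1 by (intro mult_left_mono sum_squares_bound) auto
    finally show ?thesis by simp
  qed
  have Cq': "(Cq * (X / lam))\<^sup>2 \<le> Cq\<^sup>2 * (S / lam)"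
  proof -
    have "X\<^sup>2 / lam\<^sup>2 \<le> S / lam"
      using lam1 by (intro frac_le) (auto simp: S_def power2_eq_square)
    from mult_left_mono[OF this, of "Cq\<^sup>2"] show ?thesis by (simp add: power_mult_distrib power_divide)
  qed
  have "(Cq\<^sup>2 + KR * C) * (S / lam) \<le> C1 / 4 * S"
  proof -
    have "(Cq\<^sup>2 + KR * C) / lam \<le> C1 / 4" using C1 lam1 by (simp add: field_simps)
    from mult_right_mono[OF this, of S] show ?thesis by (simp add: S_def)
  qed
  moreover have "C1 * S \<le> (nY (wt (Lop v)))\<^sup>2"
    using carl by (simp add: S_def X_def Y_def power_mult_distrib)
  ultimately have "C1 / 4 * S \<le> Jf (\<lambda>J y. W J y + v J y) - Jf W - dJ W v"
    unfolding J_expansion[OF H vH] using half cross Cq' unfolding distrib_right by linarith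
  then show ?thesis by (simp add: S_def X_def Y_def power_mult_distrib)
qed

text \<open>\<open>exp (2 * lam * a)\<close> is the least value of the squared weight;
  \<open>CARD('n)\<close> and \<open>1 + 1 / h\<^sup>2\<close> come from \<open>H1h0_norm_le\<close>
  with the step replaced by its lower bound \<open>h\<close>. The resulting factor of the
  exponential contains neither \<open>R\<close> nor \<open>lam\<close>.\<close>

lemma strict_convexity:
  assumes lam1: "lam \<ge> 1" and v: "v \<in> H0" and W: "W \<in> ball" and V: "(\<lambda>J y. W J y + v J y) \<in> ball"
    and C1: "C1 > 0" "4 * (Cq\<^sup>2 + KR * C) / C1 \<le> lam"
    and carl: "C1 * ((nY (wt (y_deriv a b v)))\<^sup>2 + lam\<^sup>2 * (nY (wt v))\<^sup>2) \<le> (nY (wt (Lop v)))\<^sup>2"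
    and h: "h > 0" "h \<le> step A m"
  shows "C1 / (4 * (real CARD('n) * (1 + 1 / h\<^sup>2))) * exp (2 * lam * a) * (nX v)\<^sup>2
    \<le> Jf (\<lambda>J y. W J y + v J y) - Jf W - dJ W v"
proof -
  note vH = H1h0_D(1)[OF v]
  define M where "M = real CARD('n) * (1 + 1 / h\<^sup>2)"
  have M: "M > 0" unfolding M_def using h by (intro mult_pos_pos add_pos_nonneg) auto
  have ge: "exp (2 * lam * a) * (nY Q)\<^sup>2 \<le> (nY (wt Q))\<^sup>2" if Q: "Q \<in> L2sp" for Q
  proof -
    have "(exp (lam * a) * nY Q)\<^sup>2 \<le> (nY (wt Q))\<^sup>2"
      by (intro power_mono wt_ge Q mult_nonneg_nonneg L2.nrm_nonneg) auto
    then show ?thesis by (simp add: power_mult_distrib exp_double[symmetric] mult.assoc)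
  qed
  have "(nX v)\<^sup>2 \<le> real CARD('n) * ((1 + 1 / (step A m)\<^sup>2) * (nY v)\<^sup>2 + (nY (y_deriv a b v))\<^sup>2)"
    using H1h0_norm_le[OF le_ab v step] unfolding L2h_norm_eq_nrm .
  also have "\<dots> \<le> real CARD('n) * ((1 + 1 / h\<^sup>2) * (nY v)\<^sup>2 + (1 + 1 / h\<^sup>2) * (nY (y_deriv a b v))\<^sup>2)"
  proof (intro mult_left_mono add_mono mult_right_mono)
    show "1 / (step A m)\<^sup>2 \<le> 1 / h\<^sup>2" using h by (intro divide_left_mono power_mono mult_pos_pos zero_less_power) auto
    have "1 * (nY (y_deriv a b v))\<^sup>2 \<le> (1 + 1 / h\<^sup>2) * (nY (y_deriv a b v))\<^sup>2"
      by (intro mult_right_mono) auto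
    then show "(nY (y_deriv a b v))\<^sup>2 \<le> (1 + 1 / h\<^sup>2) * (nY (y_deriv a b v))\<^sup>2" by simp
  qed auto
  also have "\<dots> = M * ((nY (y_deriv a b v))\<^sup>2 + (nY v)\<^sup>2)" by (simp add: M_def algebra_simps)
  finally have "exp (2 * lam * a) * (nX v)\<^sup>2 \<le> exp (2 * lam * a) * (M * ((nY (y_deriv a b v))\<^sup>2 + (nY v)\<^sup>2))"
    by (intro mult_left_mono) auto
  also have "\<dots> = M * (exp (2 * lam * a) * (nY (y_deriv a b v))\<^sup>2 + exp (2 * lam * a) * (nY v)\<^sup>2)"
    by (simp add: algebra_simps)
  also have "\<dots> \<le> M * ((nY (wt (y_deriv a b v)))\<^sup>2 + lam\<^sup>2 * (nY (wt v))\<^sup>2)"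
  proof (intro mult_left_mono add_mono ge H1h_in_L2S(3)[OF vH])
    have "exp (2 * lam * a) * (nY v)\<^sup>2 \<le> 1 * (nY (wt v))\<^sup>2"
      using ge[OF H1h_in_L2S(1)[OF vH]] by simp
    also have "\<dots> \<le> lam\<^sup>2 * (nY (wt v))\<^sup>2" using lam1 by (intro mult_right_mono one_le_power) auto
    finally show "exp (2 * lam * a) * (nY v)\<^sup>2 \<le> lam\<^sup>2 * (nY (wt v))\<^sup>2" .
  qed (use M in simp)
  finally have "C1 / (4 * M) * (exp (2 * lam * a) * (nX v)\<^sup>2)
      \<le> C1 / (4 * M) * (M * ((nY (wt (y_deriv a b v)))\<^sup>2 + lam\<^sup>2 * (nY (wt v))\<^sup>2))"
    using C1(1) M by (intro mult_left_mono) auto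
  also have "\<dots> = C1 / 4 * ((nY (wt (y_deriv a b v)))\<^sup>2 + lam\<^sup>2 * (nY (wt v))\<^sup>2)" using M by simp
  also have "\<dots> \<le> Jf (\<lambda>J y. W J y + v J y) - Jf W - dJ W v"
    by (rule lower_bound[OF lam1 v W V C1 carl])
  finally show ?thesis by (simp add: M_def mult.assoc)
qed

text \<open>An explicit form of the closed ball with prescribed boundary values, convenient for
  convexity and limits; \<open>Bset_eq_closure\<close> relates it to
  \<open>B_closure\<close>.\<close>

definition Bset :: "('n, 'N) sdf \<Rightarrow> ('n, 'N) sdf set" where
  "Bset P = {W \<in> H. boundary_eq m a b W P \<and> nX W \<le> R}"

lemma BsetD:
  assumes "W \<in> Bset P"
  shows "W \<in> ball" "W \<in> H" "boundary_eq m a b W P" "nX W \<le> R"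
  using assms by (auto simp: Bset_def ball_def)

lemma Bset_diff: "V \<in> Bset P \<Longrightarrow> W \<in> Bset P \<Longrightarrow> (\<lambda>J y. V J y - W J y) \<in> H0"
  by (rule H1h0_diff) (auto simp: Bset_def)

lemma Bset_segment:
  assumes V: "V \<in> Bset P" and W: "W \<in> Bset P" and t: "0 \<le> t" "t \<le> 1"
  shows "(\<lambda>J y. W J y + t *\<^sub>R (V J y - W J y)) \<in> Bset P"
proof -
  let ?v = "\<lambda>J y. t *\<^sub>R (V J y - W J y)"
  have v: "?v \<in> H0" by (rule X0.S_scale[OF Bset_diff[OF V W]])
  have eq: "(\<lambda>J y. W J y + ?v J y) = (\<lambda>J y. (1 - t) *\<^sub>R W J y + t *\<^sub>R V J y)"
    by (simp add: fun_eq_iff algebra_simps)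
  have s: "(\<lambda>J y. (1 - t) *\<^sub>R W J y) \<in> H" "(\<lambda>J y. t *\<^sub>R V J y) \<in> H"
    by (intro X.S_scale BsetD(2)[OF W] BsetD(2)[OF V])+
  have "nX (\<lambda>J y. W J y + ?v J y) \<le> (1 - t) * nX W + t * nX V"
    unfolding eq using X.nrm_triangle[OF s] X.nrm_scale[OF BsetD(2)[OF W], of "1 - t"] X.nrm_scale[OF BsetD(2)[OF V], of t] t
    by simp
  also have "\<dots> \<le> (1 - t) * R + t * R"
    using t BsetD(4)[OF W] BsetD(4)[OF V] by (intro add_mono mult_left_mono) auto
  also have "\<dots> = R" by (simp add: algebra_simps)
  finally show ?thesis
    using H1h0_add[OF BsetD(2,3)[OF W] v] by (simp add: Bset_def)
qed

text \<open>Completeness is available for \<open>H1h0\<close>, so a limit is written as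
  \<open>s 0\<close> plus an increment with zero boundary values.\<close>

lemma Bset_closed:
  assumes s: "\<And>i. s i \<in> Bset P" and v: "v \<in> H0" and lim: "(\<lambda>i. nX (\<lambda>J y. s i J y - (s 0 J y + v J y))) \<longlonglongrightarrow> 0"
  shows "(\<lambda>J y. s 0 J y + v J y) \<in> Bset P"
proof -
  let ?l = "\<lambda>J y. s 0 J y + v J y"
  note l = H1h0_add[OF BsetD(2,3)[OF s[of 0]] v]
  have "nX ?l - R \<le> nX (\<lambda>J y. s i J y - ?l J y)" for i
    using X.nrm_triangle_diff[OF BsetD(2)[OF s[of i]] l(1)] BsetD(4)[OF s[of i]] by linarith
  then have "nX ?l - R \<le> 0" by (intro LIMSEQ_le_const[OF lim]) auto
  then show ?thesis using l by (simp add: Bset_def)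
qed

text \<open>A point of norm exactly \<open>R\<close> is approximated by moving it slightly towards a
  point \<open>U\<close> of norm less than \<open>R\<close>, which the nonemptiness of
  \<open>B_set\<close> supplies; the ball alone would not suffice, since the boundary values must be
  kept.\<close>

lemma Bset_eq_closure:
  assumes ne: "B_set A m a b R P \<noteq> {}"
  shows "B_closure A m a b R P = Bset P"
proof
  obtain U where U: "U \<in> H" "boundary_eq m a b U P" "nX U < R"
    using ne by (auto simp: B_set_def)
  show "B_closure A m a b R P \<subseteq> Bset P"
  proof
    fix W assume W: "W \<in> B_closure A m a b R P"
    then have WH: "W \<in> H" "boundary_eq m a b W P" by (auto simp: B_closure_def)
    have "nX W \<le> R + e" if e: "e > 0" for e
    proof -
      obtain V where V: "V \<in> B_set A m a b R P" "nX (\<lambda>J y. W J y - V J y) < e"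
        using W e unfolding B_closure_def by blast
      then have "V \<in> H" "nX V < R" by (auto simp: B_set_def)
      then show ?thesis using X.nrm_triangle_diff[OF WH(1), of V] V(2) by linarith
    qed
    then have "nX W \<le> R" by (rule field_le_epsilon)
    then show "W \<in> Bset P" using WH by (simp add: Bset_def)
  qed
  show "Bset P \<subseteq> B_closure A m a b R P"
  proof
    fix W assume W: "W \<in> Bset P"
    note WH = BsetD(2,3)[OF W]
    have U': "U \<in> Bset P" using U by (simp add: Bset_def)
    let ?d = "\<lambda>J y. U J y - W J y"
    have dH: "?d \<in> H" by (rule X.S_diff[OF U(1) WH(1)])
    have "\<exists>V\<in>B_set A m a b R P. nX (\<lambda>J y. W J y - V J y) < e" if e: "e > 0" for e
    proof -
      define t where "t = min 1 (e / 2 / (nX ?d + 1))"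
      have d0: "nX ?d \<ge> 0" by (rule X.nrm_nonneg[OF dH])
      have t: "0 < t" "t \<le> 1" using e d0 by (auto simp: t_def)
      let ?V = "\<lambda>J y. W J y + t *\<^sub>R (U J y - W J y)"
      have V: "?V \<in> Bset P" by (rule Bset_segment[OF U' W]) (use t in auto)
      have s: "(\<lambda>J y. (1 - t) *\<^sub>R W J y) \<in> H" "(\<lambda>J y. t *\<^sub>R U J y) \<in> H"
        by (intro X.S_scale WH(1) U(1))+
      have eq: "?V = (\<lambda>J y. (1 - t) *\<^sub>R W J y + t *\<^sub>R U J y)"
        by (simp add: fun_eq_iff algebra_simps)
      have "nX ?V \<le> (1 - t) * nX W + t * nX U"
        unfolding eq using X.nrm_triangle[OF s] X.nrm_scale[OF WH(1), of "1 - t"] X.nrm_scale[OF U(1), of t] t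
        by simp
      also have "\<dots> < (1 - t) * R + t * R"
        using t BsetD(4)[OF W] U(3) by (intro add_le_less_mono mult_left_mono mult_strict_left_mono) auto
      also have "\<dots> = R" by (simp add: algebra_simps)
      finally have VB: "?V \<in> B_set A m a b R P" using BsetD(2,3)[OF V] by (simp add: B_set_def)
      have "nX (\<lambda>J y. W J y - ?V J y) = t * nX ?d"
        using X.nrm_scale[OF dH, of "-t"] t by simp
      also have "\<dots> \<le> t * (nX ?d + 1)" using t by simp
      also have "\<dots> \<le> (e / 2 / (nX ?d + 1)) * (nX ?d + 1)"
        using d0 by (intro mult_right_mono) (auto simp: t_def)
      also have "\<dots> < e" using d0 e by (subst times_divide_eq_left, subst nonzero_mult_div_cancel_right) auto
      finally show ?thesis using VB by (rule bexI)
    qed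
    then show "W \<in> B_closure A m a b R P" using WH by (simp add: B_closure_def)
  qed
qed

text \<open>Existence is \<open>midpoint_convex_minimizer\<close> together with
  \<open>H1h0_complete\<close>. Uniqueness combines strong convexity with the variational
  inequality, which is therefore proved first.\<close>

lemma minimizer:
  assumes ne: "Bset P \<noteq> {}" and k: "k > 0"
    and conv: "\<And>W V. W \<in> Bset P \<Longrightarrow> V \<in> Bset P \<Longrightarrow>
      k * (nX (\<lambda>J y. V J y - W J y))\<^sup>2 \<le> Jf V - Jf W - dJ W (\<lambda>J y. V J y - W J y)"
  shows "\<exists>!W. is_arg_min Jf (\<lambda>W. W \<in> Bset P) W"
    and "is_arg_min Jf (\<lambda>W. W \<in> Bset P) W \<Longrightarrow> V \<in> Bset P \<Longrightarrow> 0 \<le> dJ W (\<lambda>J y. V J y - W J y)"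
proof -
  define K where "K = 2 * (E * KR) * (E * C * sob a b) + (KD + E * (2 * \<rho> * C))\<^sup>2"
  have K0: "K \<ge> 0" unfolding K_def using E_pos KR_pos C sob_pos by simp
  have rem: "\<bar>Jf V - Jf W - dJ W (\<lambda>J y. V J y - W J y)\<bar> \<le> K * (nX (\<lambda>J y. V J y - W J y))\<^sup>2"
    if W: "W \<in> Bset P" and V: "V \<in> Bset P" for W V
  proof -
    have "norm (W J y + (V J y - W J y)) \<le> \<rho>" if "J \<in> int" "y \<in> {a..b}" for J y
      using ballD(3)[OF BsetD(1)[OF V] that] by simp
    from J_remainder[OF BsetD(1)[OF W] H1h0_D(1)[OF Bset_diff[OF V W]] this]
    show ?thesis unfolding K_def by simp
  qed
  show vi: "0 \<le> dJ W (\<lambda>J y. V J y - W J y)"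
    if min: "is_arg_min Jf (\<lambda>W. W \<in> Bset P) W" and V: "V \<in> Bset P" for W V
  proof (rule ccontr)
    assume neg: "\<not> 0 \<le> dJ W (\<lambda>J y. V J y - W J y)"
    have W: "W \<in> Bset P" using min by (simp add: is_arg_min_def)
    let ?v = "\<lambda>J y. V J y - W J y"
    define \<tau> where "\<tau> = dJ W ?v"
    define n where "n = K * (nX ?v)\<^sup>2 + 1"
    have n: "n > 0" using K0 by (simp add: n_def add_nonneg_pos)
    have \<tau>: "\<tau> < 0" using neg by (simp add: \<tau>_def)
    \<comment> \<open>Along the segment the functional changes by at most \<open>t * \<tau>\<close>
      plus \<open>t\<^sup>2\<close> times the quadratic bound; this \<open>t\<close> keeps the
      second part below half of the linear decrease.\<close>
    define t where "t = min 1 (- \<tau> / (2 * n))"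
    have t: "0 < t" "t \<le> 1" using \<tau> n by (auto simp: t_def divide_neg_pos)
    have tn: "t * n \<le> - \<tau> / 2"
    proof -
      have "t * n \<le> (- \<tau> / (2 * n)) * n" using n by (intro mult_right_mono) (auto simp: t_def)
      also have "\<dots> = - \<tau> / 2" using n by simp
      finally show ?thesis .
    qed
    let ?U = "\<lambda>J y. W J y + t *\<^sub>R (V J y - W J y)"
    have U: "?U \<in> Bset P" by (rule Bset_segment[OF V W]) (use t in auto)
    have vH: "?v \<in> H" by (rule H1h0_D(1)[OF Bset_diff[OF V W]])
    \<comment> \<open>The instance of \<open>dJ_comb\<close> with two zero functions shows that
      \<open>dJ W\<close> vanishes at zero.\<close>
    have e1: "dJ W (\<lambda>J y. ?U J y - W J y) = t * \<tau>"
      using dJ_comb[OF BsetD(2)[OF W] X.S_zero vH, of t] dJ_comb[OF BsetD(2)[OF W] X.S_zero X.S_zero, of 1]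
      by (simp add: \<tau>_def)
    have e2: "nX (\<lambda>J y. ?U J y - W J y) = t * nX ?v"
      using X.nrm_scale[OF vH, of t] t by simp
    have "Jf ?U - Jf W \<le> t * \<tau> + K * (t * nX ?v)\<^sup>2"
      using rem[OF W U] unfolding e1 e2 by linarith
    also have "\<dots> = t * \<tau> + t * (t * (K * (nX ?v)\<^sup>2))" by (simp add: power2_eq_square)
    also have "\<dots> \<le> t * \<tau> + t * (t * n)"
      using t by (intro add_left_mono mult_left_mono) (auto simp: n_def)
    also have "\<dots> \<le> t * \<tau> + t * (- \<tau> / 2)"
      using t tn by (intro add_left_mono mult_left_mono) auto
    also have "\<dots> = t * (\<tau> / 2)" by (simp add: field_simps)
    also have "\<dots> < 0" using t \<tau> by (simp add: mult_pos_neg)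
    finally show False using min U by (auto simp: is_arg_min_def)
  qed
  have "\<exists>u\<in>Bset P. \<forall>v\<in>Bset P. Jf u \<le> Jf v"
  proof (rule midpoint_convex_minimizer[where B = 0 and c = "k / 4"
        and mid = "\<lambda>u v. (\<lambda>j y. u j y + (1/2) *\<^sub>R (v j y - u j y))" and ds = "\<lambda>u v. nX (\<lambda>j y. u j y - v j y)"])
    show "0 \<le> Jf u" for u by (simp add: Jf_def)
    show "(\<lambda>j y. u j y + (1/2) *\<^sub>R (v j y - u j y)) \<in> Bset P" if "u \<in> Bset P" "v \<in> Bset P" for u v
      by (rule Bset_segment[OF that(2,1)]) auto
    show "Jf (\<lambda>j y. u j y + (1/2) *\<^sub>R (v j y - u j y)) + k / 4 * (nX (\<lambda>j y. u j y - v j y))\<^sup>2 \<le> (Jf u + Jf v) / 2"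
      if u: "u \<in> Bset P" and v: "v \<in> Bset P" for u v
    proof -
      let ?M = "\<lambda>j y. u j y + (1/2) *\<^sub>R (v j y - u j y)"
      let ?w = "\<lambda>j y. u j y - v j y"
      have M: "?M \<in> Bset P" by (rule Bset_segment[OF v u]) auto
      have w: "?w \<in> H" by (rule H1h0_D(1)[OF Bset_diff[OF u v]])
      have uM: "(\<lambda>j y. u j y - ?M j y) = (\<lambda>j y. (1/2) *\<^sub>R ?w j y)"
      proof (intro ext)
        fix j y
        have "u j y = (1/2) *\<^sub>R u j y + (1/2) *\<^sub>R u j y" by (simp flip: scaleR_left_distrib)
        then show "u j y - ?M j y = (1/2) *\<^sub>R ?w j y" by (simp add: scaleR_diff_right)
      qed
      have vM: "(\<lambda>j y. v j y - ?M j y) = (\<lambda>j y. (-1/2) *\<^sub>R ?w j y)"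
      proof (intro ext)
        fix j y
        have "v j y = (1/2) *\<^sub>R v j y + (1/2) *\<^sub>R v j y" by (simp flip: scaleR_left_distrib)
        moreover have "(-1/2) *\<^sub>R ?w j y = - ((1/2) *\<^sub>R ?w j y)" by simp
        ultimately show "v j y - ?M j y = (-1/2) *\<^sub>R ?w j y"
          using fun_cong[OF fun_cong[OF uM, of j], of y] by (simp add: scaleR_diff_right algebra_simps)
      qed
      have d: "dJ ?M (\<lambda>j y. c *\<^sub>R ?w j y) = c * dJ ?M ?w" for c
        using dJ_comb[OF BsetD(2)[OF M] X.S_zero w, of c] dJ_comb[OF BsetD(2)[OF M] X.S_zero X.S_zero, of 1] by simp
      have nw: "nX (\<lambda>j y. c *\<^sub>R ?w j y) = \<bar>c\<bar> * nX ?w" for c by (rule X.nrm_scale[OF w])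
      \<comment> \<open>Strong convexity at the midpoint, towards \<open>u\<close> and towards
        \<open>v\<close>: the derivative terms are opposite and cancel in the sum, and each half
        distance contributes \<open>k / 4\<close>.\<close>
      have 1: "k * (\<bar>1/2\<bar> * nX ?w)\<^sup>2 \<le> Jf u - Jf ?M - (1/2) * dJ ?M ?w"
        using conv[OF M u] unfolding uM nw d .
      have 2: "k * (\<bar>-1/2\<bar> * nX ?w)\<^sup>2 \<le> Jf v - Jf ?M - (-1/2) * dJ ?M ?w"
        using conv[OF M v] unfolding vM nw d .
      show ?thesis using 1 2 by (simp add: power_mult_distrib power2_eq_square)
    qed
    show "\<exists>l\<in>Bset P. (\<lambda>i. nX (\<lambda>j y. s i j y - l j y)) \<longlonglongrightarrow> 0"
      if s: "\<And>i. s i \<in> Bset P" and cauchy: "\<And>e. e > 0 \<Longrightarrow> \<exists>M::nat. \<forall>i\<ge>M. \<forall>j\<ge>M. nX (\<lambda>k y. s i k y - s j k y) < e" for s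
    proof -
      let ?d = "\<lambda>i J y. s i J y - s 0 J y"
      have "\<exists>v\<in>H0. (\<lambda>i. nX (\<lambda>J y. ?d i J y - v J y)) \<longlonglongrightarrow> 0"
        by (rule H1h0_complete[OF ab step Bset_diff[OF s s]]) (use cauchy in simp)
      then obtain v where v: "v \<in> H0" "(\<lambda>i. nX (\<lambda>J y. s i J y - (s 0 J y + v J y))) \<longlonglongrightarrow> 0"
        by (auto simp: diff_diff_eq)
      from v(2) Bset_closed[OF s v] show ?thesis by (rule bexI)
    qed
    show "(\<lambda>i. Jf (s i)) \<longlonglongrightarrow> Jf l"
      if s: "\<And>i. s i \<in> Bset P" and l: "l \<in> Bset P" and lim: "(\<lambda>i. nX (\<lambda>j y. s i j y - l j y)) \<longlonglongrightarrow> 0" for s l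
    proof -
      define L where "L = 2 * (E * KR) * KD"
      let ?n = "\<lambda>i. nX (\<lambda>j y. s i j y - l j y)"
      have "(\<lambda>i. K * (?n i)\<^sup>2 + L * ?n i) \<longlonglongrightarrow> K * 0\<^sup>2 + L * 0"
        by (intro tendsto_intros lim)
      then have lim': "(\<lambda>i. K * (?n i)\<^sup>2 + L * ?n i) \<longlonglongrightarrow> 0" by simp
      have "norm (Jf (s i) - Jf l) \<le> K * (?n i)\<^sup>2 + L * ?n i" for i
        using rem[OF l s[of i]] dJ_bound[OF BsetD(1)[OF l] H1h0_D(1)[OF Bset_diff[OF s[of i] l]]]
        unfolding L_def real_norm_def by linarith
      then have "(\<lambda>i. Jf (s i) - Jf l) \<longlonglongrightarrow> 0"
        by (intro Lim_null_comparison[OF _ lim'] always_eventually) blast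
      then show ?thesis by (simp add: LIM_zero_iff)
    qed
  qed (use ne k in auto)
  then obtain u where u: "u \<in> Bset P" "\<And>v. v \<in> Bset P \<Longrightarrow> Jf u \<le> Jf v" by blast
  show "\<exists>!W. is_arg_min Jf (\<lambda>W. W \<in> Bset P) W"
  proof (rule ex1I)
    show min: "is_arg_min Jf (\<lambda>W. W \<in> Bset P) u" using u by (auto simp: is_arg_min_def not_less)
    fix W assume W: "is_arg_min Jf (\<lambda>W. W \<in> Bset P) W"
    then have WB: "W \<in> Bset P" and le: "Jf W \<le> Jf u" using u(1) by (auto simp: is_arg_min_def not_less)
    let ?w = "\<lambda>J y. W J y - u J y"
    have "k * (nX ?w)\<^sup>2 \<le> 0" using conv[OF u(1) WB] vi[OF min WB] le by linarith
    then have "nX ?w = 0" using k by (simp add: mult_le_0_iff)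
    then have "?w = (\<lambda>J y. 0)" by (rule H1h0_norm_zero[OF ab Bset_diff[OF WB u(1)]])
    then show "W = u" by (simp add: fun_eq_iff)
  qed
qed

end

text \<open>\<open>Q\<close> need not be measurable: a non-integrable \<open>|Q|\<^sup>2\<close> has integral \<open>0\<close>. So nothing has to be known about
  the measurability of the inverse matrices in the Carleman estimate.\<close>
lemma L2h_norm_le:
  fixes Q V :: "('n::finite, 'N::finite) sdf"
  assumes V: "V \<in> L2S a b (interior_idx m)" and k: "k \<ge> 0"
    and le: "\<And>J y. J \<in> interior_idx m \<Longrightarrow> y \<in> {a..b} \<Longrightarrow> norm (Q J y) \<le> k * norm (V J y)"
  shows "(L2h_norm m a b Q)\<^sup>2 \<le> k\<^sup>2 * (L2h_norm m a b V)\<^sup>2"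
proof -
  have nn: "0 \<le> integral {a..b} (\<lambda>y. (norm (U y))\<^sup>2)" for U :: "real \<Rightarrow> real^'N"
    by (cases "(\<lambda>y. (norm (U y))\<^sup>2) integrable_on {a..b}") (auto simp: integral_nonneg not_integrable_integral)
  have "integral {a..b} (\<lambda>y. (norm (Q J y))\<^sup>2) \<le> k\<^sup>2 * integral {a..b} (\<lambda>y. (norm (V J y))\<^sup>2)"
    if J: "J \<in> interior_idx m" for J
  proof (cases "(\<lambda>y. (norm (Q J y))\<^sup>2) integrable_on {a..b}")
    case True
    have "(\<lambda>y. k\<^sup>2 * (norm (V J y))\<^sup>2) integrable_on {a..b}"
      using V J by (intro integrable_on_mult_right L2_fun_square_integrable) (auto simp: L2S_def)
    with True have "integral {a..b} (\<lambda>y. (norm (Q J y))\<^sup>2) \<le> integral {a..b} (\<lambda>y. k\<^sup>2 * (norm (V J y))\<^sup>2)"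
      by (rule integral_le) (use power_mono[OF le[OF J], of _ 2] in \<open>auto simp: power_mult_distrib\<close>)
    then show ?thesis by simp
  qed (use nn[of "V J"] in \<open>simp add: not_integrable_integral\<close>)
  then have "(\<Sum>J\<in>interior_idx m. integral {a..b} (\<lambda>y. (norm (Q J y))\<^sup>2))
      \<le> k\<^sup>2 * (\<Sum>J\<in>interior_idx m. integral {a..b} (\<lambda>y. (norm (V J y))\<^sup>2))"
    unfolding sum_distrib_left by (rule sum_mono)
  then show ?thesis
    unfolding L2h_norm_def by (simp add: sum_nonneg nn)
qed

text \<open>The lower bound on the step limits \<open>m\<close>, so this monotonicity bounds the
  number of grid lines for all admissible grids at once.\<close>

lemma card_interior_idx_le:
  assumes "m \<le> m'"
  shows "card (interior_idx m :: (nat^'n::finite) set) \<le> card (interior_idx m' :: (nat^'n) set)"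
  by (rule card_mono[OF finite_interior_idx])
    (use diff_le_mono[OF assms, of 1] in \<open>auto simp: interior_idx_def intro: order_trans\<close>)

text \<open>The order of the quantifiers expresses what a constant may depend on: \<open>K\<close>
  is introduced after the constants with its norm fixed as \<open>\<kappa>\<close>, and so are the
  grid and the boundary data; \<open>C3\<close> is chosen before \<open>R\<close>,
  \<open>lam1\<close> after it. The assumption on \<open>lam0\<close> likewise fixes the Carleman
  constant before the grid.\<close>

theorem theorem4p2:
  fixes A d a b h0 a0 lam0 \<kappa> :: real
    and mus :: "(real^'n::finite) \<times> real \<Rightarrow> real"
  assumes "A > 0" and "d > 0" and "1 < a" and "a < b" and "h0 > 0"
    and mus_C2: "C2_on UNIV mus" and mus_nonneg: "\<And>x. mus x \<ge> 0"
    and mus_supp: "\<And>x. x \<notin> Omega A a b \<Longrightarrow> mus x = 0"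
    and a0_gt: "a0 > 1"
    and a0: "\<And>a' b'. a0 \<le> a' \<Longrightarrow> a' < b' \<Longrightarrow>
       (\<forall>x \<in> closure (Omega A a' b' :: ((real^'n) \<times> real) set).
           invertible (D_mat d x :: real^'N::finite^'N)) \<and>
       bounded ((\<lambda>x. matrix_inv (D_mat d x :: real^'N^'N)) `
           closure (Omega A a' b' :: ((real^'n) \<times> real) set))"
    and lam0_ge: "lam0 \<ge> 1"
    and lam0: "a0 \<le> a \<Longrightarrow> \<exists>C>0. \<forall>m>1. step A m \<ge> h0 \<longrightarrow>
       carleman TYPE('n) TYPE('N) A d a b m C lam0"
  shows
    "(\<forall>R>0. \<forall>lam\<ge>0. \<exists>C4>0.
        \<forall>(K :: ((real^'n) \<times> real) \<times> real \<times> real \<Rightarrow> real) m (P :: ('n, 'N) sdf).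
          C2_on (Kdom A d a b) K \<and> (\<forall>p\<in>Kdom A d a b. K p \<ge> 0) \<and> C1_norm (Kdom A d a b) K = \<kappa> \<and>
          m > 1 \<and> step A m \<ge> h0 \<and> B_set A m a b R P \<noteq> {} \<longrightarrow>
          (\<forall>W \<in> B_closure A m a b R P. \<exists>!g. has_gradient A m a b (J_fun A d a b m mus K lam) W g) \<and>
          (\<forall>W1 \<in> B_closure A m a b R P. \<forall>W2 \<in> B_closure A m a b R P.
             H1h_norm A m a b (\<lambda>J y. gradient A m a b (J_fun A d a b m mus K lam) W1 J y
                                   - gradient A m a b (J_fun A d a b m mus K lam) W2 J y)
             \<le> C4 * H1h_norm A m a b (\<lambda>J y. W1 J y - W2 J y)))
     \<and>
     (a0 \<le> a \<longrightarrow> (\<exists>C3>0. \<forall>R>0. \<exists>lam1\<ge>lam0.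
        \<forall>(K :: ((real^'n) \<times> real) \<times> real \<times> real \<Rightarrow> real) m (P :: ('n, 'N) sdf).
          C2_on (Kdom A d a b) K \<and> (\<forall>p\<in>Kdom A d a b. K p \<ge> 0) \<and> C1_norm (Kdom A d a b) K = \<kappa> \<and>
          m > 1 \<and> step A m \<ge> h0 \<and> B_set A m a b R P \<noteq> {} \<longrightarrow>
          (\<forall>lam\<ge>lam1.
             (\<forall>W1 \<in> B_closure A m a b R P. \<forall>W2 \<in> B_closure A m a b R P.
                J_fun A d a b m mus K lam W2 - J_fun A d a b m mus K lam W1
                - H1h_inner A m a b (gradient A m a b (J_fun A d a b m mus K lam) W1) (\<lambda>J y. W2 J y - W1 J y)
                \<ge> C3 * exp (2 * lam * a) * (H1h_norm A m a b (\<lambda>J y. W2 J y - W1 J y))\<^sup>2)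
             \<and>
             (\<exists>!Wmin. is_arg_min (J_fun A d a b m mus K lam) (\<lambda>W. W \<in> B_closure A m a b R P) Wmin) \<and>
             (\<forall>Wmin. is_arg_min (J_fun A d a b m mus K lam) (\<lambda>W. W \<in> B_closure A m a b R P) Wmin \<longrightarrow>
                (\<forall>W \<in> B_closure A m a b R P.
                   H1h_inner A m a b (gradient A m a b (J_fun A d a b m mus K lam) Wmin)
                     (\<lambda>J y. W J y - Wmin J y) \<ge> 0)))))"
proof -
  have ab: "a < b" by fact
  interpret transport A d a b mus by unfold_locales (fact assms)+
  define G :: "nat \<Rightarrow> nat^'n \<Rightarrow> real \<Rightarrow> (real^'n) \<times> real" where "G = grid_point A"
  have G: "G m J y \<in> cl" if "J \<in> interior_idx m" "y \<in> {a..b}" for m J y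
    unfolding G_def by (rule grid_point_in_closure[OF A ab that])
  have G_cont: "continuous_on T (G m J)" for T m J unfolding G_def by (rule continuous_grid_point)
  have compact_image: "bounded (M ` cl)" if "continuous_on halfspace M" for M :: "(real^'n) \<times> real \<Rightarrow> real^'N^'N"
    by (intro compact_imp_bounded compact_continuous_image compact_closure_Omega A ab
        continuous_on_subset[OF that cl_halfspace])
  obtain cD where cD: "cD > 0" "\<And>x w. x \<in> cl \<Longrightarrow> norm ((D_mat d x :: real^'N^'N) *v w) \<le> cD * norm w"
    using matrix_vector_bounded[OF compact_image[OF continuous_D_mat]] by blast
  have "\<forall>i::'n. \<exists>c>0. \<forall>x\<in>cl. \<forall>w. norm ((A_mat d i x :: real^'N^'N) *v w) \<le> c * norm w"
    using matrix_vector_bounded[OF compact_image[OF continuous_A_mat]] by blast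
  then obtain cA where cA: "\<And>i::'n. cA i > 0" "\<And>i x w. x \<in> cl \<Longrightarrow> norm ((A_mat d i x :: real^'N^'N) *v w) \<le> cA i * norm w"
    by metis
  define c where "c = cD + (\<Sum>i\<in>UNIV. cA i)"
  have sum_cA: "cA i \<le> (\<Sum>i\<in>UNIV. cA i)" for i
    by (rule member_le_sum) (use cA(1) in \<open>auto intro: less_imp_le\<close>)
  have c: "c > 0" "cD \<le> c" "cA i \<le> c" for i
    using cD(1) sum_cA[of i] cA(1)[of i] by (auto simp: c_def)
  \<comment> \<open>\<open>step A m = 2 * A / m \<ge> h0\<close> forces
    \<open>m \<le> 2 * A / h0\<close>; the grid with the largest such integer has the most interior
    lines.\<close>
  define n0 where "n0 = real (card (interior_idx (nat \<lfloor>2 * A / h0\<rfloor>) :: (nat^'n) set))"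
  have card_le: "real (card (interior_idx m :: (nat^'n) set)) \<le> n0" if m: "m > 1" "step A m \<ge> h0" for m
  proof -
    have "real m \<le> 2 * A / h0" using m \<open>h0 > 0\<close> by (simp add: step_def field_simps)
    then have "m \<le> nat \<lfloor>2 * A / h0\<rfloor>" by linarith
    then show ?thesis unfolding n0_def by (simp add: card_interior_idx_le)
  qed
  let ?D = "\<lambda>m J y. D_mat d (G m J y) :: real^'N^'N"
  let ?B = "\<lambda>m i J y. A_mat d i (G m J y) :: real^'N^'N"
  let ?F = "\<lambda>K m J y w. F_vec d mus K w (G m J y) :: real^'N"
  let ?F' = "\<lambda>K m J y w p. dF d mus K (G m J y) w p :: real^'N"
  let ?ok = "\<lambda>K m. C2_on (Kdom A d a b) K \<and> C1_norm (Kdom A d a b) K = \<kappa> \<and> m > 1 \<and> step A m \<ge> h0"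
  \<comment> \<open>One \<open>C\<close> serves all \<open>K\<close>, \<open>m\<close> and
    \<open>lam\<close>, since \<open>F_estimates\<close> fixes it before the kernel and every
    interior grid line lies in the closed domain.\<close>
  have fn: "\<exists>C. \<forall>K m lam. ?ok K m \<and> lam \<ge> 0 \<longrightarrow>
      functional A a b m lam (?D m) (?B m) (?F K m) (?F' K m) c C R (sob a b * R + 1) n0" if R: "R > 0" for R
  proof -
    obtain C where C: "C > 0"
      "\<And>K x W. C2_on (Kdom A d a b) K \<Longrightarrow> C1_norm (Kdom A d a b) K = \<kappa> \<Longrightarrow> x \<in> cl \<Longrightarrow> norm W \<le> sob a b * R + 1 \<Longrightarrow>
         norm (F_vec d mus K W x :: real^'N) \<le> C"
      "\<And>K x W v. C2_on (Kdom A d a b) K \<Longrightarrow> C1_norm (Kdom A d a b) K = \<kappa> \<Longrightarrow> x \<in> cl \<Longrightarrow> norm W \<le> sob a b * R + 1 \<Longrightarrow>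
         norm (dF d mus K x W v :: real^'N) \<le> C * norm v"
      "\<And>K x W V v. C2_on (Kdom A d a b) K \<Longrightarrow> C1_norm (Kdom A d a b) K = \<kappa> \<Longrightarrow> x \<in> cl \<Longrightarrow>
         norm W \<le> sob a b * R + 1 \<Longrightarrow> norm V \<le> sob a b * R + 1 \<Longrightarrow>
         norm (dF d mus K x V v - dF d mus K x W v :: real^'N) \<le> C * norm (V - W) * norm v"
      "\<And>K x W V. C2_on (Kdom A d a b) K \<Longrightarrow> C1_norm (Kdom A d a b) K = \<kappa> \<Longrightarrow> x \<in> cl \<Longrightarrow>
         norm W \<le> sob a b * R + 1 \<Longrightarrow> norm V \<le> sob a b * R + 1 \<Longrightarrow>
         norm (F_vec d mus K V x - F_vec d mus K W x - dF d mus K x W (V - W) :: real^'N) \<le> C * (norm (V - W))\<^sup>2"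
      using F_estimates[where \<kappa> = \<kappa> and \<rho> = "sob a b * R + 1"] by blast
    have "functional A a b m lam (?D m) (?B m) (?F K m) (?F' K m) c C R (sob a b * R + 1) n0"
      if ok: "?ok K m" and lam: "lam \<ge> 0" for K m lam
    proof -
      have K: "C2_on (Kdom A d a b) K" "C1_norm (Kdom A d a b) K = \<kappa>" and m: "m > 1" "step A m \<ge> h0"
        using ok by auto
      have hs: "G m J y \<in> halfspace" if "J \<in> interior_idx m" "y \<in> {a..b}" for J y
        using G[OF that] cl_halfspace by blast
      show ?thesis
      proof
        show "a < b" "lam \<ge> 0" "c > 0" "C > 0" "R > 0" "sob a b * R + 1 \<le> sob a b * R + 1"
          by (simp_all add: ab lam c(1) C(1) R)
        show "step A m > 0" using m \<open>h0 > 0\<close> by linarith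
        show "real (card (interior_idx m :: (nat^'n) set)) \<le> n0" by (rule card_le[OF m])
        fix J :: "nat^'n" assume J: "J \<in> interior_idx m"
        show "continuous_on {a..b} (\<lambda>y. ?D m J y)"
          by (rule continuous_on_compose2[OF continuous_D_mat G_cont]) (use hs[OF J] in blast)
        show "continuous_on {a..b} (\<lambda>y. ?B m i J y)" for i
          by (rule continuous_on_compose2[OF continuous_A_mat G_cont]) (use hs[OF J] in blast)
        show "continuous_on {a..b} (\<lambda>y. ?F K m J y (f y))" if "continuous_on {a..b} f" for f
          by (rule F_vec_continuous[OF K G_cont G[OF J] that])
        show "continuous_on {a..b} (\<lambda>y. ?F' K m J y (f y) (g y))"
          if "continuous_on {a..b} f" "continuous_on {a..b} g" for f g
          by (rule dF_continuous[OF K G_cont G[OF J] that])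
        fix y assume y: "y \<in> {a..b}"
        note x = G[OF J y]
        show "norm (?D m J y *v w) \<le> c * norm w" for w
          by (rule order_trans[OF cD(2)[OF x]]) (intro mult_right_mono c norm_ge_zero)
        show "norm (?B m i J y *v w) \<le> c * norm w" for i w
          by (rule order_trans[OF cA(2)[OF x]]) (intro mult_right_mono c norm_ge_zero)
        show "?F' K m J y w (p + k *\<^sub>R q) = ?F' K m J y w p + k *\<^sub>R ?F' K m J y w q" for w p q k
          by (rule dF_comb[OF K x])
        fix w :: "real^'N" assume w: "norm w \<le> sob a b * R + 1"
        show "norm (?F K m J y w) \<le> C" by (rule C(2)[OF K x w])
        show "norm (?F' K m J y w p) \<le> C * norm p" for p by (rule C(3)[OF K x w])
        fix u :: "real^'N" assume u: "norm u \<le> sob a b * R + 1"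
        show "norm (?F' K m J y u p - ?F' K m J y w p) \<le> C * norm (u - w) * norm p" for p
          by (rule C(4)[OF K x w u])
        show "norm (?F K m J y u - ?F K m J y w - ?F' K m J y w (u - w)) \<le> C * (norm (u - w))\<^sup>2"
          by (rule C(5)[OF K x w u])
      qed
    qed
    then show ?thesis by blast
  qed
  have Jf: "functional.Jf A a b m lam (?D m) (?B m) (?F K m) = J_fun A d a b m mus K lam"
    if "functional A a b m lam (?D m) (?B m) (?F K m) (?F' K m) c C R \<rho> n0" for m lam K C R \<rho>
  proof -
    interpret fn: functional A a b m lam "?D m" "?B m" "?F K m" "?F' K m" c C R \<rho> n0 by (rule that)
    show ?thesis
      unfolding fun_eq_iff fn.Jf_def J_fun_def L2h_norm_eq_nrm
        fn.wt_def[abs_def] fn.res_def[abs_def] fn.Lop_def[abs_def] fn.N0_def[abs_def]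
      unfolding G_def by simp
  qed
  show ?thesis
  proof (intro conjI allI impI, goal_cases)
    case (1 R lam)
    note lam = 1(2)
    obtain C where C: "\<And>K m lam. ?ok K m \<and> lam \<ge> 0 \<Longrightarrow>
      functional A a b m lam (?D m) (?B m) (?F K m) (?F' K m) c C R (sob a b * R + 1) n0"
      using fn[OF 1(1)] by blast
    \<comment> \<open>\<open>K4\<close> is known to be positive only under the assumptions of the locale, that is, if an admissible \<open>K\<close> exists.\<close>
    define C4 where "C4 = \<bar>functional.K4 TYPE('n) a b lam c C R (sob a b * R + 1) n0\<bar> + 1"
    show ?case
    proof (rule exI[of _ C4], rule conjI, goal_cases)
      case 1
      show ?case by (simp add: C4_def)
    next
      case 2
      show ?case
      proof (intro allI impI, goal_cases)
        case (1 K m P)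
        then have K: "C2_on (Kdom A d a b) K" "C1_norm (Kdom A d a b) K = \<kappa>" and m: "m > 1" "step A m \<ge> h0"
          and ne: "B_set A m a b R P \<noteq> {}" by blast+
        have func: "functional A a b m lam (?D m) (?B m) (?F K m) (?F' K m) c C R (sob a b * R + 1) n0"
          by (rule C) (use K m lam in simp)
        interpret fn: functional A a b m lam "?D m" "?B m" "?F K m" "?F' K m" c C R "sob a b * R + 1" n0
          by (rule func)
        note Jf = Jf[OF func]
        show ?case
          unfolding fn.Bset_eq_closure[OF ne] Jf[symmetric]
        proof (intro conjI ballI)
          show "\<exists>!g. has_gradient A m a b fn.Jf W g" if "W \<in> fn.Bset P" for W
            by (rule fn.gradient_ex1[OF fn.BsetD(1)[OF that]])
          fix W1 W2 assume W: "W1 \<in> fn.Bset P" "W2 \<in> fn.Bset P"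
          note diff = fn.Bset_diff[OF W]
          have "H1h_norm A m a b (\<lambda>J y. gradient A m a b fn.Jf W1 J y - gradient A m a b fn.Jf W2 J y)
              \<le> fn.K4 * H1h_norm A m a b (\<lambda>J y. W1 J y - W2 J y)"
            by (rule fn.gradient_lipschitz[OF fn.BsetD(1)[OF W(2)] fn.BsetD(1)[OF W(1)] diff])
          also have "\<dots> \<le> C4 * H1h_norm A m a b (\<lambda>J y. W1 J y - W2 J y)"
            by (intro mult_right_mono fn.X0.nrm_nonneg diff) (simp add: C4_def)
          finally show "H1h_norm A m a b (\<lambda>J y. gradient A m a b fn.Jf W1 J y - gradient A m a b fn.Jf W2 J y)
              \<le> C4 * H1h_norm A m a b (\<lambda>J y. W1 J y - W2 J y)" .
        qed
      qed
    qed
  next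
    case 2
    note a0a = 2
    have inv: "invertible (D_mat d x :: real^'N^'N)" if "x \<in> cl" for x
      using a0[OF a0a ab] that by blast
    obtain ci where ci: "ci > 0" "\<And>x w. x \<in> cl \<Longrightarrow> norm (matrix_inv (D_mat d x :: real^'N^'N) *v w) \<le> ci * norm w"
      using matrix_vector_bounded[of "\<lambda>x. matrix_inv (D_mat d x :: real^'N^'N)" cl] a0[OF a0a ab] by blast
    obtain C0 where C0: "C0 > 0" "\<And>m. m > 1 \<Longrightarrow> step A m \<ge> h0 \<Longrightarrow> carleman TYPE('n) TYPE('N) A d a b m C0 lam0"
      using lam0[OF a0a] by blast
    \<comment> \<open>The Carleman estimate concerns \<open>matrix_inv\<close> of
      \<open>D_mat\<close> applied to \<open>Lop v\<close>; removing the inverse costs its squared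
      bound \<open>ci\<^sup>2\<close>.\<close>
    define C1 where "C1 = C0 / ci\<^sup>2"
    have C1: "C1 > 0" using C0(1) ci(1) by (simp add: C1_def)
    define C3 where "C3 = C1 / (4 * (real CARD('n) * (1 + 1 / h0\<^sup>2)))"
    have C3: "C3 > 0"
      unfolding C3_def using C1 \<open>h0 > 0\<close> by (intro divide_pos_pos mult_pos_pos add_pos_pos) auto
    show ?case
    proof (rule exI[of _ C3], rule conjI[OF C3], intro allI impI, goal_cases)
      case (1 R)
      obtain C where C: "\<And>K m lam. ?ok K m \<and> lam \<ge> 0 \<Longrightarrow>
        functional A a b m lam (?D m) (?B m) (?F K m) (?F' K m) c C R (sob a b * R + 1) n0"
        using fn[OF 1] by blast
      \<comment> \<open>The threshold of \<open>lower_bound\<close>; \<open>Cq\<close> and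
        \<open>KR\<close> are expressions in \<open>C\<close>, \<open>R\<close>, \<open>c\<close>,
        \<open>n0\<close> and the interval, so it can be fixed before the kernel, the grid and
        \<open>lam\<close>.\<close>
      define lam1 where "lam1 = max lam0
        (4 * ((functional.Cq C (sob a b * R + 1))\<^sup>2 + functional.KR TYPE('n) a b c C R n0 * C) / C1)"
      show ?case
      proof (rule exI[of _ lam1], rule conjI, goal_cases)
        case 1
        show ?case by (simp add: lam1_def)
      next
        case 2
        show ?case
        proof (intro allI impI, goal_cases)
          case (1 K m P lam)
          note lam = 1(2)
          from 1(1) have K: "C2_on (Kdom A d a b) K" "C1_norm (Kdom A d a b) K = \<kappa>" and m: "m > 1" "step A m \<ge> h0"
            and ne: "B_set A m a b R P \<noteq> {}" by blast+
          have lam': "lam0 \<le> lam" "1 \<le> lam" "0 \<le> lam" using lam lam0_ge by (auto simp: lam1_def)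
          have func: "functional A a b m lam (?D m) (?B m) (?F K m) (?F' K m) c C R (sob a b * R + 1) n0"
            by (rule C) (use K m lam' in simp)
          interpret fn: functional A a b m lam "?D m" "?B m" "?F K m" "?F' K m" c C R "sob a b * R + 1" n0
            by (rule func)
          note Jf = Jf[OF func]
          have large: "4 * (fn.Cq\<^sup>2 + fn.KR * C) / C1 \<le> lam" using lam by (simp add: lam1_def)
          have carl: "C1 * ((fn.nY (fn.wt (y_deriv a b v)))\<^sup>2 + lam\<^sup>2 * (fn.nY (fn.wt v))\<^sup>2) \<le> (fn.nY (fn.wt (fn.Lop v)))\<^sup>2"
            if v: "v \<in> fn.H0" for v
          proof -
            let ?Q = "\<lambda>J y. exp (lam * y) *\<^sub>R (y_deriv a b v J y +
              (\<Sum>i\<in>UNIV. (matrix_inv (?D m J y) ** ?B m i J y) *v x_diff A m i v J y))"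
            have "C0 * ((L2h_norm m a b (\<lambda>J y. exp (lam * y) *\<^sub>R y_deriv a b v J y))\<^sup>2 +
                lam\<^sup>2 * (L2h_norm m a b (\<lambda>J y. exp (lam * y) *\<^sub>R v J y))\<^sup>2) \<le> (L2h_norm m a b ?Q)\<^sup>2"
              using C0(2)[OF m] v lam'(1) unfolding carleman_def G_def by blast
            also have "\<dots> \<le> ci\<^sup>2 * (L2h_norm m a b (fn.wt (fn.Lop v)))\<^sup>2"
            proof (rule L2h_norm_le[OF fn.wt_in[OF fn.Lop_in[OF H1h0_D(1)[OF v]]]])
              fix J :: "nat^'n" and y assume J: "J \<in> interior_idx m" and y: "y \<in> {a..b}"
              note x = G[OF J y]
              have "matrix_inv (?D m J y) ** ?D m J y = mat 1"
                using inv[OF x] unfolding invertible_def matrix_inv_def by (metis (mono_tags, lifting) someI_ex)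
              \<comment> \<open>Written in this way, the derivative term lets the inverse matrix
                factor out of the whole operator.\<close>
              then have "y_deriv a b v J y = matrix_inv (?D m J y) *v (?D m J y *v y_deriv a b v J y)"
                by (simp add: matrix_vector_mul_assoc)
              then have "?Q J y = exp (lam * y) *\<^sub>R (matrix_inv (?D m J y) *v fn.Lop v J y)"
                unfolding fn.Lop_def
                by (simp add: matrix_vector_right_distrib matrix_vector_mul_assoc linear_sum[OF matrix_vector_mul_linear] o_def)
              then show "norm (?Q J y) \<le> ci * norm (fn.wt (fn.Lop v) J y)"
                using mult_left_mono[OF ci(2)[OF x, of "fn.Lop v J y"], of "exp (lam * y)"]
                by (simp add: fn.wt_def mult_ac)
            qed (use ci(1) in simp)
            finally have "C0 * ((fn.nY (fn.wt (y_deriv a b v)))\<^sup>2 + lam\<^sup>2 * (fn.nY (fn.wt v))\<^sup>2)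
                \<le> ci\<^sup>2 * (fn.nY (fn.wt (fn.Lop v)))\<^sup>2"
              unfolding L2h_norm_eq_nrm fn.wt_def[abs_def] .
            then show ?thesis using ci(1) by (simp add: C1_def field_simps)
          qed
          have conv: "C3 * exp (2 * lam * a) * (fn.nX (\<lambda>J y. V J y - W J y))\<^sup>2
              \<le> fn.Jf V - fn.Jf W - fn.dJ W (\<lambda>J y. V J y - W J y)"
            if W: "W \<in> fn.Bset P" and V: "V \<in> fn.Bset P" for W V
          proof -
            note v = fn.Bset_diff[OF V W]
            have eq: "(\<lambda>J y. W J y + (V J y - W J y)) = V" by simp
            show ?thesis
              using fn.strict_convexity[OF lam'(2) v fn.BsetD(1)[OF W] _ C1 large carl[OF v] \<open>h0 > 0\<close> m(2)]
              unfolding eq C3_def using fn.BsetD(1)[OF V] by blast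
          qed
          have B_ne: "fn.Bset P \<noteq> {}"
            using ne fn.Bset_eq_closure[OF ne] by (force simp: B_set_def fn.Bset_def)
          have k: "C3 * exp (2 * lam * a) > 0" using C3 by simp
          have grad: "H1h_inner A m a b (gradient A m a b fn.Jf W) (\<lambda>J y. V J y - W J y) = fn.dJ W (\<lambda>J y. V J y - W J y)"
            if W: "W \<in> fn.Bset P" and V: "V \<in> fn.Bset P" for W V
            by (rule fn.gradient_props(2)[OF fn.BsetD(1)[OF W] fn.Bset_diff[OF V W]])
          show ?case
            unfolding fn.Bset_eq_closure[OF ne] Jf[symmetric]
          proof (intro conjI ballI allI impI)
            show "C3 * exp (2 * lam * a) * (H1h_norm A m a b (\<lambda>J y. W2 J y - W1 J y))\<^sup>2
                \<le> fn.Jf W2 - fn.Jf W1 - H1h_inner A m a b (gradient A m a b fn.Jf W1) (\<lambda>J y. W2 J y - W1 J y)"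
              if "W1 \<in> fn.Bset P" "W2 \<in> fn.Bset P" for W1 W2
              unfolding grad[OF that] by (rule conv[OF that])
            show "\<exists>!Wmin. is_arg_min fn.Jf (\<lambda>W. W \<in> fn.Bset P) Wmin"
              by (rule fn.minimizer(1)[OF B_ne k]) (rule conv)
            show "0 \<le> H1h_inner A m a b (gradient A m a b fn.Jf Wmin) (\<lambda>J y. W J y - Wmin J y)"
              if Wmin: "is_arg_min fn.Jf (\<lambda>W. W \<in> fn.Bset P) Wmin" and W: "W \<in> fn.Bset P" for Wmin W
            proof -
              have WB: "Wmin \<in> fn.Bset P" using Wmin by (simp add: is_arg_min_def)
              show ?thesis
                unfolding grad[OF WB W] by (rule fn.minimizer(2)[OF B_ne k _ Wmin W]) (rule conv)
            qed
          qed
        qed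
      qed
    qed
  qed
qed

end
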